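(* Let $k$ be a field of characteristic $0$. For any fixed $r\ge 1$ and $J=(j_1,\dots,j_r)\in\mathbb{N}^r$, the characters $\chi_{R^{(r)}_J(n)}$ of the $S_n$-representations $R^{(r)}_J(n)$ are eventually polynomial in $n$ of degree at most $|J|$: there exist $N$ and a character polynomial $P$ of degree at most $|J|$ such that $\chi_{R^{(r)}_J(n)}(\sigma)=P(\sigma)$ for all $n\ge N$ and all $\sigma\in S_n$. In particular there exists a polynomial $P_J^{(r)}(n)$ of degree at most $|J|$ such that $\dim(R^{(r)}_J(n))=P^{(r)}_J(n)$ for all $n\gg 0$.
   Context: For $n\ge0$ the symmetric group $S_n$ acts on $k[x_1^{(1)},\dots,x_n^{(1)},\dots,x_1^{(r)},\dots,x_n^{(r)}]$ by $\sigma\cdot x_j^{(i)}=x_{\sigma(j)}^{(i)}$. Let $I_n$ be the ideal generated by the $S_n$-invariant polynomials with vanishing constant term. The $r$-diagonal coinvariant algebra is $R^{(r)}(n)=k[x_j^{(i)}]/I_n$. A monomial has multi-grading $J=(j_1,\dots,j_r)$ if its total degree in $x_1^{(a)},\dots,x_n^{(a)}$ is $j_a$ for each $a$; this descends to an $S_n$-invariant multi-grading $R^{(r)}(n)=\bigoplus_J R^{(r)}_J(n)$. Put $|J|=j_1+\cdots+j_r$. A character polynomial is a polynomial with rational coefficients in $X_1,X_2,\dots$, where $X_i(\sigma)$ is the number of $i$-cycles of $\sigma\in S_n$; its degree is defined by $\deg(X_i)=i$. *)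

theory Defs
  imports
    "HOL-Library.Poly_Mapping"
    "HOL-Computational_Algebra.Polynomial"
    "HOL-Combinatorics.Permutations"
    "HOL-Combinatorics.Orbits"
    "HOL-Algebra.QuotRing"
    "HOL-Algebra.Embedded_Algebras"
begin

section \<open>Multivariate polynomials\<close>

text \<open>Monomials are finitely supported exponent vectors; polynomials are finitely supported
  coefficient functions on monomials, with the convolution product of \<open>Poly_Mapping\<close>.\<close>

type_synonym ('v, 'k) mpoly = "('v \<Rightarrow>\<^sub>0 nat) \<Rightarrow>\<^sub>0 'k"

definition Const :: "'k::zero \<Rightarrow> ('v, 'k) mpoly" where
  "Const c = Poly_Mapping.single 0 c"

definition Var :: "'v \<Rightarrow> ('v, 'k::zero_neq_one) mpoly" where
  "Var v = Poly_Mapping.single (Poly_Mapping.single v 1) 1"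

text \<open>Substitute \<open>f v\<close> for every variable \<open>v\<close>, applying \<open>h\<close> to the coefficients.\<close>

definition mpoly_subst ::
    "('k::zero \<Rightarrow> 'b) \<Rightarrow> ('v \<Rightarrow> 'b) \<Rightarrow> ('v, 'k) mpoly \<Rightarrow> 'b::comm_semiring_1" where
  "mpoly_subst h f p =
     (\<Sum>m\<in>Poly_Mapping.keys p. h (Poly_Mapping.lookup p m) *
        (\<Prod>v\<in>Poly_Mapping.keys m. f v ^ Poly_Mapping.lookup m v))"


section \<open>Diagonal coinvariant algebras\<close>

text \<open>The variable \<open>(i, j)\<close> with \<open>i < r\<close>, \<open>j < n\<close> stands for $x_{j+1}^{(i+1)}$, and $S_n$ consists
  of the \<open>\<sigma>\<close> with \<open>\<sigma> permutes {..<n}\<close>.\<close>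

definition diag_poly_ring :: "nat \<Rightarrow> nat \<Rightarrow> (nat \<times> nat, 'k::comm_ring_1) mpoly ring" where
  "diag_poly_ring r n =
     \<lparr>carrier = {p. \<forall>m\<in>Poly_Mapping.keys p. Poly_Mapping.keys m \<subseteq> {..<r} \<times> {..<n}},
      mult = (*), one = 1, zero = 0, add = (+)\<rparr>"

definition perm_act ::
    "(nat \<Rightarrow> nat) \<Rightarrow> (nat \<times> nat, 'k::comm_ring_1) mpoly \<Rightarrow> (nat \<times> nat, 'k) mpoly" where
  "perm_act \<sigma> = mpoly_subst Const (\<lambda>(i, j). Var (i, \<sigma> j))"

definition coinv_ideal :: "nat \<Rightarrow> nat \<Rightarrow> (nat \<times> nat, 'k::comm_ring_1) mpoly set" where
  "coinv_ideal r n =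
     Idl\<^bsub>diag_poly_ring r n\<^esub>
       {p \<in> carrier (diag_poly_ring r n).
          (\<forall>\<sigma>. \<sigma> permutes {..<n} \<longrightarrow> perm_act \<sigma> p = p) \<and> Poly_Mapping.lookup p 0 = 0}"

definition coinv_alg :: "nat \<Rightarrow> nat \<Rightarrow> (nat \<times> nat, 'k::comm_ring_1) mpoly set ring" where
  "coinv_alg r n = diag_poly_ring r n Quot coinv_ideal r n"

definition coinv_class ::
    "nat \<Rightarrow> nat \<Rightarrow> (nat \<times> nat, 'k::comm_ring_1) mpoly \<Rightarrow> (nat \<times> nat, 'k) mpoly set" where
  "coinv_class r n p = coinv_ideal r n +>\<^bsub>diag_poly_ring r n\<^esub> p"

text \<open>The structure map from \<open>k\<close> to the coinvariant algebra. Its range is the copy of \<open>k\<close> over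
  which dimensions are taken.\<close>

definition coinv_const :: "nat \<Rightarrow> nat \<Rightarrow> 'k::comm_ring_1 \<Rightarrow> (nat \<times> nat, 'k) mpoly set" where
  "coinv_const r n c = coinv_class r n (Const c)"

definition has_multidegree ::
    "nat \<Rightarrow> nat list \<Rightarrow> nat \<Rightarrow> (nat \<times> nat, 'k::zero) mpoly \<Rightarrow> bool" where
  "has_multidegree r J n p \<longleftrightarrow>
     (\<forall>m\<in>Poly_Mapping.keys p. \<forall>a<r. (\<Sum>j<n. Poly_Mapping.lookup m (a, j)) = J ! a)"

definition coinv_component ::
    "nat \<Rightarrow> nat list \<Rightarrow> nat \<Rightarrow> (nat \<times> nat, 'k::comm_ring_1) mpoly set set" where
  "coinv_component r J n =
     coinv_class r n ` {p \<in> carrier (diag_poly_ring r n). has_multidegree r J n p}"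

text \<open>Since the ideal is $S_n$-stable, the image of the coset of \<open>p\<close> under \<open>perm_act \<sigma>\<close> is the coset
  of \<open>perm_act \<sigma> p\<close>; so the induced action on the quotient is given by taking images.\<close>

definition coinv_act ::
    "(nat \<Rightarrow> nat) \<Rightarrow> (nat \<times> nat, 'k::comm_ring_1) mpoly set \<Rightarrow> (nat \<times> nat, 'k) mpoly set" where
  "coinv_act \<sigma> C = perm_act \<sigma> ` C"


section \<open>Traces and characters\<close>

text \<open>\<open>A\<close> is a ring that is an algebra over the field \<open>'k\<close> through the injective ring homomorphism
  \<open>h\<close>, and \<open>T\<close> is a linear endomorphism of the finite-dimensional subspace \<open>E\<close> of \<open>A\<close>. The trace
  of \<open>T\<close> is the sum of the diagonal entries of the matrix \<open>M\<close> of \<open>T\<close> with respect to a basis \<open>Us\<close>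
  of \<open>E\<close>; it does not depend on the basis.\<close>

definition lin_trace ::
    "('a, 'b) ring_scheme \<Rightarrow> ('k::field \<Rightarrow> 'a) \<Rightarrow> 'a set \<Rightarrow> ('a \<Rightarrow> 'a) \<Rightarrow> 'k" where
  "lin_trace A h E T =
     (THE t. \<exists>Us M. ring.independent A (range h) Us \<and> ring.Span A (range h) Us = E \<and>
        (\<forall>j<length Us. T (Us ! j) =
           ring.combine A (map (\<lambda>i. h (M i j)) [0..<length Us]) Us) \<and>
        t = (\<Sum>i<length Us. M i i))"

definition coinv_character :: "nat \<Rightarrow> nat list \<Rightarrow> nat \<Rightarrow> (nat \<Rightarrow> nat) \<Rightarrow> 'k::field" where
  "coinv_character r J n \<sigma> =
     lin_trace (coinv_alg r n) (coinv_const r n) (coinv_component r J n) (coinv_act \<sigma>)"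


section \<open>Character polynomials\<close>

definition cycle_count :: "nat \<Rightarrow> (nat \<Rightarrow> nat) \<Rightarrow> nat \<Rightarrow> nat" where
  "cycle_count n \<sigma> i = card {C. \<exists>x<n. C = orbit \<sigma> x \<and> card C = i}"

text \<open>The variables are \<open>X\<^sub>i\<close> for \<open>i \<ge> 1\<close>, so the index \<open>0\<close> must not occur.\<close>

definition is_char_poly :: "(nat, rat) mpoly \<Rightarrow> bool" where
  "is_char_poly P \<longleftrightarrow> (\<forall>m\<in>Poly_Mapping.keys P. 0 \<notin> Poly_Mapping.keys m)"

definition char_poly_degree_le :: "(nat, rat) mpoly \<Rightarrow> nat \<Rightarrow> bool" where
  "char_poly_degree_le P d \<longleftrightarrow>
     (\<forall>m\<in>Poly_Mapping.keys P. (\<Sum>i\<in>Poly_Mapping.keys m. i * Poly_Mapping.lookup m i) \<le> d)"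

definition char_poly_eval :: "(nat, rat) mpoly \<Rightarrow> nat \<Rightarrow> (nat \<Rightarrow> nat) \<Rightarrow> rat" where
  "char_poly_eval P n \<sigma> = mpoly_subst id (\<lambda>i. of_nat (cycle_count n \<sigma> i)) P"

end

theory Submission
  imports Defs
begin

text \<open>Write \<open>S\<close> for the polynomial ring, \<open>\<Lambda>\<close> for its ring of \<open>S\<^sub>n\<close>-invariants and \<open>I\<close> for the ideal
  generated by the invariants without constant term, so that \<open>S / I\<close> is the coinvariant algebra.
  The theorem holds because in total degree at most \<open>n / 3\<close> the ring \<open>S\<close> is a free \<open>\<Lambda>\<close>-module.

  In these degrees \<open>\<Lambda>\<close> has the basis of orbit sums \<open>msym r n \<mu>\<close>, one for each multiset \<open>\<mu>\<close> of nonzero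
  vectors in \<open>\<nat>\<^sup>r\<close>, and the possible \<open>\<mu>\<close> do not depend on \<open>n\<close>. Choose for every multidegree \<open>D\<close>
  polynomials \<open>b\<^sub>D\<close> that form a basis modulo \<open>I\<close>. Freeness says that the products of \<open>msym r n \<mu>\<close>
  with the members of \<open>b\<close> of degree \<open>J - |\<mu>|\<close> form a basis of the component of \<open>S\<close> of multidegree \<open>J\<close>,
  where \<open>|\<mu>|\<close> is the sum of \<open>\<mu>\<close>. A permutation \<open>\<sigma>\<close> fixes the orbit sums, and on \<open>b\<^sub>D\<close> it acts by the matrix of
  its action on the coinvariants up to errors in \<open>I\<close>, which only involve products with a larger \<open>\<mu>\<close>.
  The action is block triangular, and comparing its trace with the trace in the basis of monomials
  (\<open>trace_mod_ideal_sum\<close>) shows that the number of monomials of multidegree \<open>J\<close> fixed by \<open>\<sigma>\<close> is the sum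
  over \<open>\<mu>\<close> of the characters of the coinvariants in degree \<open>J - |\<mu>|\<close>. The summand for the empty \<open>\<mu>\<close> is
  the wanted character and all others have smaller degree. By induction the character is a character
  polynomial of degree at most the total degree of \<open>J\<close>, once this is known for the number of fixed monomials
  (\<open>char_poly_on_fixed_words\<close>). The latter is a coefficient of the product over all cycles \<open>C\<close> and
  all \<open>a\<close> of \<open>1 / (1 - q\<^sub>a\<^bsup>|C|\<^esup>)\<close>, and the logarithmic derivative of this product gives a recursion
  whose coefficients are multiples of the \<open>X\<^sub>i\<close>. The dimension is the character at the identity, where
  \<open>X\<^sub>1 = n\<close> and the other \<open>X\<^sub>i\<close> vanish.

  For freeness the spanning property is formal, and independence reduces to
  \<open>lowest_relation_in_sym_ideal\<close>: in a relation between the orbit sums, the coefficients of the orbit sums of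
  lowest degree lie in \<open>I\<close>. To see this, fix a small set \<open>T\<close> of indices and average the relation over the
  permutations of the complement of \<open>T\<close>. The polynomials invariant under that smaller group form a
  free module over \<open>k[x\<^sub>j | j \<in> T]\<close> with the full orbit sums as a basis (\<open>invariant_decomposition\<close>,
  \<open>msym_independent\<close>), and comparing coefficients puts the averages of the lowest coefficients into \<open>I\<close>.
  Finally a polynomial \<open>h\<close> all of whose averages lie in a stable subspace lies in it
  itself: Maschke's projection \<open>P\<close> onto the subspace commutes with averaging, so all averages of \<open>h - P h\<close>
  vanish, and averaging over the complement of \<open>T\<close> does not change the coefficient of a monomial
  that only involves indices in \<open>T\<close>.\<close>

section \<open>Monomials and their columns\<close>

abbreviation keys where "keys \<equiv> Poly_Mapping.keys"
abbreviation lookup where "lookup \<equiv> Poly_Mapping.lookup"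
abbreviation single where "single \<equiv> Poly_Mapping.single"

type_synonym 'k dpoly = "(nat \<times> nat, 'k) mpoly"

text \<open>The notation \<open>inv\<close> for inverse functions is ambiguous with the inverses of a group.\<close>

abbreviation pinv :: "(nat \<Rightarrow> nat) \<Rightarrow> nat \<Rightarrow> nat" where "pinv \<equiv> inv_into UNIV"

type_synonym word = "nat \<times> nat \<Rightarrow>\<^sub>0 nat"

definition tdeg :: "('a \<Rightarrow>\<^sub>0 nat) \<Rightarrow> nat" where
  "tdeg p = (\<Sum>x\<in>keys p. lookup p x)"

lemma tdeg_superset: "finite A \<Longrightarrow> keys p \<subseteq> A \<Longrightarrow> tdeg p = (\<Sum>x\<in>A. lookup p x)"
  unfolding tdeg_def by (rule sum.mono_neutral_left) (auto simp: in_keys_iff)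

lemma tdeg_add [simp]: "tdeg (p + q) = tdeg p + tdeg q"
  unfolding tdeg_def by (rule setsum_keys_plus_distrib) auto

lemma tdeg_zero [simp]: "tdeg 0 = 0"
  by (simp add: tdeg_def)

lemma tdeg_eq_0_iff [simp]: "tdeg p = 0 \<longleftrightarrow> p = 0"
proof
  assume "tdeg p = 0"
  then have "\<forall>x\<in>keys p. lookup p x = 0" by (simp add: tdeg_def)
  then have "keys p = {}" by (auto simp: in_keys_iff simp del: keys_eq_empty)
  then show "p = 0" by simp
qed simp

lemma lookup_le_tdeg: "lookup p x \<le> tdeg p"
  by (cases "x \<in> keys p") (auto simp: tdeg_def in_keys_iff intro: member_le_sum)

lemma tdeg_sum: "tdeg (sum f A) = (\<Sum>x\<in>A. tdeg (f x))"
  by (induction A rule: infinite_finite_induct) auto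

lemma tdeg_single [simp]: "tdeg (single x c) = c"
  by (simp add: tdeg_def)

abbreviation wt :: "('a \<Rightarrow>\<^sub>0 nat) multiset \<Rightarrow> nat" where
  "wt \<mu> \<equiv> tdeg (sum_mset \<mu>)"

text \<open>Column \<open>j\<close> of a monomial collects the exponents of the variables \<open>(a, j)\<close> for all \<open>a\<close>. Permutations
  move the columns, so a monomial is determined up to the action by the multiset of its nonzero columns.\<close>

definition column :: "word \<Rightarrow> nat \<Rightarrow> nat \<Rightarrow>\<^sub>0 nat" where
  "column w j = Poly_Mapping.map_key (\<lambda>a. (a, j)) w"

lemma inj_pair: "inj (\<lambda>a. (a, j))"
  by (auto simp: inj_def)

lemma lookup_column [simp]: "lookup (column w j) a = lookup w (a, j)"
  unfolding column_def by (simp add: map_key.rep_eq[OF inj_pair])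

lemma column_add: "column (v + w) j = column v j + column w j"
  by (rule poly_mapping_eqI) (simp add: lookup_add)

definition cols :: "word \<Rightarrow> nat set" where
  "cols w = snd ` keys w"

lemma finite_cols [simp]: "finite (cols w)"
  by (simp add: cols_def)

lemma cols_iff: "j \<in> cols w \<longleftrightarrow> column w j \<noteq> 0"
proof -
  have "j \<in> cols w \<longleftrightarrow> (\<exists>a. lookup w (a, j) \<noteq> 0)"
    by (force simp: cols_def in_keys_iff image_iff)
  also have "\<dots> \<longleftrightarrow> column w j \<noteq> 0"
    by (metis lookup_column poly_mapping_eqI lookup_zero)
  finally show ?thesis .
qed

lemma word_eqI: "(\<And>j. column v j = column w j) \<Longrightarrow> v = w"
  by (rule poly_mapping_eqI) (metis lookup_column surj_pair)

definition coltype :: "word \<Rightarrow> (nat \<Rightarrow>\<^sub>0 nat) multiset" where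
  "coltype w = image_mset (column w) (mset_set (cols w))"

definition mdeg :: "word \<Rightarrow> nat \<Rightarrow>\<^sub>0 nat" where
  "mdeg w = (\<Sum>j\<in>cols w. column w j)"

lemma sum_mset_coltype: "sum_mset (coltype w) = mdeg w"
  by (simp add: coltype_def mdeg_def sum_unfold_sum_mset)

lemma mdeg_superset: "finite A \<Longrightarrow> cols w \<subseteq> A \<Longrightarrow> mdeg w = (\<Sum>j\<in>A. column w j)"
  unfolding mdeg_def by (rule sum.mono_neutral_left) (auto simp: cols_iff)

lemma cols_add: "cols (v + w) = cols v \<union> cols w"
proof -
  have "a + b \<noteq> 0 \<longleftrightarrow> a \<noteq> 0 \<or> b \<noteq> 0" for a b :: "nat \<Rightarrow>\<^sub>0 nat"
    by (metis add_is_0 tdeg_add tdeg_eq_0_iff)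
  then show ?thesis by (auto simp: cols_iff column_add)
qed

lemma mdeg_add [simp]: "mdeg (v + w) = mdeg v + mdeg w"
proof -
  let ?A = "cols v \<union> cols w"
  have "mdeg (v + w) = (\<Sum>j\<in>?A. column (v + w) j)"
    by (rule mdeg_superset) (auto simp: cols_add)
  also have "\<dots> = (\<Sum>j\<in>?A. column v j) + (\<Sum>j\<in>?A. column w j)"
    by (simp add: column_add sum.distrib)
  finally show ?thesis
    using mdeg_superset[of ?A v] mdeg_superset[of ?A w] by simp
qed

lemma cols_zero [simp]: "cols 0 = {}"
  by (simp add: cols_def)

lemma coltype_zero [simp]: "coltype 0 = {#}"
  by (simp add: coltype_def)

lemma mdeg_zero [simp]: "mdeg 0 = 0"
  by (simp add: mdeg_def)

lemma tdeg_mdeg [simp]: "tdeg (mdeg w) = tdeg w"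
proof -
  let ?A = "fst ` keys w"
  have "tdeg w = (\<Sum>x\<in>?A \<times> cols w. lookup w x)"
    by (rule tdeg_superset) (force simp: cols_def)+
  also have "\<dots> = (\<Sum>j\<in>cols w. \<Sum>a\<in>?A. lookup w (a, j))"
    by (subst sum.swap) (simp add: sum.cartesian_product)
  also have "\<dots> = (\<Sum>j\<in>cols w. tdeg (column w j))"
    by (intro sum.cong refl, subst tdeg_superset[of ?A]) (force simp: in_keys_iff image_iff)+
  finally show ?thesis by (simp add: mdeg_def tdeg_sum)
qed

lemma tdeg_coltype: "tdeg (sum_mset (coltype w)) = tdeg w"
  by (simp add: sum_mset_coltype)

lemma coltype_eq_empty_iff [simp]: "coltype w = {#} \<longleftrightarrow> w = 0"
proof
  assume "coltype w = {#}"
  then have "tdeg w = 0" using tdeg_coltype[of w] by simp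
  then show "w = 0" by simp
qed simp

definition words :: "nat \<Rightarrow> nat set \<Rightarrow> word set" where
  "words r S = {w. keys w \<subseteq> {..<r} \<times> S}"

lemma words_cols: "w \<in> words r S \<Longrightarrow> cols w \<subseteq> S"
  by (auto simp: words_def cols_def)

lemma words_add: "v + w \<in> words r S \<longleftrightarrow> v \<in> words r S \<and> w \<in> words r S"
proof -
  have "keys (v + w) = keys v \<union> keys w"
    by (auto simp: in_keys_iff lookup_add)
  then show ?thesis by (auto simp: words_def)
qed

lemma words_zero [simp]: "0 \<in> words r S"
  by (simp add: words_def)

lemma words_mono: "S \<subseteq> T \<Longrightarrow> w \<in> words r S \<Longrightarrow> w \<in> words r T"
  by (auto simp: words_def)

lemma finite_words:
  assumes "finite S"
  shows "finite {w \<in> words r S. tdeg w \<le> N}"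
proof -
  let ?A = "{..<r} \<times> S"
  let ?F = "{f. (\<forall>x\<in>?A. f x \<in> {..N}) \<and> (\<forall>x. x \<notin> ?A \<longrightarrow> f x = (0::nat))}"
  have "finite ?F"
    by (rule finite_subset[OF _ finite_set_of_finite_funs[of ?A "{..N}" 0]]) (use assms in auto)
  moreover have "lookup ` {w \<in> words r S. tdeg w \<le> N} \<subseteq> ?F"
    by (auto simp: words_def in_keys_iff subset_iff intro: order_trans[OF lookup_le_tdeg])
  ultimately have "finite (lookup ` {w \<in> words r S. tdeg w \<le> N})"
    using finite_subset by blast
  then show ?thesis
    by (rule finite_imageD) (auto simp: inj_on_def poly_mapping_eqI)
qed

text \<open>The factor of a monomial that involves the columns in \<open>T\<close>.\<close>

definition restr :: "nat set \<Rightarrow> word \<Rightarrow> word" where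
  "restr T w = Poly_Mapping.mapp (\<lambda>x c. c when snd x \<in> T) w"

lemma lookup_restr: "lookup (restr T w) x = (lookup w x when snd x \<in> T)"
  by (auto simp: restr_def lookup_mapp when_def in_keys_iff)

lemma restr_split: "restr T w + restr (- T) w = w"
  by (rule poly_mapping_eqI) (auto simp: lookup_add lookup_restr when_def)

lemma restr_add: "restr T (v + w) = restr T v + restr T w"
  by (rule poly_mapping_eqI) (auto simp: lookup_add lookup_restr when_def)

lemma column_restr: "column (restr T w) j = (column w j when j \<in> T)"
  by (rule poly_mapping_eqI) (auto simp: lookup_restr when_def)

lemma restr_id: "cols w \<subseteq> T \<Longrightarrow> restr T w = w"
  by (rule word_eqI) (use cols_iff in \<open>auto simp: column_restr when_def\<close>)

lemma column_zero [simp]: "column 0 j = 0"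
  by (rule poly_mapping_eqI) simp

lemma restr_0: "cols w \<inter> T = {} \<Longrightarrow> restr T w = 0"
  by (rule word_eqI) (use cols_iff in \<open>auto simp: column_restr when_def\<close>)

lemma restr_words: "w \<in> words r S \<Longrightarrow> restr T w \<in> words r (S \<inter> T)"
  by (auto simp: words_def in_keys_iff lookup_restr subset_iff when_def split: if_splits)

lemma coltype_superset: "cols w \<subseteq> A \<Longrightarrow> finite A \<Longrightarrow>
   image_mset (column w) (mset_set A) = coltype w + replicate_mset (card (A - cols w)) 0"
proof -
  assume *: "cols w \<subseteq> A" "finite A"
  then have "mset_set A = mset_set (cols w) + mset_set (A - cols w)"
    by (metis Diff_disjoint Diff_partition finite_Diff finite_cols mset_set_Union)
  moreover have "image_mset (column w) (mset_set (A - cols w)) = image_mset (\<lambda>_. 0) (mset_set (A - cols w))"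
    using * by (intro image_mset_cong) (auto simp: cols_iff)
  ultimately show ?thesis by (simp add: coltype_def image_mset_const_eq)
qed

text \<open>This moves column \<open>j\<close> to column \<open>\<sigma> j\<close>; it is the action of \<open>\<sigma>\<close> on monomials.\<close>

definition relabel :: "(nat \<Rightarrow> nat) \<Rightarrow> word \<Rightarrow> word" where
  "relabel \<sigma> w = Poly_Mapping.map_key (map_prod id (pinv \<sigma>)) w"

lemma inj_map_prod_inv: "bij \<sigma> \<Longrightarrow> inj (map_prod id (pinv \<sigma>))"
  by (simp add: bij_imp_bij_inv bij_is_inj prod.inj_map)

lemma lookup_relabel: "bij \<sigma> \<Longrightarrow> lookup (relabel \<sigma> w) (a, j) = lookup w (a, pinv \<sigma> j)"
  unfolding relabel_def by (simp add: map_key.rep_eq[OF inj_map_prod_inv])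

lemma column_relabel: "bij \<sigma> \<Longrightarrow> column (relabel \<sigma> w) j = column w (pinv \<sigma> j)"
  by (rule poly_mapping_eqI) (simp add: lookup_relabel)

lemma cols_relabel: "bij \<sigma> \<Longrightarrow> cols (relabel \<sigma> w) = \<sigma> ` cols w"
proof -
  assume b: "bij \<sigma>"
  have "j \<in> cols (relabel \<sigma> w) \<longleftrightarrow> pinv \<sigma> j \<in> cols w" for j
    by (simp add: cols_iff column_relabel[OF b])
  moreover have "pinv \<sigma> j \<in> A \<longleftrightarrow> j \<in> \<sigma> ` A" for j A
    using b by (metis bij_inv_eq_iff imageE imageI)
  ultimately show ?thesis by auto
qed

lemma coltype_relabel [simp]: "bij \<sigma> \<Longrightarrow> coltype (relabel \<sigma> w) = coltype w"
proof -
  assume b: "bij \<sigma>"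
  have "mset_set (\<sigma> ` cols w) = image_mset \<sigma> (mset_set (cols w))"
    by (rule image_mset_mset_set[symmetric]) (meson b bij_is_inj inj_on_subset subset_UNIV)
  then have "coltype (relabel \<sigma> w) = image_mset (\<lambda>j. column w (pinv \<sigma> (\<sigma> j))) (mset_set (cols w))"
    by (simp add: coltype_def cols_relabel[OF b] column_relabel[OF b] multiset.map_comp o_def)
  then show ?thesis
    using bij_is_inj[OF b] by (simp add: coltype_def)
qed

lemma mdeg_relabel [simp]: "bij \<sigma> \<Longrightarrow> mdeg (relabel \<sigma> w) = mdeg w"
  by (metis sum_mset_coltype coltype_relabel)

lemma tdeg_relabel [simp]: "bij \<sigma> \<Longrightarrow> tdeg (relabel \<sigma> w) = tdeg w"
  by (metis tdeg_mdeg mdeg_relabel)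

lemma relabel_add: "bij \<sigma> \<Longrightarrow> relabel \<sigma> (v + w) = relabel \<sigma> v + relabel \<sigma> w"
  by (rule word_eqI) (simp add: column_relabel column_add)

lemma relabel_comp: "bij \<sigma> \<Longrightarrow> bij \<tau> \<Longrightarrow> relabel \<sigma> (relabel \<tau> w) = relabel (\<sigma> \<circ> \<tau>) w"
  by (rule word_eqI) (simp add: column_relabel bij_comp o_inv_distrib)

lemma relabel_inv [simp]: "bij \<sigma> \<Longrightarrow> relabel (pinv \<sigma>) (relabel \<sigma> w) = w"
  by (rule word_eqI) (simp add: column_relabel bij_imp_bij_inv inv_inv_eq bij_is_inj)

lemma relabel_inv' [simp]: "bij \<sigma> \<Longrightarrow> relabel \<sigma> (relabel (pinv \<sigma>) w) = w"
  by (rule word_eqI) (simp add: column_relabel bij_imp_bij_inv inv_inv_eq bij_is_surj surj_f_inv_f)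

lemma words_relabel: "\<sigma> permutes S \<Longrightarrow> w \<in> words r S \<Longrightarrow> relabel \<sigma> w \<in> words r S"
proof -
  assume *: "\<sigma> permutes S" "w \<in> words r S"
  have "bij \<sigma>" using * by (simp add: permutes_bij)
  have "lookup w (a, j) \<noteq> 0 \<Longrightarrow> a < r \<and> j \<in> S" for a j
    using * by (auto simp: words_def subset_iff in_keys_iff)
  then have "a < r \<and> j \<in> S" if "lookup (relabel \<sigma> w) (a, j) \<noteq> 0" for a j
    using that lookup_relabel[OF \<open>bij \<sigma>\<close>] permutes_in_image[OF permutes_inv[OF *(1)]] by metis
  then show ?thesis
    by (auto simp: words_def in_keys_iff)
qed

lemma relabel_fix: "bij \<sigma> \<Longrightarrow> (\<And>j. j \<in> cols w \<Longrightarrow> \<sigma> j = j) \<Longrightarrow> relabel \<sigma> w = w"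
proof (rule word_eqI)
  fix j assume *: "bij \<sigma>" "\<And>j. j \<in> cols w \<Longrightarrow> \<sigma> j = j"
  have "column w (pinv \<sigma> j) = column w j"
    by (metis * bij_inv_eq_iff cols_iff)
  then show "column (relabel \<sigma> w) j = column w j" using * by (simp add: column_relabel)
qed

text \<open>After padding with zero columns, the two families of columns indexed by \<open>S\<close> have equal
  multisets of values, so a permutation of \<open>S\<close> matches them.\<close>

lemma coltype_eq_imp_relabel:
  assumes "finite S" "v \<in> words r S" "w \<in> words r S" "coltype v = coltype w"
  obtains \<sigma> where "\<sigma> permutes S" "relabel \<sigma> v = w"
proof -
  have "size (coltype u) = card (cols u)" for u by (simp add: coltype_def)
  then have "card (cols v) = card (cols w)" using assms(4) by metis
  then have "card (S - cols v) = card (S - cols w)"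
    using assms by (simp add: card_Diff_subset words_cols)
  then have "image_mset (column v) (mset_set S) = image_mset (column w) (mset_set S)"
    using assms by (simp add: coltype_superset words_cols)
  then obtain p where p: "p permutes S" "\<forall>x\<in>S. column v x = column w (p x)"
    using image_mset_eq_implies_permutes[OF assms(1)] by blast
  have b: "bij p" using p permutes_bij by blast
  have "column v x = column w (p x)" for x
    using p assms words_cols cols_iff permutes_not_in by (metis subsetD)
  then have "relabel p v = w"
    by (intro word_eqI) (simp add: column_relabel b bij_is_surj surj_f_inv_f)
  then show thesis by (rule that[OF p(1)])
qed

text \<open>The column types of total degree at most \<open>N\<close>. They index the orbits of monomials, and the set does
  not depend on the number of columns; this is where the stability in \<open>n\<close> comes from.\<close>

definition types :: "nat \<Rightarrow> nat \<Rightarrow> (nat \<Rightarrow>\<^sub>0 nat) multiset set" where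
  "types r N = {\<mu>. (\<forall>K\<in>#\<mu>. K \<noteq> 0 \<and> keys K \<subseteq> {..<r}) \<and> wt \<mu> \<le> N}"

lemma coltype_in_types: "w \<in> words r S \<Longrightarrow> tdeg w \<le> N \<Longrightarrow> coltype w \<in> types r N"
proof -
  assume *: "w \<in> words r S" "tdeg w \<le> N"
  have "a < r" if "lookup w (a, j) \<noteq> 0" for a j
    using * that by (auto simp: words_def subset_iff in_keys_iff)
  then have "keys (column w j) \<subseteq> {..<r}" for j
    by (auto simp: in_keys_iff)
  then have "K \<noteq> 0 \<and> keys K \<subseteq> {..<r}" if "K \<in># coltype w" for K
    using that by (auto simp: coltype_def cols_iff)
  then show ?thesis using * by (simp add: types_def tdeg_coltype)
qed

lemma types_mono: "\<mu> \<in> types r N \<Longrightarrow> N \<le> N' \<Longrightarrow> \<mu> \<in> types r N'"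
  by (simp add: types_def)

lemma types_size: "\<mu> \<in> types r N \<Longrightarrow> size \<mu> \<le> wt \<mu>"
proof -
  have "(\<forall>K\<in>#\<mu>. K \<noteq> 0) \<Longrightarrow> size \<mu> \<le> wt \<mu>" for \<mu> :: "(nat \<Rightarrow>\<^sub>0 nat) multiset"
  proof (induction \<mu>)
    case (add K \<mu>)
    then have "tdeg K \<noteq> 0" "size \<mu> \<le> wt \<mu>" by (auto simp del: neq0_conv)
    moreover have "tdeg K > 0" using \<open>tdeg K \<noteq> 0\<close> by blast
    ultimately show ?case by simp
  qed simp
  then show "\<mu> \<in> types r N \<Longrightarrow> size \<mu> \<le> wt \<mu>" by (simp add: types_def)
qed

text \<open>New columns can be placed one after the other as long as there is room for them.\<close>

lemma exists_word:
  assumes "finite S" "\<And>K. K \<in># \<mu> \<Longrightarrow> K \<noteq> 0 \<and> keys K \<subseteq> {..<r}" "size \<mu> \<le> card S"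
  shows "\<exists>u\<in>words r S. coltype u = \<mu>"
  using assms(2,3)
proof (induction \<mu>)
  case empty
  show ?case by (rule bexI[of _ 0]) auto
next
  case (add K \<mu>)
  then obtain u where u: "u \<in> words r S" "coltype u = \<mu>" by auto
  have "card (cols u) = size \<mu>" using u by (auto simp: coltype_def)
  then have "card (cols u) < card S" using add.prems by auto
  then obtain j where j: "j \<in> S" "j \<notin> cols u"
    by (metis assms(1) card_mono finite_cols linorder_not_less subsetI)
  define v where "v = (\<Sum>a\<in>keys K. single (a, j) (lookup K a))"
  have lv: "lookup v (a, i) = (lookup K a when i = j)" for a i
  proof (cases "i = j")
    case True
    then have "lookup v (a, i) = (\<Sum>b\<in>keys K. if b = a then lookup K b else 0)"
      unfolding v_def by (auto simp: lookup_sum lookup_single when_def intro!: sum.cong)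
    then show ?thesis using True by (auto simp: in_keys_iff)
  next
    case False
    then show ?thesis unfolding v_def by (auto simp: lookup_sum lookup_single when_def)
  qed
  have cv: "column v i = (K when i = j)" for i
    by (rule poly_mapping_eqI) (simp add: lv when_def)
  have "K \<noteq> 0" "keys K \<subseteq> {..<r}" using add.prems by auto
  then have sv: "cols v = {j}" by (auto simp: cols_iff cv)
  have "v \<in> words r S" using \<open>keys K \<subseteq> {..<r}\<close> j
    by (auto simp: words_def in_keys_iff lv subset_iff when_def split: if_splits)
  moreover have "coltype (u + v) = add_mset K \<mu>"
  proof -
    have "coltype (u + v) = image_mset (column (u + v)) (mset_set (insert j (cols u)))"
      by (simp add: coltype_def cols_add sv)
    also have "\<dots> = add_mset (column (u + v) j) (image_mset (column (u + v)) (mset_set (cols u)))"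
      using j by simp
    also have "column (u + v) j = K" using j by (simp add: column_add cv cols_iff)
    also have "image_mset (column (u + v)) (mset_set (cols u)) = coltype u"
      unfolding coltype_def using j by (intro image_mset_cong) (auto simp: column_add cv when_def)
    finally show ?thesis using u by simp
  qed
  ultimately show ?case using u words_add by blast
qed

lemma finite_types: "finite (types r N)"
proof (rule finite_surj)
  show "finite {w \<in> words r {..<N}. tdeg w \<le> N}" by (rule finite_words) simp
  show "types r N \<subseteq> coltype ` {w \<in> words r {..<N}. tdeg w \<le> N}"
  proof
    fix \<mu> assume m: "\<mu> \<in> types r N"
    then have "size \<mu> \<le> card {..<N}" using types_size[OF m] by (auto simp: types_def)
    then obtain u where "u \<in> words r {..<N}" "coltype u = \<mu>"
      using exists_word[of "{..<N}" \<mu> r] m by (auto simp: types_def)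
    then show "\<mu> \<in> coltype ` {w \<in> words r {..<N}. tdeg w \<le> N}"
      using m tdeg_coltype[of u] by (auto simp: types_def image_iff)
  qed
qed

lemma empty_in_types [simp]: "{#} \<in> types r N"
  by (simp add: types_def)

section \<open>The permutation action on polynomials\<close>

lemma poly_expand: "p = (\<Sum>w\<in>keys p. single w (lookup p w))"
proof (rule poly_mapping_eqI)
  fix v
  have "lookup (\<Sum>w\<in>keys p. single w (lookup p w)) v = (\<Sum>w\<in>keys p. if w = v then lookup p w else 0)"
    by (simp add: lookup_sum lookup_single when_def)
  then show "lookup p v = lookup (\<Sum>w\<in>keys p. single w (lookup p w)) v"
    by (simp add: in_keys_iff)
qed

lemma lookup_Const_mult [simp]: "lookup (Const c * p) w = c * lookup p w"
  by (simp add: Const_def flip: mult_map_scale_conv_mult) (simp add: Poly_Mapping.map.rep_eq when_def)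

lemma Const_0 [simp]: "Const 0 = 0" and Const_1 [simp]: "Const 1 = 1"
  by (simp_all add: Const_def)

lemma Const_add: "Const (a + b) = Const a + Const b"
  by (simp add: Const_def single_add)

lemma Const_mult: "Const (a * b) = Const a * (Const b :: ('v, 'k::comm_ring_1) mpoly)"
  by (simp add: Const_def mult_single)

lemma Const_uminus: "Const (- a) = - (Const a :: ('v, 'k::comm_ring_1) mpoly)"
  by (simp add: Const_def single_uminus)

lemma Const_sum: "Const (sum f A) = (\<Sum>x\<in>A. Const (f x))"
  by (induction A rule: infinite_finite_induct) (auto simp: Const_add)

lemma lookup_mult_single:
  fixes p :: "('v, 'k::comm_ring_1) mpoly"
  shows "lookup (p * single w c) (y + w) = lookup p y * c"
proof -
  have "p * single w c = (\<Sum>v\<in>keys p. single (v + w) (lookup p v * c))"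
    by (subst poly_expand[of p]) (simp add: sum_distrib_right mult_single)
  then have "lookup (p * single w c) (y + w) = (\<Sum>v\<in>keys p. if v = y then lookup p v * c else 0)"
    by (auto simp: lookup_sum lookup_single when_def intro!: sum.cong)
  then show ?thesis by (auto simp: in_keys_iff)
qed

lemma lookup_mult_single_0:
  fixes p :: "('v, 'k::comm_ring_1) mpoly"
  assumes "\<And>y. x \<noteq> y + w"
  shows "lookup (p * single w c) x = 0"
proof -
  have "p * single w c = (\<Sum>v\<in>keys p. single (v + w) (lookup p v * c))"
    by (subst poly_expand[of p]) (simp add: sum_distrib_right mult_single)
  then show ?thesis using assms[symmetric] by (simp add: lookup_sum lookup_single)
qed

lemma mult_expand_right:
  fixes p :: "('v, 'k::comm_ring_1) mpoly"
  shows "p * s = (\<Sum>w\<in>keys s. p * single w (lookup s w))"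
  by (subst poly_expand[of s]) (simp add: sum_distrib_left)

text \<open>If \<open>s\<close> only involves columns in \<open>T\<close> and all its monomials have at least the \<open>T\<close>-degree of \<open>x\<close>,
  then a monomial of \<open>s\<close> that divides \<open>x\<close> must be the whole \<open>T\<close>-part of \<open>x\<close>. Hence coefficients of
  lowest \<open>T\<close>-degree of products are products of coefficients.\<close>

lemma lookup_mult_low:
  fixes p :: "('k::comm_ring_1) dpoly"
  assumes "\<And>w. w \<in> keys s \<Longrightarrow> cols w \<subseteq> T \<and> tdeg (restr T x) \<le> tdeg w"
  shows "lookup (p * s) x = lookup p (restr (- T) x) * lookup s (restr T x)"
proof -
  have "lookup (p * single w (lookup s w)) x =
      (if w = restr T x then lookup p (restr (- T) x) * lookup s w else 0)" if "w \<in> keys s" for w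
  proof (cases "w = restr T x")
    case True
    have "x = restr (- T) x + w" using True restr_split[of T x] by (simp add: add.commute)
    then show ?thesis using True lookup_mult_single by (metis (full_types))
  next
    case False
    have "x \<noteq> y + w" for y
    proof
      assume x: "x = y + w"
      then have *: "restr T x = restr T y + w" using assms[OF that] by (simp add: restr_add restr_id)
      then have "tdeg (restr T y) = 0" using assms[OF that] by simp
      then show False using * False by simp
    qed
    then show ?thesis using False by (simp add: lookup_mult_single_0)
  qed
  then have "lookup (p * s) x = (\<Sum>w\<in>keys s. if w = restr T x then lookup p (restr (- T) x) * lookup s w else 0)"
    by (subst mult_expand_right) (simp add: lookup_sum)
  then show ?thesis by (auto simp: in_keys_iff)
qed

lemma single_power: "single w c ^ k = single (\<Sum>_\<in>{..<k}. w) (c ^ k :: 'k::comm_ring_1)"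
  by (induction k) (auto simp: mult_single add.commute)

lemma sum_const_single: "(\<Sum>_\<in>{..<k}. single v (1::nat)) = single v k"
  by (induction k) (auto simp flip: single_add)

lemma prod_single: "(\<Prod>v\<in>A. single (f v) 1) = single (\<Sum>v\<in>A. f v) (1 :: 'k::comm_ring_1)"
  by (induction A rule: infinite_finite_induct) (auto simp: mult_single)

lemma relabel_eq_sum: "bij \<sigma> \<Longrightarrow> (\<Sum>v\<in>keys w. single (fst v, \<sigma> (snd v)) (lookup w v)) = relabel \<sigma> w"
proof (rule poly_mapping_eqI)
  fix x :: "nat \<times> nat" assume b: "bij \<sigma>"
  obtain a j where x: "x = (a, j)" by fastforce
  have "(fst v, \<sigma> (snd v)) = (a, j) \<longleftrightarrow> v = (a, pinv \<sigma> j)" for v :: "nat \<times> nat"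
    using b by (cases v) (auto simp: bij_is_inj bij_is_surj surj_f_inv_f)
  then have "lookup (\<Sum>v\<in>keys w. single (fst v, \<sigma> (snd v)) (lookup w v)) x
      = (\<Sum>v\<in>keys w. if v = (a, pinv \<sigma> j) then lookup w v else 0)"
    by (simp only: x lookup_sum lookup_single when_def)
  then show "lookup (\<Sum>v\<in>keys w. single (fst v, \<sigma> (snd v)) (lookup w v)) x = lookup (relabel \<sigma> w) x"
    by (simp add: x lookup_relabel[OF b] in_keys_iff)
qed

lemma perm_act_eq:
  fixes p :: "('k::comm_ring_1) dpoly"
  assumes "bij \<sigma>"
  shows "perm_act \<sigma> p = (\<Sum>w\<in>keys p. single (relabel \<sigma> w) (lookup p w))"
proof -
  have "(case v of (i, j) \<Rightarrow> Var (i, \<sigma> j)) ^ k = single (single (fst v, \<sigma> (snd v)) k) (1::'k)" for v :: "nat \<times> nat" and k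
    by (cases v) (simp only: Var_def single_power sum_const_single prod.case fst_conv snd_conv power_one)
  then show ?thesis
    by (simp add: perm_act_def mpoly_subst_def prod_single relabel_eq_sum[OF assms] Const_def mult_single)
qed

lemma lookup_perm_act:
  fixes p :: "('k::comm_ring_1) dpoly"
  assumes "bij \<sigma>"
  shows "lookup (perm_act \<sigma> p) w = lookup p (relabel (pinv \<sigma>) w)"
proof -
  have "relabel \<sigma> v = w \<longleftrightarrow> v = relabel (pinv \<sigma>) w" for v
    using assms by auto
  then have "lookup (perm_act \<sigma> p) w = (\<Sum>v\<in>keys p. if v = relabel (pinv \<sigma>) w then lookup p v else 0)"
    by (simp add: perm_act_eq[OF assms] lookup_sum lookup_single when_def)
  then show ?thesis by (simp add: in_keys_iff)
qed

lemma perm_act_add: "bij \<sigma> \<Longrightarrow> perm_act \<sigma> (p + q) = perm_act \<sigma> p + perm_act \<sigma> q"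
  by (rule poly_mapping_eqI) (simp add: lookup_perm_act lookup_add)

lemma perm_act_diff: "bij \<sigma> \<Longrightarrow> perm_act \<sigma> (p - q) = perm_act \<sigma> p - perm_act \<sigma> q"
  by (rule poly_mapping_eqI) (simp add: lookup_perm_act lookup_minus)

lemma perm_act_scale: "bij \<sigma> \<Longrightarrow> perm_act \<sigma> (Const c * p) = Const c * perm_act \<sigma> p"
  by (rule poly_mapping_eqI) (simp add: lookup_perm_act)

lemma perm_act_0: "bij \<sigma> \<Longrightarrow> perm_act \<sigma> 0 = 0"
  by (rule poly_mapping_eqI) (simp add: lookup_perm_act)

lemma perm_act_sum: "bij \<sigma> \<Longrightarrow> perm_act \<sigma> (sum f A) = (\<Sum>x\<in>A. perm_act \<sigma> (f x))"
  by (induction A rule: infinite_finite_induct) (auto simp: perm_act_0 perm_act_add)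

lemma perm_act_single: "bij \<sigma> \<Longrightarrow> perm_act \<sigma> (single w c) = single (relabel \<sigma> w) (c::'k::comm_ring_1)"
  by (cases "c = 0") (simp_all add: perm_act_eq)

lemma perm_act_comp: "bij \<sigma> \<Longrightarrow> bij \<tau> \<Longrightarrow> perm_act \<sigma> (perm_act \<tau> p) = perm_act (\<sigma> \<circ> \<tau>) p"
  by (rule poly_mapping_eqI) (simp add: lookup_perm_act bij_comp relabel_comp bij_imp_bij_inv o_inv_distrib)

text \<open>By additivity it is enough to check the product of two monomials.\<close>

lemma perm_act_mult:
  fixes p q :: "('k::comm_ring_1) dpoly"
  assumes b: "bij \<sigma>"
  shows "perm_act \<sigma> (p * q) = perm_act \<sigma> p * perm_act \<sigma> q"
proof -
  have 1: "perm_act \<sigma> (single v c * single w d) = perm_act \<sigma> (single v c) * perm_act \<sigma> (single w d)" for v w and c d :: 'k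
    by (simp add: mult_single perm_act_single[OF b] relabel_add[OF b])
  have 2: "perm_act \<sigma> ((\<Sum>v\<in>A. single v (f v)) * single w d) =
      perm_act \<sigma> (\<Sum>v\<in>A. single v (f v)) * perm_act \<sigma> (single w d)" for A f w and d :: 'k
    by (simp only: sum_distrib_right perm_act_sum[OF b] 1)
  have 3: "perm_act \<sigma> (p * single w d) = perm_act \<sigma> p * perm_act \<sigma> (single w d)" for w and d :: 'k
    using 2[where A = "keys p" and f = "lookup p"] by (simp only: poly_expand[symmetric])
  have 4: "perm_act \<sigma> (p * (\<Sum>v\<in>A. single v (f v))) =
      perm_act \<sigma> p * perm_act \<sigma> (\<Sum>v\<in>A. single v (f v))" for A and f :: "word \<Rightarrow> 'k"
    by (simp only: sum_distrib_left perm_act_sum[OF b] 3)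
  show ?thesis
    using 4[where A = "keys q" and f = "lookup q"] by (simp only: poly_expand[symmetric])
qed

lemma keys_perm_act: "bij \<sigma> \<Longrightarrow> w \<in> keys (perm_act \<sigma> p) \<longleftrightarrow> relabel (pinv \<sigma>) w \<in> keys p"
  by (simp add: in_keys_iff lookup_perm_act)

definition polys :: "nat \<Rightarrow> nat set \<Rightarrow> ('k::comm_ring_1) dpoly set" where
  "polys r S = {p. keys p \<subseteq> words r S}"

lemma polys_0 [simp]: "0 \<in> polys r S"
  by (simp add: polys_def)

lemma polys_add: "p \<in> polys r S \<Longrightarrow> q \<in> polys r S \<Longrightarrow> p + q \<in> polys r S"
  using Poly_Mapping.keys_add[of p q] by (auto simp: polys_def)

lemma polys_sum: "(\<And>x. x \<in> A \<Longrightarrow> f x \<in> polys r S) \<Longrightarrow> sum f A \<in> polys r S"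
  by (induction A rule: infinite_finite_induct) (auto simp: polys_add)

lemma polys_mult:  "p \<in> polys r S \<Longrightarrow> q \<in> polys r S \<Longrightarrow> p * q \<in> polys r S"
  unfolding polys_def using keys_mult[of p q] by (auto simp: subset_iff words_add)

lemma polys_single: "w \<in> words r S \<Longrightarrow> single w c \<in> polys r S"
  by (simp add: polys_def)

lemma polys_Const: "Const c \<in> polys r S"
  by (simp add: Const_def polys_single)

lemma polys_scale: "p \<in> polys r S \<Longrightarrow> Const c * p \<in> polys r S"
  by (simp add: polys_mult polys_Const)

lemma polys_uminus: "p \<in> polys r S \<Longrightarrow> - p \<in> polys r S"
  by (auto simp: polys_def in_keys_iff subset_iff)

lemma polys_diff: "p \<in> polys r S \<Longrightarrow> q \<in> polys r S \<Longrightarrow> p - q \<in> polys r S"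
  using polys_add[OF _ polys_uminus] by fastforce

lemma polys_mono: "S \<subseteq> T \<Longrightarrow> p \<in> polys r S \<Longrightarrow> p \<in> polys r T"
  using words_mono by (auto simp: polys_def)

lemma polys_perm_act: "\<sigma> permutes S \<Longrightarrow> p \<in> polys r S \<Longrightarrow> perm_act \<sigma> p \<in> polys r S"
proof -
  assume *: "\<sigma> permutes S" "p \<in> polys r S"
  have b: "bij \<sigma>" using * permutes_bij by blast
  show ?thesis using * words_relabel[OF *(1)] relabel_inv'[OF b]
    by (auto simp: polys_def keys_perm_act[OF b]) (metis subsetD)
qed

lemma carrier_diag: "carrier (diag_poly_ring r n) = polys r {..<n}"
  by (auto simp: diag_poly_ring_def polys_def words_def)

text \<open>The monomial symmetric polynomial of the column type \<open>\<mu>\<close>: the sum of one orbit of monomials.\<close>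

definition msym :: "nat \<Rightarrow> nat \<Rightarrow> (nat \<Rightarrow>\<^sub>0 nat) multiset \<Rightarrow> ('k::comm_ring_1) dpoly" where
  "msym r n \<mu> = (\<Sum>w | w \<in> words r {..<n} \<and> coltype w = \<mu>. single w 1)"

lemma finite_coltype: "finite S \<Longrightarrow> finite {w. w \<in> words r S \<and> coltype w = \<mu>}"
  by (rule finite_subset[OF _ finite_words[of S r "wt \<mu>"]]) (auto simp: tdeg_coltype)

lemma lookup_msym: "lookup (msym r n \<mu>) w = (if w \<in> words r {..<n} \<and> coltype w = \<mu> then 1 else 0)"
proof -
  have "lookup (msym r n \<mu> :: 'a dpoly) w =
     (\<Sum>v | v \<in> words r {..<n} \<and> coltype v = \<mu>. if v = w then 1 else 0)"
    by (simp add: msym_def lookup_sum lookup_single when_def)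
  then show ?thesis by (simp add: finite_coltype)
qed

lemma msym_polys: "msym r n \<mu> \<in> polys r {..<n}"
  by (auto simp: polys_def in_keys_iff lookup_msym split: if_splits)

lemma msym_empty [simp]: "msym r n {#} = 1"
  by (rule poly_mapping_eqI) (auto simp: lookup_msym lookup_one when_def)

lemma words_relabel_iff: "\<sigma> permutes S \<Longrightarrow> relabel \<sigma> w \<in> words r S \<longleftrightarrow> w \<in> words r S"
  by (metis words_relabel permutes_inv relabel_inv permutes_bij)

lemma msym_inv: "\<sigma> permutes {..<n} \<Longrightarrow> perm_act \<sigma> (msym r n \<mu>) = msym r n \<mu>"
  by (rule poly_mapping_eqI)
    (simp add: lookup_perm_act permutes_bij lookup_msym words_relabel_iff permutes_inv bij_imp_bij_inv)

lemma keys_msym: "w \<in> keys (msym r n \<mu>) \<Longrightarrow> w \<in> words r {..<n} \<and> coltype w = \<mu>"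
  by (auto simp: in_keys_iff lookup_msym split: if_splits)

section \<open>Partially symmetric polynomials\<close>

lemma perm_act_fixed:
  assumes "\<sigma> permutes S" "T \<inter> S = {}" "p \<in> polys r T"
  shows "perm_act \<sigma> p = p"
proof (rule poly_mapping_eqI)
  fix w
  have b: "bij \<sigma>" using assms permutes_bij by blast
  have fx: "relabel \<sigma> v = v" if "v \<in> words r T" for v
    using that assms words_cols by (intro relabel_fix[OF b]) (metis disjoint_iff permutes_not_in subsetD)
  have "lookup p (relabel (pinv \<sigma>) w) = lookup p w"
  proof (cases "w \<in> words r T")
    case True
    then show ?thesis using fx relabel_inv[OF b] by metis
  next
    case False
    have "relabel (pinv \<sigma>) w \<notin> words r T"
      using False fx relabel_inv'[OF b] by metis
    then have "relabel (pinv \<sigma>) w \<notin> keys p" "w \<notin> keys p" using assms False by (auto simp: polys_def)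
    then show ?thesis by (simp add: in_keys_iff)
  qed
  then show "lookup (perm_act \<sigma> p) w = lookup p w" by (simp add: lookup_perm_act[OF b])
qed

lemma polys_keys: "p \<in> polys r S \<Longrightarrow> w \<in> keys p \<Longrightarrow> w \<in> words r S"
  by (auto simp: polys_def)

lemma polys_cols: "p \<in> polys r S \<Longrightarrow> w \<in> keys p \<Longrightarrow> cols w \<subseteq> S"
  using polys_keys words_cols by blast

lemma tdeg_restr_le: "tdeg (restr T x) \<le> tdeg x"
  by (metis restr_split tdeg_add le_add1)

lemma restr_union:
  assumes "cols w \<subseteq> T" "cols u \<inter> T = {}"
  shows "restr T (u + w) = w" "restr (- T) (u + w) = u"
  proof -
  have "cols u \<subseteq> - T" "cols w \<inter> - T = {}" using assms by auto
  then show "restr T (u + w) = w" "restr (- T) (u + w) = u"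
    using assms by (simp_all add: restr_add restr_id restr_0)
qed

lemma lookup_invariant:
  assumes "bij \<sigma>" "perm_act \<sigma> q = q"
  shows "lookup q (relabel \<sigma> x) = lookup q x"
  by (metis assms lookup_perm_act relabel_inv)

text \<open>Linear independence of the orbit sums over the polynomials in the columns \<open>T\<close>. Choose a monomial
  \<open>w\<close> of least degree among all coefficients and a monomial \<open>u\<close> of the corresponding type outside of \<open>T\<close>,
  for which the bound on \<open>n\<close> leaves enough columns. Only one summand contributes to the coefficient of
  \<open>u + w\<close> in the relation.\<close>

lemma msym_independent:
  fixes s :: "(nat \<Rightarrow>\<^sub>0 nat) multiset \<Rightarrow> ('k::comm_ring_1) dpoly"
  assumes T: "T \<subseteq> {..<n}" "card T + N \<le> n"
    and s: "\<And>\<kappa>. \<kappa> \<in> types r N \<Longrightarrow> s \<kappa> \<in> polys r T"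
    and eq: "(\<Sum>\<kappa>\<in>types r N. msym r n \<kappa> * s \<kappa>) = 0"
    and \<kappa>: "\<kappa> \<in> types r N"
  shows "s \<kappa> = 0"
proof (rule ccontr)
  assume "s \<kappa> \<noteq> 0"
  define A where "A = {(\<kappa>, w). \<kappa> \<in> types r N \<and> w \<in> keys (s \<kappa>)}"
  obtain w where "w \<in> keys (s \<kappa>)" using \<open>s \<kappa> \<noteq> 0\<close> by (metis equals0I keys_eq_empty)
  then have "(\<kappa>, w) \<in> A" using \<kappa> by (simp add: A_def)
  then obtain x0 where "x0 \<in> A" and least: "\<And>y. y \<in> A \<Longrightarrow> tdeg (snd x0) \<le> tdeg (snd y)"
    using ex_has_least_nat[of "\<lambda>x. x \<in> A" _ "\<lambda>x. tdeg (snd x)"] by blast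
  obtain \<kappa>0 w0 where x0: "x0 = (\<kappa>0, w0)" by fastforce
  have k0: "\<kappa>0 \<in> types r N" "w0 \<in> keys (s \<kappa>0)" using \<open>x0 \<in> A\<close> by (auto simp: x0 A_def)
  have least: "tdeg w0 \<le> tdeg w" if "\<kappa> \<in> types r N" "w \<in> keys (s \<kappa>)" for \<kappa> w
    using least[of "(\<kappa>, w)"] that by (simp add: A_def x0)
  have finT: "finite T" using T finite_subset by blast
  have "size \<kappa>0 \<le> card ({..<n} - T)"
  proof -
    have "wt \<kappa>0 \<le> N" using k0(1) by (simp add: types_def)
    then show ?thesis using types_size[OF k0(1)] T finT by (simp add: card_Diff_subset)
  qed
  then obtain u where u: "u \<in> words r ({..<n} - T)" "coltype u = \<kappa>0"
    using exists_word[of "{..<n} - T" \<kappa>0 r] k0(1) by (auto simp: types_def)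
  have w0: "w0 \<in> words r T" using s[OF k0(1)] k0(2) by (auto simp: polys_def)
  have restr: "restr T (u + w0) = w0" "restr (- T) (u + w0) = u"
    using restr_union[of w0 T u] words_cols[OF w0] words_cols[OF u(1)] by auto
  have un: "u \<in> words r {..<n}" using u(1) words_mono[of "{..<n} - T" "{..<n}" u r] by auto
  have "lookup (msym r n \<kappa> * s \<kappa>) (u + w0) = (if \<kappa> = \<kappa>0 then lookup (s \<kappa>0) w0 else 0)"
    if k: "\<kappa> \<in> types r N" for \<kappa>
  proof -
    have "cols w \<subseteq> T \<and> tdeg (restr T (u + w0)) \<le> tdeg w" if "w \<in> keys (s \<kappa>)" for w
      using polys_cols[OF s[OF k] that] least[OF k that] by (simp add: restr)
    then have "lookup (msym r n \<kappa> * s \<kappa>) (u + w0) = lookup (msym r n \<kappa>) u * lookup (s \<kappa>) w0"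
      using lookup_mult_low[of "s \<kappa>" T "u + w0" "msym r n \<kappa>"] by (simp add: restr)
    then show ?thesis using u un by (auto simp: lookup_msym)
  qed
  then have "lookup (\<Sum>\<kappa>\<in>types r N. msym r n \<kappa> * s \<kappa>) (u + w0) =
      (\<Sum>\<kappa>\<in>types r N. if \<kappa> = \<kappa>0 then lookup (s \<kappa>0) w0 else 0)"
    by (simp add: lookup_sum)
  also have "\<dots> = lookup (s \<kappa>0) w0" using k0 by (simp add: finite_types)
  finally show False using eq k0 by (simp add: in_keys_iff)
qed

text \<open>The orbit sums generate the polynomials that are invariant under permutations of the columns
  outside of \<open>T\<close> as a module over the polynomials in the columns \<open>T\<close>. Subtracting suitable multiples of
  orbit sums kills the part of \<open>q\<close> of lowest \<open>T\<close>-degree: by invariance its coefficient at \<open>w + u\<close>, with \<open>w\<close>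
  in \<open>T\<close> and \<open>u\<close> outside of \<open>T\<close>, only depends on \<open>w\<close> and on the type of \<open>u\<close>. The \<open>T\<close>-degree is bounded by
  \<open>N\<close>, so the process stops.\<close>

lemma invariant_decomposition:
  fixes q :: "('k::comm_ring_1) dpoly"
  assumes T: "T \<subseteq> {..<n}"
    and q: "q \<in> polys r {..<n}"
    and inv: "\<And>\<sigma>. \<sigma> permutes ({..<n} - T) \<Longrightarrow> perm_act \<sigma> q = q"
    and deg: "\<And>x. x \<in> keys q \<Longrightarrow> tdeg x \<le> N"
  obtains s where "\<And>\<kappa>. s \<kappa> \<in> polys r T" "q = (\<Sum>\<kappa>\<in>types r N. msym r n \<kappa> * s \<kappa>)"
proof -
  let ?U = "{..<n} - T"
  have finT: "finite T" using T finite_subset by blast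
  define ok where "ok \<kappa> \<longleftrightarrow> (\<exists>u\<in>words r ?U. coltype u = \<kappa>)" for \<kappa>
  define rep where "rep \<kappa> = (SOME u. u \<in> words r ?U \<and> coltype u = \<kappa>)" for \<kappa>
  have rep: "rep \<kappa> \<in> words r ?U \<and> coltype (rep \<kappa>) = \<kappa>" if "ok \<kappa>" for \<kappa>
    unfolding rep_def by (rule someI_ex) (use that in \<open>auto simp: ok_def\<close>)
  have "\<exists>s. (\<forall>\<kappa>. s \<kappa> \<in> polys r T) \<and> q = (\<Sum>\<kappa>\<in>types r N. msym r n \<kappa> * s \<kappa>)"
    if "\<forall>x\<in>keys q. Suc N - k \<le> tdeg (restr T x)" "q \<in> polys r {..<n}"
      "\<forall>\<sigma>. \<sigma> permutes ?U \<longrightarrow> perm_act \<sigma> q = q" "\<forall>x\<in>keys q. tdeg x \<le> N"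
    for k and q :: "'k dpoly"
    using that
  proof (induction k arbitrary: q)
    case 0
    have "keys q = {}"
    proof (rule ccontr)
      assume "keys q \<noteq> {}"
      then obtain x where "x \<in> keys q" by blast
      then have "Suc N \<le> tdeg x" "tdeg x \<le> N"
        using 0 tdeg_restr_le[of T x] by (auto intro: order_trans)
      then show False by simp
    qed
    then have "q = 0" by simp
    then show ?case by (intro exI[of _ "\<lambda>_. 0"]) simp
  next
    case (Suc k)
    define e where "e = N - k"
    have qe: "e \<le> tdeg (restr T x)" if "x \<in> keys q" for x
      using Suc.prems(1) that by (auto simp: e_def)
    define W where "W = {w \<in> words r T. tdeg w = e}"
    have finW: "finite W"
      by (rule finite_subset[OF _ finite_words[OF finT, of r e]]) (auto simp: W_def)
    \<comment> \<open>\<open>rep \<kappa>\<close> is a monomial of type \<open>\<kappa>\<close> outside of \<open>T\<close>; types that do not fit there do not occur in \<open>q\<close>\<close>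
    define s0 where "s0 \<kappa> = (if ok \<kappa> then \<Sum>w\<in>W. single w (lookup q (w + rep \<kappa>)) else 0)" for \<kappa>
    have ls0: "lookup (s0 \<kappa>) w = (if ok \<kappa> \<and> w \<in> W then lookup q (w + rep \<kappa>) else 0)" for \<kappa> w
      using finW by (simp add: s0_def lookup_sum lookup_single when_def)
    have ks0: "w \<in> W \<and> ok \<kappa>" if "w \<in> keys (s0 \<kappa>)" for w \<kappa>
      using that by (auto simp: in_keys_iff ls0 split: if_splits)
    have s0P: "s0 \<kappa> \<in> polys r T" for \<kappa> using ks0 by (auto simp: polys_def W_def)
    define q' where "q' = q - (\<Sum>\<kappa>\<in>types r N. msym r n \<kappa> * s0 \<kappa>)"
    have q'P: "q' \<in> polys r {..<n}"
      unfolding q'_def using Suc.prems(2) s0P polys_mono[OF T] msym_polys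
      by (intro polys_diff polys_sum polys_mult) auto
    have q'inv: "perm_act \<sigma> q' = q'" if p: "\<sigma> permutes ?U" for \<sigma>
    proof -
      have b: "bij \<sigma>" using p permutes_bij by blast
      have "\<sigma> permutes {..<n}" using p permutes_subset by blast
      moreover have "perm_act \<sigma> (s0 \<kappa>) = s0 \<kappa>" for \<kappa>
        by (rule perm_act_fixed[OF p _ s0P]) auto
      ultimately show ?thesis using Suc.prems(3) p
        by (simp add: q'_def perm_act_diff[OF b] perm_act_sum[OF b] perm_act_mult[OF b] msym_inv)
    qed
    have q'deg: "tdeg x \<le> N" if "x \<in> keys q'" for x
    proof (rule ccontr)
      assume x: "\<not> tdeg x \<le> N"
      have "lookup (msym r n \<kappa> * s0 \<kappa>) x = 0" for \<kappa>
      proof (rule ccontr)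
        assume "lookup (msym r n \<kappa> * s0 \<kappa>) x \<noteq> 0"
        then have "x \<in> keys (msym r n \<kappa> * s0 \<kappa>)" by (simp add: in_keys_iff)
        then obtain a b where ab: "x = a + b" "a \<in> keys (msym r n \<kappa> :: 'k dpoly)" "b \<in> keys (s0 \<kappa>)"
          using keys_mult[of "msym r n \<kappa>" "s0 \<kappa>"] by blast
        have "b + rep \<kappa> \<in> keys q" using ab(3) by (auto simp: in_keys_iff ls0 split: if_splits)
        then have "tdeg b + tdeg (rep \<kappa>) \<le> N" using Suc.prems(4) by force
        moreover have "tdeg (rep \<kappa>) = tdeg a"
          using rep ks0[OF ab(3)] keys_msym[OF ab(2)] tdeg_coltype by metis
        ultimately show False using x ab(1) by simp
      qed
      then have "lookup q' x = lookup q x" by (simp add: q'_def lookup_minus lookup_sum)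
      then show False using that x Suc.prems(4) by (simp add: in_keys_iff)
    qed
    \<comment> \<open>the subtraction has removed everything of \<open>T\<close>-degree at most \<open>e\<close>\<close>
    have low: "lookup q' x = 0" if x: "tdeg (restr T x) \<le> e" for x
    proof (cases "x \<in> words r {..<n} \<and> tdeg x \<le> N")
      case False
      then show ?thesis using polys_keys[OF q'P, of x] q'deg[of x] by (auto simp: in_keys_iff)
    next
      case True
      define u where "u = restr (- T) x"
      define w where "w = restr T x"
      have xuw: "x = w + u" by (simp add: u_def w_def restr_split)
      have u: "u \<in> words r ?U" using restr_words[of x r "{..<n}" "- T"] True by (simp add: u_def Diff_eq)
      have w: "w \<in> words r T" using restr_words[of x r "{..<n}" T] True T by (simp add: w_def Int_absorb1)
      have un: "u \<in> words r {..<n}" using u words_mono[of "{..<n} - T" "{..<n}" u r] by auto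
      have eq: "lookup (msym r n \<kappa> * s0 \<kappa>) x = (if \<kappa> = coltype u then lookup (s0 \<kappa>) w else 0)" for \<kappa>
      proof -
        have "lookup (msym r n \<kappa> * s0 \<kappa>) x = lookup (msym r n \<kappa>) u * lookup (s0 \<kappa>) w"
          unfolding u_def w_def
          by (rule lookup_mult_low) (use ks0 x polys_cols[OF s0P] in \<open>simp add: W_def\<close>)
        then show ?thesis using un by (auto simp: lookup_msym)
      qed
      have "coltype u \<in> types r N" using u True by (intro coltype_in_types) (auto simp: xuw)
      then have sum: "lookup (\<Sum>\<kappa>\<in>types r N. msym r n \<kappa> * s0 \<kappa>) x = lookup (s0 (coltype u)) w"
        by (simp add: lookup_sum eq finite_types)
      have "lookup (s0 (coltype u)) w = lookup q x"
      proof (cases "tdeg w = e")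
        case True
        have oku: "ok (coltype u)" using u by (auto simp: ok_def)
        obtain \<sigma> where \<sigma>: "\<sigma> permutes ?U" "relabel \<sigma> (rep (coltype u)) = u"
          using coltype_eq_imp_relabel[of ?U "rep (coltype u)" r u] rep[OF oku] u by auto
        have b: "bij \<sigma>" using \<sigma> permutes_bij by blast
        have "relabel \<sigma> w = w"
          using words_cols[OF w] \<sigma>(1) by (intro relabel_fix[OF b]) (auto simp: permutes_def)
        then have "lookup q (w + rep (coltype u)) = lookup q (w + u)"
          using lookup_invariant[OF b, of q "w + rep (coltype u)"] Suc.prems(3) \<sigma> by (simp add: relabel_add[OF b])
        then show ?thesis using True oku w by (simp add: ls0 W_def xuw)
      next
        case False
        then have "x \<notin> keys q" using x qe[of x] by (auto simp: w_def)
        then show ?thesis using False by (simp add: ls0 W_def in_keys_iff)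
      qed
      then show ?thesis using sum by (simp add: q'_def lookup_minus)
    qed
    have "Suc N - k \<le> tdeg (restr T x)" if "x \<in> keys q'" for x
    proof -
      have "\<not> tdeg (restr T x) \<le> e" using low[of x] that by (auto simp: in_keys_iff)
      then show ?thesis unfolding e_def by linarith
    qed
    then obtain s where s: "\<forall>\<kappa>. s \<kappa> \<in> polys r T" "q' = (\<Sum>\<kappa>\<in>types r N. msym r n \<kappa> * s \<kappa>)"
      using Suc.IH[of q'] q'P q'inv q'deg by blast
    have "q = (\<Sum>\<kappa>\<in>types r N. msym r n \<kappa> * (s \<kappa> + s0 \<kappa>))"
      using s(2) by (simp add: q'_def distrib_left sum.distrib algebra_simps)
    then show ?case using s(1) s0P polys_add by (intro exI[of _ "\<lambda>\<kappa>. s \<kappa> + s0 \<kappa>"]) blast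
  qed
  from this[of q "Suc N"] q inv deg that show thesis by auto
qed

section \<open>Averaging over permutations\<close>

definition avg :: "nat set \<Rightarrow> ('k::field_char_0) dpoly \<Rightarrow> 'k dpoly" where
  "avg U h = Const (inverse (of_nat (card {\<sigma>. \<sigma> permutes U}))) * (\<Sum>\<sigma> | \<sigma> permutes U. perm_act \<sigma> h)"

lemma card_perms_nz: "finite U \<Longrightarrow> (of_nat (card {\<sigma>. \<sigma> permutes U}) :: 'k::field_char_0) \<noteq> 0"
  by (simp add: card_permutations)

lemma avg_inv:
  assumes "\<tau> permutes U"
  shows "perm_act \<tau> (avg U h) = avg U h"
proof -
  have b: "bij \<tau>" using assms permutes_bij by blast
  have "perm_act \<tau> (\<Sum>\<sigma> | \<sigma> permutes U. perm_act \<sigma> h) = (\<Sum>\<sigma> | \<sigma> permutes U. perm_act (\<tau> \<circ> \<sigma>) h)"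
    by (simp add: perm_act_sum[OF b] perm_act_comp[OF b] permutes_bij cong: sum.cong_simp)
  also have "\<dots> = (\<Sum>\<sigma> | \<sigma> permutes U. perm_act \<sigma> h)"
    by (rule setum_permutations_compose_left[OF assms, symmetric])
  finally show ?thesis by (simp add: avg_def perm_act_scale[OF b])
qed

lemma avg_mult:
  assumes "\<And>\<sigma>. \<sigma> permutes U \<Longrightarrow> perm_act \<sigma> f = f"
  shows "avg U (f * h) = f * avg U h"
proof -
  have "(\<Sum>\<sigma> | \<sigma> permutes U. perm_act \<sigma> (f * h)) = (\<Sum>\<sigma> | \<sigma> permutes U. f * perm_act \<sigma> h)"
    by (rule sum.cong) (auto simp: perm_act_mult permutes_bij assms)
  then show ?thesis by (simp add: avg_def sum_distrib_left ac_simps)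
qed

lemma avg_0 [simp]: "avg U 0 = 0"
  by (simp add: avg_def perm_act_0 permutes_bij)

lemma avg_add: "avg U (g + h) = avg U g + avg U h"
proof -
  have "(\<Sum>\<sigma> | \<sigma> permutes U. perm_act \<sigma> (g + h)) = (\<Sum>\<sigma> | \<sigma> permutes U. perm_act \<sigma> g + perm_act \<sigma> h)"
    by (rule sum.cong) (auto simp: perm_act_add permutes_bij)
  then show ?thesis by (simp add: avg_def sum.distrib distrib_left)
qed

lemma avg_sum: "avg U (sum f A) = (\<Sum>x\<in>A. avg U (f x))"
  by (induction A rule: infinite_finite_induct) (auto simp: avg_add)

lemma lookup_avg:
  "lookup (avg U h) w = inverse (of_nat (card {\<sigma>. \<sigma> permutes U})) * (\<Sum>\<sigma> | \<sigma> permutes U. lookup h (relabel (pinv \<sigma>) w))"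
  by (simp add: avg_def lookup_sum lookup_perm_act permutes_bij)

text \<open>The permutations of \<open>U\<close> fix a monomial without columns in \<open>U\<close>. This makes polynomials of low degree
  detectable by their averages.\<close>

lemma lookup_avg_fixed:
  assumes "finite U" "cols w \<inter> U = {}"
  shows "lookup (avg U h) w = lookup h w"
proof -
  have "relabel (pinv \<sigma>) w = w" if "\<sigma> permutes U" for \<sigma>
    using assms that permutes_inv[OF that]
    by (intro relabel_fix) (auto simp: permutes_bij permutes_not_in disjoint_iff)
  then show ?thesis using card_perms_nz[OF assms(1)] by (simp add: lookup_avg)
qed

lemma avg_polys: "U \<subseteq> S \<Longrightarrow> h \<in> polys r S \<Longrightarrow> avg U h \<in> polys r S"
  unfolding avg_def by (intro polys_scale polys_sum) (auto intro: polys_perm_act permutes_subset)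

lemma keys_avg: "w \<in> keys (avg U h) \<Longrightarrow> \<exists>\<sigma>. \<sigma> permutes U \<and> relabel (pinv \<sigma>) w \<in> keys h"
proof (rule ccontr)
  assume w: "w \<in> keys (avg U h)" and "\<not> ?thesis"
  then have "(\<Sum>\<sigma> | \<sigma> permutes U. lookup h (relabel (pinv \<sigma>) w)) = 0"
    by (intro sum.neutral) (auto simp: in_keys_iff)
  then show False using w by (simp add: in_keys_iff lookup_avg)
qed

lemma tdeg_keys_avg:
  assumes "\<And>w. w \<in> keys h \<Longrightarrow> tdeg w \<le> N" "w \<in> keys (avg U h)"
  shows "tdeg w \<le> N"
  using keys_avg[OF assms(2)] assms(1) by (metis tdeg_relabel permutes_bij permutes_inv)

section \<open>The ideal generated by the positive-degree invariants\<close>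

interpretation vs: vector_space "\<lambda>(c::'k::field) (p::('v::comm_monoid_add \<Rightarrow>\<^sub>0 'k)). single 0 c * p"
  by unfold_locales (simp_all add: distrib_left distrib_right single_add mult_single flip: mult.assoc)

interpretation vp: vector_space_pair
  "\<lambda>(c::'k::field) (p::('v::comm_monoid_add \<Rightarrow>\<^sub>0 'k)). single 0 c * p"
  "\<lambda>(c::'k::field) (p::('v::comm_monoid_add \<Rightarrow>\<^sub>0 'k)). single 0 c * p"
  by unfold_locales

definition is_type :: "nat \<Rightarrow> (nat \<Rightarrow>\<^sub>0 nat) multiset \<Rightarrow> bool" where
  "is_type r \<mu> \<longleftrightarrow> (\<forall>K\<in>#\<mu>. K \<noteq> 0 \<and> keys K \<subseteq> {..<r})"

lemma types_iff: "\<mu> \<in> types r N \<longleftrightarrow> is_type r \<mu> \<and> wt \<mu> \<le> N"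
  by (simp add: types_def is_type_def)

definition sym_ideal_gens :: "nat \<Rightarrow> nat \<Rightarrow> ('k::field_char_0) dpoly set" where
  "sym_ideal_gens r n = {msym r n \<mu> * single w 1 |\<mu> w. is_type r \<mu> \<and> \<mu> \<noteq> {#} \<and> w \<in> words r {..<n}}"

text \<open>The ideal of the coinvariant algebra as a span over the ground field, which makes it easy to take
  homogeneous parts; \<open>coinv_ideal_eq\<close> identifies the two.\<close>

definition sym_ideal :: "nat \<Rightarrow> nat \<Rightarrow> ('k::field_char_0) dpoly set" where
  "sym_ideal r n = vs.span (sym_ideal_gens r n)"

lemma subspace_sym_ideal: "vs.subspace (sym_ideal r n)"
  by (simp add: sym_ideal_def)

lemma sym_ideal_sum: "(\<And>x. x \<in> A \<Longrightarrow> f x \<in> sym_ideal r n) \<Longrightarrow> sum f A \<in> sym_ideal r n"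
  using vs.subspace_sum[OF subspace_sym_ideal] by blast

lemma sym_ideal_add: "p \<in> sym_ideal r n \<Longrightarrow> q \<in> sym_ideal r n \<Longrightarrow> p + q \<in> sym_ideal r n"
  using vs.subspace_add[OF subspace_sym_ideal] by blast

lemma sym_ideal_0 [simp]: "0 \<in> sym_ideal r n"
  using vs.subspace_0[OF subspace_sym_ideal] by blast

lemma sym_ideal_scale: "p \<in> sym_ideal r n \<Longrightarrow> Const c * p \<in> sym_ideal r n"
  using vs.subspace_scale[OF subspace_sym_ideal] by (simp add: Const_def)

lemma single_eq_Const: "single w c = Const c * single w (1::'k::comm_ring_1)"
  by (simp add: Const_def mult_single)

lemma sym_ideal_gen_mult:
  assumes "is_type r \<mu>" "\<mu> \<noteq> {#}" "p \<in> polys r {..<n}"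
  shows "msym r n \<mu> * p \<in> sym_ideal r n"
proof -
  have "msym r n \<mu> * single w c \<in> sym_ideal r n" if "w \<in> words r {..<n}" for w c
  proof -
    have "msym r n \<mu> * single w 1 \<in> sym_ideal r n"
      unfolding sym_ideal_def by (rule vs.span_base) (use assms that in \<open>auto simp: sym_ideal_gens_def\<close>)
    then have "Const c * (msym r n \<mu> * single w 1) \<in> sym_ideal r n" by (rule sym_ideal_scale)
    then show ?thesis by (subst single_eq_Const) (simp add: ac_simps)
  qed
  then show ?thesis
    using assms(3) by (subst mult_expand_right) (auto simp: polys_def intro!: sym_ideal_sum)
qed

lemma sym_ideal_mult:
  assumes "q \<in> sym_ideal r n" "p \<in> polys r {..<n}"
  shows "q * p \<in> sym_ideal r n"
  using assms(1) unfolding sym_ideal_def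
proof (induction q rule: vs.span_induct_alt)
  case base
  show ?case using sym_ideal_0 by (simp add: sym_ideal_def)
next
  case (step c x y)
  obtain \<mu> w where x: "x = msym r n \<mu> * single w 1" "is_type r \<mu>" "\<mu> \<noteq> {#}" "w \<in> words r {..<n}"
    using step(1) by (auto simp: sym_ideal_gens_def)
  have "single w 1 * p \<in> polys r {..<n}" by (simp add: polys_mult polys_single assms x)
  from sym_ideal_gen_mult[OF x(2,3) this] have "x * p \<in> sym_ideal r n" by (simp add: x ac_simps)
  then have "Const c * (x * p) + y * p \<in> sym_ideal r n"
    using step(2) by (intro sym_ideal_add sym_ideal_scale) (auto simp: sym_ideal_def)
  moreover have "(single 0 c * x + y) * p = Const c * (x * p) + y * p"
    by (simp add: Const_def distrib_right mult.assoc)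
  ultimately show ?case by (simp only: sym_ideal_def)
qed

lemma polys_subspace: "vs.subspace (polys r S)"
  by (rule vs.subspaceI) (auto simp: polys_add polys_mult polys_single)

lemma sym_ideal_polys: "sym_ideal r n \<subseteq> polys r {..<n}"
  unfolding sym_ideal_def by (rule vs.span_minimal[OF _ polys_subspace])
    (auto simp: sym_ideal_gens_def intro!: polys_mult msym_polys polys_single)

lemma sym_ideal_perm_act:
  assumes \<sigma>: "\<sigma> permutes {..<n}" and "q \<in> sym_ideal r n"
  shows "perm_act \<sigma> q \<in> sym_ideal r n"
  using assms(2) unfolding sym_ideal_def
proof (induction q rule: vs.span_induct_alt)
  have b: "bij \<sigma>" using \<sigma> permutes_bij by blast
  {
    case base
    show ?case using sym_ideal_0 by (simp add: sym_ideal_def perm_act_0[OF b])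
  next
    case (step c x y)
    obtain \<mu> w where x: "x = msym r n \<mu> * single w 1" "is_type r \<mu>" "\<mu> \<noteq> {#}" "w \<in> words r {..<n}"
      using step(1) by (auto simp: sym_ideal_gens_def)
    have "perm_act \<sigma> x = msym r n \<mu> * single (relabel \<sigma> w) 1"
      by (simp add: x perm_act_mult[OF b] msym_inv[OF \<sigma>] perm_act_single[OF b])
    then have "perm_act \<sigma> x \<in> sym_ideal r n"
      using x sym_ideal_gen_mult polys_single words_relabel[OF \<sigma>] by metis
    then have "Const c * perm_act \<sigma> x + perm_act \<sigma> y \<in> sym_ideal r n"
      using step(2) by (intro sym_ideal_add sym_ideal_scale) (auto simp: sym_ideal_def)
    then show ?case
      using perm_act_scale[OF b, of c x] by (simp add: sym_ideal_def perm_act_add[OF b] Const_def)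
  }
qed

lemma words_empty: "w \<in> words r {} \<longleftrightarrow> w = 0"
  by (auto simp: words_def)

lemma polys_empty: "p \<in> polys r {} \<Longrightarrow> p = Const (lookup p 0)"
  by (rule poly_mapping_eqI) (auto simp: polys_def words_empty Const_def lookup_single when_def in_keys_iff subset_iff)

lemma lookup_msym_mult_0:
  assumes "\<kappa> \<noteq> {#}" shows "lookup (msym r n \<kappa> * s) 0 = (0 :: 'k::comm_ring_1)"
proof -
  have r0: "restr S 0 = 0" for S by (rule restr_0) simp
  have "lookup (msym r n \<kappa> * s) 0 = lookup (msym r n \<kappa>) 0 * lookup s (0::word)"
    using lookup_mult_low[of s UNIV 0 "msym r n \<kappa>"] by (simp add: r0)
  then show ?thesis using assms by (simp add: lookup_msym)
qed

lemma invariant_decomposition_full: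
  fixes q :: "('k::comm_ring_1) dpoly"
  assumes q: "q \<in> polys r {..<n}"
    and inv: "\<And>\<sigma>. \<sigma> permutes {..<n} \<Longrightarrow> perm_act \<sigma> q = q"
    and deg: "\<And>x. x \<in> keys q \<Longrightarrow> tdeg x \<le> N"
  obtains c where "q = (\<Sum>\<kappa>\<in>types r N. Const (c \<kappa>) * msym r n \<kappa>)"
proof -
  obtain s where s: "\<And>\<kappa>. s \<kappa> \<in> polys r {}" "q = (\<Sum>\<kappa>\<in>types r N. msym r n \<kappa> * s \<kappa>)"
    using invariant_decomposition[of "{}" n q r N] assms by auto
  have "q = (\<Sum>\<kappa>\<in>types r N. Const (lookup (s \<kappa>) 0) * msym r n \<kappa>)"
    unfolding s(2) using polys_empty[OF s(1)] by (metis (no_types, lifting) mult.commute)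
  then show thesis by (rule that)
qed

text \<open>This is the case \<open>T = {}\<close> of the decomposition, in which the coefficients of the orbit sums are
  constants; the empty type has coefficient zero because \<open>q\<close> has no constant term.\<close>

lemma invariant_in_sym_ideal:
  fixes q :: "('k::field_char_0) dpoly"
  assumes q: "q \<in> polys r {..<n}"
    and inv: "\<And>\<sigma>. \<sigma> permutes {..<n} \<Longrightarrow> perm_act \<sigma> q = q"
    and q0: "lookup q 0 = 0"
  shows "q \<in> sym_ideal r n"
proof -
  define N where "N = (\<Sum>x\<in>keys q. tdeg x)"
  have "tdeg x \<le> N" if "x \<in> keys q" for x
    unfolding N_def using that by (intro member_le_sum) auto
  then obtain c where c: "q = (\<Sum>\<kappa>\<in>types r N. Const (c \<kappa>) * msym r n \<kappa>)"
    using invariant_decomposition_full[of q r n N] assms by blast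
  have "lookup (msym r n \<kappa> :: 'k dpoly) 0 = 0" if "\<kappa> \<noteq> {#}" for \<kappa>
    using that by (simp add: lookup_msym)
  then have "(\<Sum>\<kappa>\<in>types r N. if \<kappa> = {#} then c \<kappa> else 0) = lookup q 0"
    unfolding c by (auto simp: lookup_sum lookup_one intro!: sum.cong)
  then have c0: "c {#} = 0" using q0 by (simp add: finite_types)
  have "Const (c \<kappa>) * msym r n \<kappa> \<in> sym_ideal r n" if "\<kappa> \<in> types r N" for \<kappa>
  proof (cases "\<kappa> = {#}")
    case False
    then have "msym r n \<kappa> * Const (c \<kappa>) \<in> sym_ideal r n"
      using that by (intro sym_ideal_gen_mult) (auto simp: types_iff polys_Const)
    then show ?thesis by (simp add: mult.commute)
  qed (simp add: c0)
  then show ?thesis unfolding c by (rule sym_ideal_sum)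
qed

section \<open>An equivariant projection onto a stable subspace\<close>

text \<open>Maschke: average a linear projection \<open>g\<close> onto \<open>W\<close> over its conjugates by the group.\<close>

lemma equivariant_projection:
  fixes W :: "('k::field_char_0) dpoly set"
  assumes W: "vs.subspace W" and U: "finite U"
    and stable: "\<And>\<sigma> x. \<sigma> permutes U \<Longrightarrow> x \<in> W \<Longrightarrow> perm_act \<sigma> x \<in> W"
  obtains P where "\<And>x y. P (x + y) = P x + P y" "\<And>c x. P (Const c * x) = Const c * P x"
    "\<And>x. P x \<in> W" "\<And>x. x \<in> W \<Longrightarrow> P x = x"
    "\<And>\<sigma> x. \<sigma> permutes U \<Longrightarrow> P (perm_act \<sigma> x) = perm_act \<sigma> (P x)"
proof -
  obtain B where B: "B \<subseteq> W" "vs.independent B" "W \<subseteq> vs.span B"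
    using vs.maximal_independent_subset[of W] by blast
  have spB: "vs.span B = W"
    using B W vs.span_minimal by blast
  obtain g where g: "Vector_Spaces.linear (\<lambda>c p. single 0 c * p) (\<lambda>c p. single 0 c * p) g"
    "\<And>x. x \<in> B \<Longrightarrow> g x = x" "range g = vs.span B"
    using vp.linear_independent_extend_subspace[OF B(2), of id] by auto
  have gadd: "g (x + y) = g x + g y" for x y by (rule vp.linear_add[OF g(1)])
  have gsc: "g (Const c * x) = Const c * g x" for c x
    using vp.linear_scale[OF g(1)] by (simp add: Const_def)
  have gW: "g x = x" if "x \<in> W" for x
    using that unfolding spB[symmetric]
    by (induction x rule: vs.span_induct_alt) (use vp.linear_0[OF g(1)] g(2) gadd gsc in \<open>auto simp: Const_def\<close>)
  have gin: "g x \<in> W" for x using g(3) spB by auto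
  define F where "F \<sigma> x = perm_act (pinv \<sigma>) (g (perm_act \<sigma> x))" for \<sigma> x
  define P where "P x = Const (inverse (of_nat (card {\<sigma>. \<sigma> permutes U}))) * (\<Sum>\<sigma> | \<sigma> permutes U. F \<sigma> x)" for x
  have bij: "bij \<sigma>" "bij (pinv \<sigma>)" if "\<sigma> permutes U" for \<sigma>
    using that permutes_bij permutes_inv by blast+
  have Fadd: "F \<sigma> (x + y) = F \<sigma> x + F \<sigma> y" if "\<sigma> permutes U" for \<sigma> x y
    using bij[OF that] by (simp add: F_def perm_act_add gadd)
  have Fsc: "F \<sigma> (Const c * x) = Const c * F \<sigma> x" if "\<sigma> permutes U" for \<sigma> c x
    using bij[OF that] by (simp add: F_def perm_act_scale gsc)
  have "P (x + y) = P x + P y" for x y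
    by (simp add: P_def Fadd sum.distrib distrib_left cong: sum.cong_simp)
  moreover have "P (Const c * x) = Const c * P x" for c x
    by (simp add: P_def Fsc flip: sum_distrib_left cong: sum.cong_simp)
  moreover have "P x \<in> W" for x
  proof -
    have "(\<Sum>\<sigma> | \<sigma> permutes U. F \<sigma> x) \<in> W"
      by (rule vs.subspace_sum[OF W]) (auto simp: F_def gin stable permutes_inv)
    then show ?thesis unfolding P_def Const_def by (rule vs.subspace_scale[OF W])
  qed
  moreover have "P x = x" if "x \<in> W" for x
  proof -
    have "F \<sigma> x = x" if s: "\<sigma> permutes U" for \<sigma>
    proof -
      have "F \<sigma> x = perm_act (pinv \<sigma>) (perm_act \<sigma> x)" using \<open>x \<in> W\<close> stable[OF s] by (simp add: F_def gW)
      also have "\<dots> = x"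
        by (rule poly_mapping_eqI) (use bij[OF s] in \<open>simp add: lookup_perm_act inv_inv_eq\<close>)
      finally show ?thesis .
    qed
    then have "P x = Const (inverse (of_nat (card {\<sigma>. \<sigma> permutes U}))) * (of_nat (card {\<sigma>. \<sigma> permutes U}) * x)"
      by (simp add: P_def cong: sum.cong_simp)
    also have "\<dots> = x"
      by (rule poly_mapping_eqI) (use card_perms_nz[OF U] in \<open>simp add: of_nat_single flip: Const_def\<close>)
    finally show ?thesis .
  qed
  moreover have "P (perm_act \<tau> x) = perm_act \<tau> (P x)" if t: "\<tau> permutes U" for \<tau> x
  proof -
    define G where "G \<sigma> = perm_act (\<tau> \<circ> pinv \<sigma>) (g (perm_act \<sigma> x))" for \<sigma>
    have "G (\<sigma> \<circ> \<tau>) = F \<sigma> (perm_act \<tau> x)" if s: "\<sigma> permutes U" for \<sigma>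
    proof -
      have "\<tau> \<circ> pinv (\<sigma> \<circ> \<tau>) = pinv \<sigma>"
        using bij[OF s] bij[OF t] by (simp add: o_inv_distrib flip: o_assoc) (simp add: o_assoc bij_is_surj surj_iff[THEN iffD1])
      then show ?thesis using bij[OF s] bij[OF t] by (simp add: G_def F_def perm_act_comp)
    qed
    then have "(\<Sum>\<sigma> | \<sigma> permutes U. F \<sigma> (perm_act \<tau> x)) = (\<Sum>\<sigma> | \<sigma> permutes U. G (\<sigma> \<circ> \<tau>))"
      by (simp cong: sum.cong_simp)
    also have "\<dots> = (\<Sum>\<sigma> | \<sigma> permutes U. G \<sigma>)"
      by (rule sum_permutations_compose_right[OF t, symmetric])
    also have "\<dots> = perm_act \<tau> (\<Sum>\<sigma> | \<sigma> permutes U. F \<sigma> x)"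
      unfolding perm_act_sum[OF bij(1)[OF t]]
      by (rule sum.cong) (auto simp: G_def F_def perm_act_comp bij t)
    finally show ?thesis by (simp add: P_def perm_act_scale[OF bij(1)[OF t]])
  qed
  ultimately show thesis by (rule that)
qed

section \<open>Freeness over the invariants in low degree\<close>

lemma card_cols_le_tdeg: "card (cols w) \<le> tdeg w"
proof -
  have "1 \<le> tdeg (column w j)" if "j \<in> cols w" for j
    using that tdeg_eq_0_iff[of "column w j"] cols_iff[of j w] by linarith
  then have "(\<Sum>j\<in>cols w. 1) \<le> (\<Sum>j\<in>cols w. tdeg (column w j))" by (rule sum_mono)
  also have "\<dots> = tdeg (mdeg w)" by (simp only: mdeg_def tdeg_sum)
  finally show ?thesis by simp
qed

lemma avg_equivariant:
  fixes P :: "('k::field_char_0) dpoly \<Rightarrow> 'k dpoly"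
  assumes add: "\<And>x y. P (x + y) = P x + P y" and sc: "\<And>c x. P (Const c * x) = Const c * P x"
    and eq: "\<And>\<sigma> x. \<sigma> permutes U \<Longrightarrow> P (perm_act \<sigma> x) = perm_act \<sigma> (P x)"
  shows "P (avg U h) = avg U (P h)"
proof -
  have P0: "P 0 = 0" using add[of 0 0] by simp
  have "P (sum f A) = (\<Sum>x\<in>A. P (f x))" for f and A :: "(nat \<Rightarrow> nat) set"
    by (induction A rule: infinite_finite_induct) (auto simp: P0 add)
  then show ?thesis by (simp add: avg_def sc eq cong: sum.cong_simp)
qed

text \<open>Let \<open>P\<close> be the equivariant projection onto \<open>W\<close>. For a monomial \<open>w\<close> of degree at most \<open>N\<close>, the average
  of \<open>h\<close> over the permutations outside of the columns of \<open>w\<close> is fixed by \<open>P\<close>, so \<open>h\<close> and \<open>P h\<close> have the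
  same average, hence the same coefficient at \<open>w\<close>.\<close>

lemma in_stable_subspace_by_averages:
  fixes W :: "('k::field_char_0) dpoly set"
  assumes W: "vs.subspace W" "W \<subseteq> polys r {..<n}" "\<And>p w. p \<in> W \<Longrightarrow> w \<in> keys p \<Longrightarrow> tdeg w \<le> N"
    and stable: "\<And>\<sigma> x. \<sigma> permutes {..<n} \<Longrightarrow> x \<in> W \<Longrightarrow> perm_act \<sigma> x \<in> W"
    and h: "h \<in> polys r {..<n}" "\<And>w. w \<in> keys h \<Longrightarrow> tdeg w \<le> N"
    and avg: "\<And>T. T \<subseteq> {..<n} \<Longrightarrow> card T \<le> N \<Longrightarrow> avg ({..<n} - T) h \<in> W"
  shows "h \<in> W"
proof -
  show ?thesis
  proof (rule equivariant_projection[OF W(1) finite_lessThan stable])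
    fix P assume P: "\<And>x y. P (x + y) = P x + P y" "\<And>c x. P (Const c * x) = Const c * P x"
      "\<And>x. P x \<in> W" "\<And>x. x \<in> W \<Longrightarrow> P x = x"
      "\<And>\<sigma> x. \<sigma> permutes {..<n} \<Longrightarrow> P (perm_act \<sigma> x) = perm_act \<sigma> (P x)"
    have "lookup h w = lookup (P h) w" for w
    proof (cases "w \<in> words r {..<n} \<and> tdeg w \<le> N")
      case True
      define U where "U = {..<n} - cols w"
      have sub: "cols w \<subseteq> {..<n}" using True words_cols by blast
      have "card (cols w) \<le> N" using card_cols_le_tdeg[of w] True by simp
      then have "avg U h \<in> W" using avg[OF sub] by (simp add: U_def)
      then have "avg U h = P (avg U h)" using P(4) by simp
      also have "\<dots> = avg U (P h)"
      proof (rule avg_equivariant[OF P(1,2)])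
        fix \<sigma> x assume "\<sigma> permutes U"
        then have "\<sigma> permutes {..<n}" by (rule permutes_subset) (auto simp: U_def)
        then show "P (perm_act \<sigma> x) = perm_act \<sigma> (P x)" by (rule P(5))
      qed
      finally have *: "avg U h = avg U (P h)" .
      have "finite U" "cols w \<inter> U = {}" by (auto simp: U_def)
      from lookup_avg_fixed[OF this, of h] lookup_avg_fixed[OF this, of "P h"] *
      show ?thesis by simp
    next
      case False
      then have "w \<notin> keys h" using polys_keys[OF h(1), of w] h(2)[of w] by blast
      moreover have "w \<notin> keys (P h)"
        using False polys_keys[of "P h" r "{..<n}" w] W(2) P(3)[of h] W(3)[of "P h" w] by blast
      ultimately show ?thesis by (simp add: in_keys_iff)
    qed
    then have "h = P h" by (rule poly_mapping_eqI)
    then show "h \<in> W" using P(3)[of h] by simp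
  qed
qed

lemma lookup_msym_combination:
  "lookup (\<Sum>\<kappa>\<in>types r N. Const (c \<kappa>) * msym r n \<kappa>) w =
    (if w \<in> words r {..<n} \<and> coltype w \<in> types r N then c (coltype w) else (0::'k::comm_ring_1))"
proof -
  have "lookup (\<Sum>\<kappa>\<in>types r N. Const (c \<kappa>) * msym r n \<kappa>) w =
     (\<Sum>\<kappa>\<in>types r N. if \<kappa> = coltype w then (if w \<in> words r {..<n} then c (coltype w) else 0) else 0)"
    by (auto simp: lookup_sum lookup_msym intro!: sum.cong)
  then show ?thesis by (simp add: finite_types)
qed

text \<open>A product of orbit sums is invariant, hence a combination of orbit sums. When a type does not fit into
  \<open>n\<close> columns its orbit sum is zero and its coefficient is arbitrary; it is set to zero in order to have the
  degree condition for all types.\<close>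

lemma msym_mult:
  assumes "wt \<mu> + wt \<nu> \<le> N"
  obtains c :: "(nat \<Rightarrow>\<^sub>0 nat) multiset \<Rightarrow> 'k::comm_ring_1"
  where "msym r n \<mu> * msym r n \<nu> = (\<Sum>\<kappa>\<in>types r N. Const (c \<kappa>) * msym r n \<kappa>)"
    "\<And>\<kappa>. c \<kappa> \<noteq> 0 \<Longrightarrow> sum_mset \<kappa> = sum_mset \<mu> + sum_mset \<nu>"
proof -
  let ?q = "msym r n \<mu> * msym r n \<nu> :: 'k dpoly"
  have deg: "mdeg x = sum_mset \<mu> + sum_mset \<nu>" if x: "x \<in> keys ?q" for x
  proof -
    obtain a b where ab: "x = a + b" "a \<in> keys (msym r n \<mu> :: 'k dpoly)"
      "b \<in> keys (msym r n \<nu> :: 'k dpoly)"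
      using x keys_mult[of "msym r n \<mu>" "msym r n \<nu>"] by blast
    then show ?thesis using keys_msym[OF ab(2)] keys_msym[OF ab(3)] sum_mset_coltype[of a] sum_mset_coltype[of b] by (simp add: ab(1))
  qed
  have inv: "perm_act \<sigma> ?q = ?q" if "\<sigma> permutes {..<n}" for \<sigma>
    using that by (simp add: perm_act_mult permutes_bij msym_inv)
  have "tdeg x \<le> N" if "x \<in> keys ?q" for x
    using deg[OF that] assms by (metis tdeg_add tdeg_mdeg)
  then obtain c where c: "?q = (\<Sum>\<kappa>\<in>types r N. Const (c \<kappa>) * msym r n \<kappa>)"
    using invariant_decomposition_full[of ?q r n N] inv polys_mult[OF msym_polys msym_polys] by blast
  define c' where "c' \<kappa> = (if sum_mset \<kappa> = sum_mset \<mu> + sum_mset \<nu> then c \<kappa> else 0)" for \<kappa>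
  have "?q = (\<Sum>\<kappa>\<in>types r N. Const (c' \<kappa>) * msym r n \<kappa>)"
  proof (rule poly_mapping_eqI)
    fix x
    have 0: "lookup ?q x = 0" if "mdeg x \<noteq> sum_mset \<mu> + sum_mset \<nu>"
      using deg[of x] that by (auto simp: in_keys_iff)
    have "lookup ?q x = (if x \<in> words r {..<n} \<and> coltype x \<in> types r N then c (coltype x) else 0)"
      using arg_cong[OF c, of "\<lambda>p. lookup p x"] by (simp only: lookup_msym_combination)
    then show "lookup ?q x = lookup (\<Sum>\<kappa>\<in>types r N. Const (c' \<kappa>) * msym r n \<kappa>) x"
      using 0 by (simp only: lookup_msym_combination c'_def sum_mset_coltype) metis
  qed
  then show thesis by (rule that) (auto simp: c'_def split: if_splits)
qed

definition struct_const ::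
  "nat \<Rightarrow> nat \<Rightarrow> nat \<Rightarrow> (nat \<Rightarrow>\<^sub>0 nat) multiset \<Rightarrow> (nat \<Rightarrow>\<^sub>0 nat) multiset \<Rightarrow> (nat \<Rightarrow>\<^sub>0 nat) multiset \<Rightarrow> 'k::comm_ring_1"
  where "struct_const r n N \<mu> \<nu> = (SOME c. msym r n \<mu> * msym r n \<nu> = (\<Sum>\<kappa>\<in>types r N. Const (c \<kappa>) * msym r n \<kappa>)
     \<and> (\<forall>\<kappa>. c \<kappa> \<noteq> 0 \<longrightarrow> sum_mset \<kappa> = sum_mset \<mu> + sum_mset \<nu>))"

lemma struct_const:
  assumes "wt \<mu> + wt \<nu> \<le> N"
  shows "msym r n \<mu> * msym r n \<nu> = (\<Sum>\<kappa>\<in>types r N. Const (struct_const r n N \<mu> \<nu> \<kappa> :: 'k::comm_ring_1) * msym r n \<kappa>)"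
    and "(struct_const r n N \<mu> \<nu> \<kappa> :: 'k) \<noteq> 0 \<Longrightarrow> sum_mset \<kappa> = sum_mset \<mu> + sum_mset \<nu>"
proof -
  have "\<exists>c :: _ \<Rightarrow> 'k. msym r n \<mu> * msym r n \<nu> = (\<Sum>\<kappa>\<in>types r N. Const (c \<kappa>) * msym r n \<kappa>)
     \<and> (\<forall>\<kappa>. c \<kappa> \<noteq> 0 \<longrightarrow> sum_mset \<kappa> = sum_mset \<mu> + sum_mset \<nu>)"
    by (rule msym_mult[OF assms, of r n, where 'k = 'k]) blast
  from someI_ex[OF this]
  show "msym r n \<mu> * msym r n \<nu> = (\<Sum>\<kappa>\<in>types r N. Const (struct_const r n N \<mu> \<nu> \<kappa> :: 'k) * msym r n \<kappa>)"
    "(struct_const r n N \<mu> \<nu> \<kappa> :: 'k) \<noteq> 0 \<Longrightarrow> sum_mset \<kappa> = sum_mset \<mu> + sum_mset \<nu>"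
    by (auto simp: struct_const_def[symmetric])
qed

lemma types_word:
  assumes "\<kappa> \<in> types r N" "N \<le> n"
  shows "\<exists>u\<in>words r {..<n}. coltype u = \<kappa>"
proof (rule exists_word)
  show "size \<kappa> \<le> card {..<n}" using types_size[OF assms(1)] assms by (simp add: types_iff)
qed (use assms in \<open>auto simp: types_def\<close>)

lemma struct_const_empty:
  assumes "wt \<mu> \<le> N" "N \<le> n" "\<kappa> \<in> types r N"
  shows "struct_const r n N \<mu> {#} \<kappa> = (if \<kappa> = \<mu> then 1 else (0::'k::comm_ring_1))"
proof -
  obtain u where u: "u \<in> words r {..<n}" "coltype u = \<kappa>" using types_word[OF assms(3,2)] by blast
  have "lookup (msym r n \<mu> * msym r n {#} :: 'k dpoly) u = struct_const r n N \<mu> {#} \<kappa>"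
    using u assms by (subst struct_const(1)[of _ _ N]) (simp_all add: lookup_msym_combination)
  then show ?thesis using u by (simp add: lookup_msym)
qed

lemma is_type_tdeg_0: "is_type r \<nu> \<Longrightarrow> wt \<nu> = 0 \<Longrightarrow> \<nu> = {#}"
  using types_size[of \<nu> r 0] by (simp add: types_iff)

text \<open>The independence part of freeness. Average the relation over the permutations outside of \<open>T\<close>,
  expand the averages in the orbit sums with coefficients \<open>S\<close> in the columns \<open>T\<close>, and multiply out the products of
  orbit sums. The coefficient of the orbit sum of \<open>\<mu>0\<close> is zero by independence. The contributions to it come from types
  \<open>\<mu>\<close> and \<open>\<nu>\<close> whose sums add up to that of \<open>\<mu>0\<close>, and since there is nothing below degree \<open>d\<close> the only one is
  \<open>S \<mu>0 {#}\<close>. So the average of \<open>h \<mu>0\<close> has only terms with a nonempty orbit sum.\<close>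

lemma lowest_relation_in_sym_ideal:
  fixes h :: "(nat \<Rightarrow>\<^sub>0 nat) multiset \<Rightarrow> ('k::field_char_0) dpoly"
  assumes n: "3 * N \<le> n"
    and hP: "\<And>\<mu>. \<mu> \<in> types r N \<Longrightarrow> h \<mu> \<in> polys r {..<n}"
    and hdeg: "\<And>\<mu> w. \<mu> \<in> types r N \<Longrightarrow> w \<in> keys (h \<mu>) \<Longrightarrow> tdeg w \<le> N"
    and rel: "(\<Sum>\<mu>\<in>types r N. msym r n \<mu> * h \<mu>) = 0"
    and low: "\<And>\<mu>. \<mu> \<in> types r N \<Longrightarrow> wt \<mu> < d \<Longrightarrow> h \<mu> = 0"
    and \<mu>0: "\<mu>0 \<in> types r N" "wt \<mu>0 = d"
  shows "h \<mu>0 \<in> sym_ideal r n"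
proof -
  define W where "W = {p :: 'k dpoly. p \<in> sym_ideal r n \<and> (\<forall>w\<in>keys p. tdeg w \<le> N)}"
  have "h \<mu>0 \<in> W"
  proof (rule in_stable_subspace_by_averages[where n = n and r = r and N = N])
    show "vs.subspace W"
    proof (rule vs.subspaceI)
      show "0 \<in> W" by (simp add: W_def)
    next
      fix x y assume "x \<in> W" "y \<in> W"
      then show "x + y \<in> W" using Poly_Mapping.keys_add[of x y] by (auto simp: W_def sym_ideal_add)
    next
      fix c x assume "x \<in> W"
      then show "single 0 c * x \<in> W"
        using sym_ideal_scale[of x r n c] lookup_Const_mult[of c x] by (auto simp: W_def in_keys_iff simp flip: Const_def)
    qed
    show "W \<subseteq> polys r {..<n}" using sym_ideal_polys by (auto simp: W_def)
    show "tdeg w \<le> N" if "p \<in> W" "w \<in> keys p" for p w using that by (simp add: W_def)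
    show "perm_act \<sigma> x \<in> W" if s: "\<sigma> permutes {..<n}" and x: "x \<in> W" for \<sigma> x
    proof -
      have b: "bij \<sigma>" using s permutes_bij by blast
      have "tdeg w \<le> N" if w: "w \<in> keys (perm_act \<sigma> x)" for w
      proof -
        have "relabel (pinv \<sigma>) w \<in> keys x" using w keys_perm_act[OF b] by blast
        then have "tdeg (relabel (pinv \<sigma>) w) \<le> N" using x by (simp add: W_def)
        then show ?thesis using tdeg_relabel[of "pinv \<sigma>"] b bij_imp_bij_inv by metis
      qed
      then show ?thesis using x sym_ideal_perm_act[OF s, of x r] by (simp add: W_def)
    qed
    show "h \<mu>0 \<in> polys r {..<n}" using hP \<mu>0 by blast
    show "tdeg w \<le> N" if "w \<in> keys (h \<mu>0)" for w using hdeg[OF \<mu>0(1)] that by blast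
  next
    fix T assume T: "T \<subseteq> {..<n}" "card T \<le> N"
    let ?U = "{..<n} - T"
    define g where "g \<mu> = avg ?U (h \<mu>)" for \<mu>
    have gdeg: "tdeg w \<le> N" if "\<mu> \<in> types r N" "w \<in> keys (g \<mu>)" for \<mu> w
      using tdeg_keys_avg[of "h \<mu>" N w ?U] hdeg that by (auto simp: g_def)
    have "\<exists>s. (\<forall>\<nu>. s \<nu> \<in> polys r T) \<and> g \<mu> = (\<Sum>\<nu>\<in>types r N. msym r n \<nu> * s \<nu>) \<and> (h \<mu> = 0 \<longrightarrow> s = (\<lambda>_. 0))"
      if \<mu>: "\<mu> \<in> types r N" for \<mu>
    proof (cases "h \<mu> = 0")
      case True
      then show ?thesis by (intro exI[of _ "\<lambda>_. 0"]) (simp add: g_def)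
    next
      case False
      have gP: "g \<mu> \<in> polys r {..<n}" unfolding g_def by (rule avg_polys) (use hP[OF \<mu>] in auto)
      have ginv: "perm_act \<sigma> (g \<mu>) = g \<mu>" if "\<sigma> permutes ?U" for \<sigma>
        unfolding g_def by (rule avg_inv[OF that])
      obtain s where "\<And>\<nu>. s \<nu> \<in> polys r T" "g \<mu> = (\<Sum>\<nu>\<in>types r N. msym r n \<nu> * s \<nu>)"
        by (rule invariant_decomposition[OF T(1) gP ginv gdeg[OF \<mu>]]) blast+
      then show ?thesis using False by blast
    qed
    then have "\<forall>\<mu>\<in>types r N. \<exists>s. (\<forall>\<nu>. s \<nu> \<in> polys r T) \<and> g \<mu> = (\<Sum>\<nu>\<in>types r N. msym r n \<nu> * s \<nu>) \<and> (h \<mu> = 0 \<longrightarrow> s = (\<lambda>_. 0))"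
      by blast
    from bchoice[OF this] obtain S where S': "\<forall>\<mu>\<in>types r N. (\<forall>\<nu>. S \<mu> \<nu> \<in> polys r T) \<and>
        g \<mu> = (\<Sum>\<nu>\<in>types r N. msym r n \<nu> * S \<mu> \<nu>) \<and> (h \<mu> = 0 \<longrightarrow> S \<mu> = (\<lambda>_. 0))"
      by blast
    have S: "\<And>\<mu> \<nu>. \<mu> \<in> types r N \<Longrightarrow> S \<mu> \<nu> \<in> polys r T"
      "\<And>\<mu>. \<mu> \<in> types r N \<Longrightarrow> g \<mu> = (\<Sum>\<nu>\<in>types r N. msym r n \<nu> * S \<mu> \<nu>)"
      "\<And>\<mu>. \<mu> \<in> types r N \<Longrightarrow> h \<mu> = 0 \<Longrightarrow> S \<mu> = (\<lambda>_. 0)"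
      using S' by blast+
    define c where "c \<mu> \<nu> \<kappa> = (struct_const r n (2 * N) \<mu> \<nu> \<kappa> :: 'k)" for \<mu> \<nu> \<kappa>
    have mm: "msym r n \<mu> * msym r n \<nu> = (\<Sum>\<kappa>\<in>types r (2 * N). Const (c \<mu> \<nu> \<kappa>) * msym r n \<kappa>)"
      if "\<mu> \<in> types r N" "\<nu> \<in> types r N" for \<mu> \<nu>
      unfolding c_def by (rule struct_const) (use that in \<open>auto simp: types_iff\<close>)
    have cnz: "sum_mset \<kappa> = sum_mset \<mu> + sum_mset \<nu>" if "\<mu> \<in> types r N" "\<nu> \<in> types r N" "c \<mu> \<nu> \<kappa> \<noteq> 0" for \<mu> \<nu> \<kappa>
      by (rule struct_const(2)[of _ _ "2 * N"]) (use that in \<open>auto simp: types_iff c_def\<close>)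
    \<comment> \<open>\<open>R \<kappa>\<close> is the coefficient of the orbit sum of \<open>\<kappa>\<close> in the averaged relation. The types \<open>\<kappa>\<close> of products have
      degree up to \<open>2 * N\<close>, and \<open>T\<close> has up to \<open>N\<close> columns; this is where \<open>3 * N\<close> comes from.\<close>
    define R where "R \<kappa> = (\<Sum>\<mu>\<in>types r N. \<Sum>\<nu>\<in>types r N. Const (c \<mu> \<nu> \<kappa>) * S \<mu> \<nu>)" for \<kappa>
    have "0 = avg ?U (\<Sum>\<mu>\<in>types r N. msym r n \<mu> * h \<mu>)" by (simp add: rel)
    also have "\<dots> = (\<Sum>\<mu>\<in>types r N. msym r n \<mu> * g \<mu>)"
      unfolding avg_sum g_def
      by (intro sum.cong refl avg_mult msym_inv) (auto intro: permutes_subset)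
    also have "\<dots> = (\<Sum>\<mu>\<in>types r N. \<Sum>\<nu>\<in>types r N. (msym r n \<mu> * msym r n \<nu>) * S \<mu> \<nu>)"
      by (intro sum.cong refl) (simp add: S(2) sum_distrib_left mult.assoc)
    also have "\<dots> = (\<Sum>\<mu>\<in>types r N. \<Sum>\<nu>\<in>types r N. \<Sum>\<kappa>\<in>types r (2 * N). msym r n \<kappa> * (Const (c \<mu> \<nu> \<kappa>) * S \<mu> \<nu>))"
      by (intro sum.cong refl) (simp add: mm sum_distrib_right sum_distrib_left ac_simps)
    also have "\<dots> = (\<Sum>\<mu>\<in>types r N. \<Sum>\<kappa>\<in>types r (2 * N). \<Sum>\<nu>\<in>types r N. msym r n \<kappa> * (Const (c \<mu> \<nu> \<kappa>) * S \<mu> \<nu>))"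
      by (rule sum.cong[OF refl]) (rule sum.swap)
    also have "\<dots> = (\<Sum>\<kappa>\<in>types r (2 * N). \<Sum>\<mu>\<in>types r N. \<Sum>\<nu>\<in>types r N. msym r n \<kappa> * (Const (c \<mu> \<nu> \<kappa>) * S \<mu> \<nu>))"
      by (rule sum.swap)
    also have "\<dots> = (\<Sum>\<kappa>\<in>types r (2 * N). msym r n \<kappa> * R \<kappa>)"
      by (simp add: R_def sum_distrib_left)
    finally have eq: "(\<Sum>\<kappa>\<in>types r (2 * N). msym r n \<kappa> * R \<kappa>) = 0" by simp
    have RP: "R \<kappa> \<in> polys r T" for \<kappa> unfolding R_def by (intro polys_sum polys_scale S(1))
    have \<mu>02: "\<mu>0 \<in> types r (2 * N)" using \<mu>0 by (auto intro: types_mono)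
    have "R \<mu>0 = 0"
      by (rule msym_independent[OF T(1) _ RP eq \<mu>02]) (use T n in auto)
    have summand: "Const (c \<mu> \<nu> \<mu>0) * S \<mu> \<nu> = (if \<nu> = {#} then (if \<mu> = \<mu>0 then S \<mu>0 {#} else 0) else 0)"
      if \<mu>: "\<mu> \<in> types r N" and \<nu>: "\<nu> \<in> types r N" for \<mu> \<nu>
    proof (cases "\<nu> = {#}")
      case True
      have "c \<mu> {#} \<mu>0 = (if \<mu>0 = \<mu> then 1 else 0)"
        unfolding c_def by (rule struct_const_empty) (use n \<mu> \<mu>02 in \<open>auto simp: types_iff\<close>)
      then show ?thesis using True by simp
    next
      case False
      have "c \<mu> \<nu> \<mu>0 = 0 \<or> S \<mu> \<nu> = 0"
      proof (rule ccontr)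
        assume *: "\<not> ?thesis"
        then have "sum_mset \<mu>0 = sum_mset \<mu> + sum_mset \<nu>" using cnz[OF \<mu> \<nu>] by blast
        then have "d = wt \<mu> + wt \<nu>" using \<mu>0 by (metis tdeg_add)
        moreover have "\<not> wt \<mu> < d" using * low[OF \<mu>] S(3)[OF \<mu>] by auto
        ultimately have "wt \<nu> = 0" by linarith
        then show False using False is_type_tdeg_0[of r \<nu>] \<nu> by (simp add: types_iff)
      qed
      then show ?thesis using False by auto
    qed
    have "R \<mu>0 = S \<mu>0 {#}"
      using \<mu>0 by (simp add: R_def summand finite_types)
    then have S0: "S \<mu>0 {#} = 0" using \<open>R \<mu>0 = 0\<close> by simp
    have "msym r n \<nu> * S \<mu>0 \<nu> \<in> sym_ideal r n" if "\<nu> \<in> types r N" for \<nu>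
    proof (cases "\<nu> = {#}")
      case False
      then show ?thesis using that polys_mono[OF T(1) S(1)[OF \<mu>0(1)]] by (intro sym_ideal_gen_mult) (auto simp: types_iff)
    qed (simp add: S0)
    then have "g \<mu>0 \<in> sym_ideal r n" unfolding S(2)[OF \<mu>0(1)] by (rule sym_ideal_sum)
    then show "avg ?U (h \<mu>0) \<in> W" using gdeg[OF \<mu>0(1)] by (simp add: W_def g_def)
  qed
  then show ?thesis by (simp add: W_def)
qed

section \<open>The trace of a permutation on a multigraded piece\<close>

definition homog :: "nat \<Rightarrow> nat \<Rightarrow> (nat \<Rightarrow>\<^sub>0 nat) \<Rightarrow> ('k::field_char_0) dpoly set" where
  "homog r n D = {p \<in> polys r {..<n}. \<forall>w\<in>keys p. mdeg w = D}"

lemma homog_0 [simp]: "0 \<in> homog r n D" by (simp add: homog_def)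

lemma homog_add: "p \<in> homog r n D \<Longrightarrow> q \<in> homog r n D \<Longrightarrow> p + q \<in> homog r n D"
  using Poly_Mapping.keys_add[of p q] by (auto simp: homog_def polys_add)

lemma homog_scale: "p \<in> homog r n D \<Longrightarrow> Const c * p \<in> homog r n D"
  by (auto simp: homog_def polys_scale in_keys_iff)

lemma homog_sum: "(\<And>x. x \<in> A \<Longrightarrow> f x \<in> homog r n D) \<Longrightarrow> sum f A \<in> homog r n D"
  by (induction A rule: infinite_finite_induct) (auto simp: homog_add)

lemma homog_diff: "p \<in> homog r n D \<Longrightarrow> q \<in> homog r n D \<Longrightarrow> p - q \<in> homog r n D"
  using homog_add[of p r n D "Const (- 1) * q"] homog_scale[of q r n D "- 1"] by (simp add: Const_uminus)

lemma homog_single: "w \<in> words r {..<n} \<Longrightarrow> mdeg w = D \<Longrightarrow> single w c \<in> homog r n D"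
  by (auto simp: homog_def polys_single)

lemma homog_perm_act:
  assumes "\<sigma> permutes {..<n}" "p \<in> homog r n D"
  shows "perm_act \<sigma> p \<in> homog r n D"
proof -
  have b: "bij \<sigma>" "bij (pinv \<sigma>)" using assms(1) permutes_bij permutes_inv by blast+
  have "mdeg w = D" if "w \<in> keys (perm_act \<sigma> p)" for w
    using that assms(2) mdeg_relabel[OF b(2), of w] by (auto simp: keys_perm_act[OF b(1)] homog_def)
  then show ?thesis using polys_perm_act[OF assms(1)] assms(2) by (auto simp: homog_def)
qed

definition homog_part :: "(nat \<Rightarrow>\<^sub>0 nat) \<Rightarrow> ('k::comm_ring_1) dpoly \<Rightarrow> 'k dpoly" where
  "homog_part D p = Poly_Mapping.mapp (\<lambda>w c. c when mdeg w = D) p"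

lemma lookup_homog_part: "lookup (homog_part D p) w = (lookup p w when mdeg w = D)"
  by (auto simp: homog_part_def lookup_mapp when_def in_keys_iff)

lemma homog_part_id: "p \<in> homog r n D \<Longrightarrow> homog_part D p = p"
  by (rule poly_mapping_eqI) (auto simp: lookup_homog_part homog_def when_def in_keys_iff)

definition hom_gens :: "nat \<Rightarrow> nat \<Rightarrow> (nat \<Rightarrow>\<^sub>0 nat) \<Rightarrow> ('k::field_char_0) dpoly set" where
  "hom_gens r n D = {msym r n \<mu> * single w 1 |\<mu> w. is_type r \<mu> \<and> \<mu> \<noteq> {#} \<and> w \<in> words r {..<n} \<and> sum_mset \<mu> + mdeg w = D}"

lemma keys_msym_single:
  assumes "x \<in> keys (msym r n \<mu> * single w 1 :: ('k::comm_ring_1) dpoly)"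
  shows "mdeg x = sum_mset \<mu> + mdeg w"
proof -
  obtain a where a: "x = a + w" "a \<in> keys (msym r n \<mu> :: 'k dpoly)"
    using assms keys_mult[of "msym r n \<mu>" "single w (1::'k)"] by auto
  then show ?thesis using keys_msym[OF a(2)] sum_mset_coltype[of a] by simp
qed

text \<open>All generators are homogeneous, so taking the part of degree \<open>D\<close> either keeps or kills them.\<close>

lemma homog_part_in_span:
  assumes "p \<in> sym_ideal r n"
  shows "homog_part D p \<in> vs.span (hom_gens r n D)"
  using assms unfolding sym_ideal_def
proof (induction p rule: vs.span_induct_alt)
  case base
  have "homog_part D 0 = (0 :: 'a dpoly)" by (rule poly_mapping_eqI) (simp add: lookup_homog_part)
  then show ?case by (simp add: vs.span_zero)
next
  case (step c x y)
  obtain \<mu> w where x: "x = msym r n \<mu> * single w 1" "is_type r \<mu>" "\<mu> \<noteq> {#}" "w \<in> words r {..<n}"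
    using step(1) by (auto simp: sym_ideal_gens_def)
  have deg: "mdeg v = sum_mset \<mu> + mdeg w" if "lookup x v \<noteq> 0" for v
    using keys_msym_single[of v r n \<mu> w, where 'k = 'a] that by (simp add: x in_keys_iff)
  have cx: "homog_part D x \<in> vs.span (hom_gens r n D)"
  proof (cases "sum_mset \<mu> + mdeg w = D")
    case True
    then have "homog_part D x = x"
      by (intro poly_mapping_eqI) (use deg in \<open>auto simp: lookup_homog_part when_def\<close>)
    moreover have "x \<in> hom_gens r n D" using x True by (auto simp: hom_gens_def)
    ultimately show ?thesis by (simp add: vs.span_base)
  next
    case False
    have "homog_part D x = 0"
    proof (rule poly_mapping_eqI)
      fix v show "lookup (homog_part D x) v = lookup 0 v"
        using deg[of v] False by (cases "lookup x v = 0") (auto simp: lookup_homog_part when_def)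
    qed
    then show ?thesis by (simp add: vs.span_zero)
  qed
  have "homog_part D (single 0 c * x + y) = single 0 c * homog_part D x + homog_part D y"
    by (rule poly_mapping_eqI) (auto simp: lookup_homog_part lookup_add when_def simp flip: Const_def)
  then show ?case using cx step(2) by (simp add: vs.span_add vs.span_scale)
qed

lemma homogeneous_sym_ideal:
  "p \<in> sym_ideal r n \<Longrightarrow> p \<in> homog r n D \<Longrightarrow> p \<in> vs.span (hom_gens r n D)"
  using homog_part_in_span[of p r n D] homog_part_id[of p r n D] by simp

abbreviation lincomb :: "(nat \<Rightarrow> 'k::comm_ring_1) \<Rightarrow> 'k dpoly list \<Rightarrow> 'k dpoly" where
  "lincomb c us \<equiv> \<Sum>i<length us. Const (c i) * us ! i"

definition basis_mod_ideal :: "nat \<Rightarrow> nat \<Rightarrow> (nat \<Rightarrow>\<^sub>0 nat) \<Rightarrow> ('k::field_char_0) dpoly list \<Rightarrow> bool" where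
  "basis_mod_ideal r n D bs \<longleftrightarrow> set bs \<subseteq> homog r n D
     \<and> (\<forall>c. lincomb c bs \<in> sym_ideal r n \<longrightarrow> (\<forall>i<length bs. c i = 0))
     \<and> (\<forall>v\<in>homog r n D. \<exists>c. v - lincomb c bs \<in> sym_ideal r n)"

text \<open>A relation rather than a function, because the independence of the choice of basis is only obtained
  at the end, for large \<open>n\<close>, from the recursion for the trace.\<close>

definition trace_mod_ideal :: "nat \<Rightarrow> nat \<Rightarrow> (nat \<Rightarrow>\<^sub>0 nat) \<Rightarrow> (nat \<Rightarrow> nat) \<Rightarrow> 'k::field_char_0 \<Rightarrow> bool" where
  "trace_mod_ideal r n D \<sigma> t \<longleftrightarrow> (\<exists>bs M. basis_mod_ideal r n D bs
     \<and> (\<forall>j<length bs. perm_act \<sigma> (bs ! j) - lincomb (\<lambda>i. M i j) bs \<in> sym_ideal r n)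
     \<and> t = (\<Sum>i<length bs. M i i))"

lemma span_image_explicit:
  fixes F :: "'i \<Rightarrow> ('v::comm_monoid_add \<Rightarrow>\<^sub>0 'k::field)"
  assumes "finite A" "x \<in> vs.span (F ` A)"
  shows "\<exists>c. (\<forall>i. i \<notin> A \<longrightarrow> c i = 0) \<and> x = (\<Sum>i\<in>A. single 0 (c i) * F i)"
  using assms(2)
proof (induction x rule: vs.span_induct_alt)
  case base
  show ?case by (rule exI[of _ "\<lambda>_. 0"]) simp
next
  case (step a x y)
  then obtain c where c: "\<forall>i. i \<notin> A \<longrightarrow> c i = 0" "y = (\<Sum>i\<in>A. single 0 (c i) * F i)" by blast
  obtain j where j: "j \<in> A" "x = F j" using step(1) by blast
  have "single 0 a * x = (\<Sum>i\<in>A. if i = j then single 0 a * F i else 0)"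
    using j assms(1) by simp
  also have "\<dots> = (\<Sum>i\<in>A. single 0 (if i = j then a else 0) * F i)"
    by (intro sum.cong) auto
  finally have "single 0 a * x + y = (\<Sum>i\<in>A. single 0 ((if i = j then a else 0) + c i) * F i)"
    by (simp add: c(2) single_add distrib_right sum.distrib)
  then show ?case using c(1) j by (intro exI[of _ "\<lambda>i. (if i = j then a else 0) + c i"]) auto
qed

text \<open>The trace in the basis \<open>F\<close> equals the trace in the basis of monomials. If \<open>C\<close> expresses the monomials
  in \<open>F\<close>, then \<open>C\<close> and the coefficients of \<open>F\<close> are inverse matrices.\<close>

lemma trace_eq_diagonal_sum:
  fixes F :: "'i \<Rightarrow> ('k::field_char_0) dpoly"
  assumes fin: "finite A" "finite X"
    and keys: "\<And>i. i \<in> A \<Longrightarrow> keys (F i) \<subseteq> X"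
    and indep: "\<And>c i. (\<Sum>i\<in>A. Const (c i) * F i) = 0 \<Longrightarrow> i \<in> A \<Longrightarrow> c i = 0"
    and spans: "\<And>w. w \<in> X \<Longrightarrow> \<exists>c. single w 1 = (\<Sum>i\<in>A. Const (c i) * F i)"
    and T: "\<And>x y. T (x + y) = T x + T y" "\<And>c x. T (Const c * x) = Const c * T x"
    and M: "\<And>j. j \<in> A \<Longrightarrow> T (F j) = (\<Sum>i\<in>A. Const (M i j) * F i)"
  shows "(\<Sum>i\<in>A. M i i) = (\<Sum>w\<in>X. lookup (T (single w 1)) w)"
proof -
  have "\<forall>w\<in>X. \<exists>c. single w 1 = (\<Sum>i\<in>A. Const (c i) * F i)" using spans by blast
  from bchoice[OF this] obtain C where C: "\<And>w. w \<in> X \<Longrightarrow> single w 1 = (\<Sum>i\<in>A. Const (C w i) * F i)"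
    by blast
  have T0: "T 0 = 0" using T(1)[of 0 0] by simp
  have Tsum: "T (sum f B) = (\<Sum>x\<in>B. T (f x))" for f and B :: "'i set"
    by (induction B rule: infinite_finite_induct) (auto simp: T0 T)
  have delta: "(\<Sum>w\<in>X. lookup (F j) w * C w i) = (if i = j then 1 else 0)" if ij: "i \<in> A" "j \<in> A" for i j
  proof -
    have "F j = (\<Sum>w\<in>keys (F j). single w (lookup (F j) w))" by (rule poly_expand)
    also have "\<dots> = (\<Sum>w\<in>X. single w (lookup (F j) w))"
      by (rule sum.mono_neutral_left) (use keys[OF ij(2)] fin in \<open>auto simp: in_keys_iff\<close>)
    also have "\<dots> = (\<Sum>w\<in>X. Const (lookup (F j) w) * single w 1)"
      by (intro sum.cong refl) (rule single_eq_Const)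
    also have "\<dots> = (\<Sum>w\<in>X. \<Sum>i\<in>A. Const (lookup (F j) w * C w i) * F i)"
      by (intro sum.cong refl) (subst C, assumption, simp add: sum_distrib_left Const_mult mult.assoc)
    also have "\<dots> = (\<Sum>i\<in>A. Const (\<Sum>w\<in>X. lookup (F j) w * C w i) * F i)"
      by (subst sum.swap) (simp add: sum_distrib_right Const_sum)
    finally have Fj: "F j = (\<Sum>i\<in>A. Const (\<Sum>w\<in>X. lookup (F j) w * C w i) * F i)" .
    have "F j = (\<Sum>i\<in>A. if i = j then F i else 0)" using fin ij by simp
    also have "\<dots> = (\<Sum>i\<in>A. Const (if i = j then 1 else 0) * F i)"
      by (intro sum.cong) auto
    finally have "(\<Sum>i\<in>A. Const ((\<Sum>w\<in>X. lookup (F j) w * C w i) - (if i = j then 1 else 0)) * F i) = 0"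
      using Fj by (simp add: Const_def single_diff left_diff_distrib sum_subtractf)
    from indep[OF this ij(1)] show ?thesis by simp
  qed
  have "T (single w 1) = (\<Sum>j\<in>A. Const (C w j) * (\<Sum>i\<in>A. Const (M i j) * F i))" if "w \<in> X" for w
    unfolding C[OF that] Tsum T(2) by (rule sum.cong[OF refl]) (simp add: M)
  then have "lookup (T (single w 1)) w = (\<Sum>j\<in>A. \<Sum>i\<in>A. M i j * (lookup (F i) w * C w j))" if "w \<in> X" for w
    using that by (simp add: lookup_sum sum_distrib_left) (simp add: ac_simps)
  then have "(\<Sum>w\<in>X. lookup (T (single w 1)) w) = (\<Sum>w\<in>X. \<Sum>j\<in>A. \<Sum>i\<in>A. M i j * (lookup (F i) w * C w j))"
    by simp
  also have "\<dots> = (\<Sum>j\<in>A. \<Sum>w\<in>X. \<Sum>i\<in>A. M i j * (lookup (F i) w * C w j))"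
    by (rule sum.swap)
  also have "\<dots> = (\<Sum>j\<in>A. \<Sum>i\<in>A. \<Sum>w\<in>X. M i j * (lookup (F i) w * C w j))"
    by (rule sum.cong[OF refl]) (rule sum.swap)
  also have "\<dots> = (\<Sum>j\<in>A. \<Sum>i\<in>A. M i j * (if j = i then 1 else 0))"
    by (rule sum.cong[OF refl], rule sum.cong[OF refl]) (simp add: delta flip: sum_distrib_left)
  also have "\<dots> = (\<Sum>j\<in>A. M j j)" using fin by (simp add: if_distrib cong: if_cong)
  finally show ?thesis by simp
qed

text \<open>A choice of bases \<open>b D\<close> of the coinvariants in all degrees \<open>D = J - |\<mu>|\<close> that can occur as
  complement of a type \<open>\<mu>\<close> in \<open>J\<close>. The equation \<open>J - |\<mu>| + |\<mu>| = J\<close> expresses that \<open>|\<mu>|\<close> is componentwise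
  at most \<open>J\<close>, since subtraction is truncated.\<close>

locale graded_bases =
  fixes r n :: nat and J :: "nat \<Rightarrow>\<^sub>0 nat"
    and b :: "(nat \<Rightarrow>\<^sub>0 nat) \<Rightarrow> ('k::field_char_0) dpoly list"
  assumes large: "3 * tdeg J \<le> n"
    and basis: "\<And>\<mu>. \<mu> \<in> types r (tdeg J) \<Longrightarrow> J - sum_mset \<mu> + sum_mset \<mu> = J \<Longrightarrow> basis_mod_ideal r n (J - sum_mset \<mu>) (b (J - sum_mset \<mu>))"
begin

abbreviation "N \<equiv> tdeg J"
abbreviation "rem \<mu> \<equiv> J - sum_mset \<mu>"

definition M where "M = {\<mu> \<in> types r N. rem \<mu> + sum_mset \<mu> = J}"
definition A where "A = Sigma M (\<lambda>\<mu>. {..<length (b (rem \<mu>))})"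
definition F where "F x = msym r n (fst x) * b (rem (fst x)) ! snd x"
definition span_from where "span_from d = vs.span (F ` {x \<in> A. d \<le> wt (fst x)})"

lemma finite_M: "finite M" by (simp add: M_def finite_types)
lemma finite_A: "finite A" by (simp add: A_def finite_M)

lemma M_tdeg: "\<mu> \<in> M \<Longrightarrow> tdeg (rem \<mu>) + wt \<mu> = N"
  by (metis (mono_tags, lifting) M_def mem_Collect_eq tdeg_add)

lemma M_basis: "\<mu> \<in> M \<Longrightarrow> basis_mod_ideal r n (rem \<mu>) (b (rem \<mu>))"
  using basis by (simp add: M_def)

lemma M_intro: "is_type r \<mu> \<Longrightarrow> D + sum_mset \<mu> = J \<Longrightarrow> \<mu> \<in> M \<and> rem \<mu> = D"
proof -
  assume *: "is_type r \<mu>" "D + sum_mset \<mu> = J"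
  then have "rem \<mu> = D" by (metis add_diff_cancel_right')
  moreover have "wt \<mu> \<le> N" using * by (metis tdeg_add le_add2)
  ultimately show ?thesis using * by (simp add: M_def types_iff)
qed

lemma span_from_mono: "d \<le> d' \<Longrightarrow> span_from d' \<subseteq> span_from d"
  unfolding span_from_def by (rule vs.span_mono) auto

lemma span_from_sum: "(\<And>x. x \<in> B \<Longrightarrow> f x \<in> span_from d) \<Longrightarrow> sum f B \<in> span_from d"
  unfolding span_from_def by (rule vs.span_sum)

lemma span_from_scale: "x \<in> span_from d \<Longrightarrow> Const c * x \<in> span_from d"
  unfolding span_from_def Const_def by (rule vs.span_scale)

lemma span_from_add: "x \<in> span_from d \<Longrightarrow> y \<in> span_from d \<Longrightarrow> x + y \<in> span_from d"
  unfolding span_from_def by (rule vs.span_add)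

lemma b_homog: "\<mu> \<in> M \<Longrightarrow> i < length (b (rem \<mu>)) \<Longrightarrow> b (rem \<mu>) ! i \<in> homog r n (rem \<mu>)"
  using M_basis[of \<mu>] by (auto simp: basis_mod_ideal_def)

text \<open>Induction on the degree of the cofactor. A polynomial is a combination of the basis and an
  element of the ideal, and an element of the ideal involves orbit sums of positive degree. Multiplying them with
  \<open>msym r n \<mu>\<close> gives orbit sums of larger degree with a cofactor of smaller degree. The first part, with
  its strict increase of the degree, is responsible for the triangular shape of the action.\<close>

lemma msym_times_in_span_from:
  assumes "\<mu> \<in> M"
  shows "(\<forall>e. e \<in> sym_ideal r n \<and> e \<in> homog r n (rem \<mu>) \<longrightarrow> msym r n \<mu> * e \<in> span_from (Suc (wt \<mu>)))
    \<and> (\<forall>v\<in>homog r n (rem \<mu>). msym r n \<mu> * v \<in> span_from (wt \<mu>))"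
  using assms
proof (induction "tdeg (rem \<mu>)" arbitrary: \<mu> rule: less_induct)
  case less
  note \<mu> = less.prems
  have 1: "msym r n \<mu> * e \<in> span_from (Suc (wt \<mu>))" if e: "e \<in> sym_ideal r n" "e \<in> homog r n (rem \<mu>)" for e
  proof -
    have "e \<in> vs.span (hom_gens r n (rem \<mu>))" using homogeneous_sym_ideal e by blast
    then show ?thesis
    proof (induction e rule: vs.span_induct_alt)
      case base
      show ?case by (simp add: span_from_def vs.span_zero)
    next
      case (step c x y)
      obtain \<nu> w where x: "x = msym r n \<nu> * single w 1" "is_type r \<nu>" "\<nu> \<noteq> {#}" "w \<in> words r {..<n}"
        "sum_mset \<nu> + mdeg w = rem \<mu>"
        using step(1) by (auto simp: hom_gens_def)
      have nz: "wt \<nu> > 0" using is_type_tdeg_0[OF x(2)] x(3) by blast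
      have totrem: "tdeg (rem \<mu>) = wt \<nu> + tdeg (mdeg w)" by (metis x(5) tdeg_add)
      have J: "sum_mset \<nu> + mdeg w + sum_mset \<mu> = J" using \<mu> x(5) by (simp add: M_def)
      have "wt \<mu> + wt \<nu> \<le> N"
        using M_tdeg[OF \<mu>] totrem by simp
      then obtain a :: "_ \<Rightarrow> 'k" where a: "msym r n \<mu> * msym r n \<nu> = (\<Sum>\<kappa>\<in>types r N. Const (a \<kappa>) * msym r n \<kappa>)"
        "\<And>\<kappa>. a \<kappa> \<noteq> 0 \<Longrightarrow> sum_mset \<kappa> = sum_mset \<mu> + sum_mset \<nu>"
        by (rule msym_mult[of \<mu> \<nu> N r n]) blast
      have "Const (a \<kappa>) * (msym r n \<kappa> * single w 1) \<in> span_from (Suc (wt \<mu>))" if \<kappa>: "\<kappa> \<in> types r N" for \<kappa>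
      proof (cases "a \<kappa> = 0")
        case True
        then show ?thesis by (simp add: span_from_def vs.span_zero)
      next
        case False
        then have s: "sum_mset \<kappa> = sum_mset \<mu> + sum_mset \<nu>" by (rule a(2))
        have k: "\<kappa> \<in> M \<and> rem \<kappa> = mdeg w"
          by (rule M_intro) (use \<kappa> J in \<open>simp_all add: types_iff s ac_simps\<close>)
        have "single w 1 \<in> homog r n (rem \<kappa>)" using k x(4) by (intro homog_single) auto
        moreover have "tdeg (rem \<kappa>) < tdeg (rem \<mu>)" using k totrem nz by simp
        ultimately have "msym r n \<kappa> * single w 1 \<in> span_from (wt \<kappa>)"
          using less.hyps[of \<kappa>] k by blast
        moreover have "Suc (wt \<mu>) \<le> wt \<kappa>" using nz by (simp add: s)
        ultimately show ?thesis using span_from_mono span_from_scale by blast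
      qed
      then have "(\<Sum>\<kappa>\<in>types r N. Const (a \<kappa>) * (msym r n \<kappa> * single w 1)) \<in> span_from (Suc (wt \<mu>))"
        by (rule span_from_sum)
      moreover have "msym r n \<mu> * x = (\<Sum>\<kappa>\<in>types r N. Const (a \<kappa>) * (msym r n \<kappa> * single w 1))"
        unfolding x(1) mult.assoc[symmetric] a(1) by (simp add: sum_distrib_right mult.assoc)
      ultimately have "Const c * (msym r n \<mu> * x) + msym r n \<mu> * y \<in> span_from (Suc (wt \<mu>))"
        using step(2) by (intro span_from_add span_from_scale) simp_all
      moreover have "msym r n \<mu> * (single 0 c * x + y) = Const c * (msym r n \<mu> * x) + msym r n \<mu> * y"
        by (simp add: Const_def distrib_left mult.left_commute)
      ultimately show ?case by simp
    qed
  qed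
  have 2: "msym r n \<mu> * v \<in> span_from (wt \<mu>)" if v: "v \<in> homog r n (rem \<mu>)" for v
  proof -
    let ?b = "b (rem \<mu>)"
    obtain c where c: "v - lincomb c ?b \<in> sym_ideal r n"
      using M_basis[OF \<mu>] v unfolding basis_mod_ideal_def by blast
    define e where "e = v - lincomb c ?b"
    have "e \<in> homog r n (rem \<mu>)" unfolding e_def
      by (intro homog_diff v homog_sum homog_scale b_homog[OF \<mu>]) simp
    then have "msym r n \<mu> * e \<in> span_from (wt \<mu>)"
      using 1[of e] c span_from_mono[of "wt \<mu>" "Suc (wt \<mu>)"] by (auto simp: e_def)
    moreover have "F (\<mu>, i) \<in> span_from (wt \<mu>)" if "i < length ?b" for i
      unfolding span_from_def by (rule vs.span_base) (use that \<mu> in \<open>auto simp: A_def\<close>)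
    then have "(\<Sum>i<length ?b. Const (c i) * F (\<mu>, i)) \<in> span_from (wt \<mu>)"
      by (intro span_from_sum span_from_scale) simp
    moreover have "msym r n \<mu> * v = msym r n \<mu> * e + (\<Sum>i<length ?b. Const (c i) * F (\<mu>, i))"
      by (simp add: e_def F_def right_diff_distrib sum_distrib_left mult.left_commute)
    ultimately show ?thesis using span_from_add by simp
  qed
  show ?case using 1 2 by blast
qed

lemma empty_in_M: "{#} \<in> M" by (simp add: M_def)

text \<open>In a relation that is not trivial, collect for every type the combination \<open>h\<close> of basis elements. The
  nonzero one for a type of least degree lies in the ideal, and then its coefficients are zero.\<close>

lemma independent:
  assumes eq: "(\<Sum>x\<in>A. Const (c x) * F x) = 0" and x: "x \<in> A"
  shows "c x = 0"
proof -
  define h where "h \<mu> = (if \<mu> \<in> M then lincomb (\<lambda>i. c (\<mu>, i)) (b (rem \<mu>)) else 0)" for \<mu>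
  have zero: "\<forall>i<length (b (rem \<mu>)). c (\<mu>, i) = 0" if "\<mu> \<in> M" "h \<mu> \<in> sym_ideal r n" for \<mu>
    using M_basis[OF that(1)] that unfolding basis_mod_ideal_def h_def by fastforce
  have hV: "h \<mu> \<in> homog r n (rem \<mu>)" for \<mu>
    by (auto simp: h_def intro!: homog_sum homog_scale b_homog)
  have "(\<Sum>x\<in>A. Const (c x) * F x) = (\<Sum>\<mu>\<in>M. \<Sum>i<length (b (rem \<mu>)). Const (c (\<mu>, i)) * F (\<mu>, i))"
    unfolding A_def by (subst sum.Sigma) (auto simp: finite_M split_def)
  also have "\<dots> = (\<Sum>\<mu>\<in>M. msym r n \<mu> * h \<mu>)"
    by (intro sum.cong refl) (simp add: h_def F_def sum_distrib_left mult.left_commute)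
  also have "\<dots> = (\<Sum>\<mu>\<in>types r N. msym r n \<mu> * h \<mu>)"
    by (rule sum.mono_neutral_left) (auto simp: M_def h_def finite_types)
  finally have rel: "(\<Sum>\<mu>\<in>types r N. msym r n \<mu> * h \<mu>) = 0" using eq by simp
  have "h \<mu> = 0" for \<mu>
  proof (rule ccontr)
    assume "h \<mu> \<noteq> 0"
    then obtain \<mu>0 where \<mu>0: "h \<mu>0 \<noteq> 0" and least: "\<And>\<nu>. h \<nu> \<noteq> 0 \<Longrightarrow> wt \<mu>0 \<le> wt \<nu>"
      using ex_has_least_nat[of "\<lambda>\<mu>. h \<mu> \<noteq> 0" \<mu> "\<lambda>\<mu>. wt \<mu>"] by blast
    have M0: "\<mu>0 \<in> M" using \<mu>0 by (auto simp: h_def split: if_splits)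
    have "h \<mu>0 \<in> sym_ideal r n"
    proof (rule lowest_relation_in_sym_ideal[OF large _ _ rel])
      show "h \<nu> \<in> polys r {..<n}" for \<nu> using hV[of \<nu>] by (simp add: homog_def)
      show "tdeg w \<le> N" if "\<nu> \<in> types r N" "w \<in> keys (h \<nu>)" for \<nu> w
      proof -
        have "\<nu> \<in> M" using that by (auto simp: h_def split: if_splits)
        moreover have "mdeg w = rem \<nu>" using hV[of \<nu>] that by (simp add: homog_def)
        ultimately show ?thesis using M_tdeg[of \<nu>] tdeg_mdeg[of w] by simp
      qed
      show "h \<nu> = 0" if "wt \<nu> < wt \<mu>0" for \<nu>
        using least[of \<nu>] that by force
      show "\<mu>0 \<in> types r N" using M0 by (simp add: M_def)
    qed simp
    from zero[OF M0 this] show False using \<mu>0 M0 by (simp add: h_def)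
  qed
  then show ?thesis using x zero[of "fst x"] by (auto simp: A_def)
qed

definition X where "X = {w \<in> words r {..<n}. mdeg w = J}"

lemma finite_X: "finite X"
  by (rule finite_subset[OF _ finite_words[of "{..<n}" r N]]) (auto simp: X_def simp flip: tdeg_mdeg)

lemma keys_F: "x \<in> A \<Longrightarrow> keys (F x) \<subseteq> X"
proof -
  assume x: "x \<in> A"
  then have m: "fst x \<in> M" and i: "snd x < length (b (rem (fst x)))" by (auto simp: A_def)
  have v: "b (rem (fst x)) ! snd x \<in> homog r n (rem (fst x))" using b_homog[OF m i] .
  have P: "F x \<in> polys r {..<n}" unfolding F_def using v by (intro polys_mult msym_polys) (simp add: homog_def)
  have "mdeg w = J" if w: "w \<in> keys (F x)" for w
  proof -
    obtain u v' where uv: "w = u + v'" "u \<in> keys (msym r n (fst x) :: 'k dpoly)"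
      "v' \<in> keys (b (rem (fst x)) ! snd x)"
      using w keys_mult[of "msym r n (fst x)" "b (rem (fst x)) ! snd x"] unfolding F_def by blast
    then have "mdeg u = sum_mset (fst x)" "mdeg v' = rem (fst x)"
      using keys_msym[OF uv(2)] sum_mset_coltype[of u] v by (auto simp: homog_def)
    then show ?thesis using m uv(1) by (simp add: M_def add.commute)
  qed
  then show ?thesis using polys_keys[OF P] by (auto simp: X_def)
qed

lemma spans:
  assumes "w \<in> X" shows "\<exists>c. single w 1 = (\<Sum>x\<in>A. Const (c x) * F x)"
proof -
  have "single w 1 \<in> homog r n (rem {#})" using assms by (intro homog_single) (auto simp: X_def)
  then have "msym r n {#} * single w 1 \<in> span_from (tdeg (sum_mset ({#} :: (nat \<Rightarrow>\<^sub>0 nat) multiset)))"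
    using msym_times_in_span_from[OF empty_in_M] by blast
  then have "single w 1 \<in> vs.span (F ` A)" by (simp add: span_from_def)
  from span_image_explicit[OF finite_A this] show ?thesis by (auto simp: Const_def)
qed

text \<open>The matrix of \<open>\<sigma>\<close> in the basis \<open>F\<close> is the block diagonal matrix of the \<open>m\<close> plus a matrix \<open>a\<close> that only
  has entries from a type to types of strictly larger degree, hence no diagonal entries.\<close>

lemma trace_identity:
  assumes \<sigma>: "\<sigma> permutes {..<n}"
    and m: "\<And>\<mu> j. \<mu> \<in> M \<Longrightarrow> j < length (b (rem \<mu>)) \<Longrightarrow>
       perm_act \<sigma> (b (rem \<mu>) ! j) - lincomb (\<lambda>i. m (rem \<mu>) i j) (b (rem \<mu>)) \<in> sym_ideal r n"
  shows "(\<Sum>\<mu>\<in>M. \<Sum>i<length (b (rem \<mu>)). m (rem \<mu>) i i) = of_nat (card {w \<in> X. relabel \<sigma> w = w})"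
proof -
  have bij: "bij \<sigma>" using \<sigma> permutes_bij by blast
  have "\<exists>a. (\<forall>y. y \<notin> {y \<in> A. Suc (wt (fst x)) \<le> wt (fst y)} \<longrightarrow> a y = 0) \<and>
      perm_act \<sigma> (F x) = (\<Sum>y\<in>A. Const ((if fst y = fst x then m (rem (fst x)) (snd y) (snd x) else 0) + a y) * F y)"
    if x: "x \<in> A" for x
  proof -
    obtain \<mu> j where xe: "x = (\<mu>, j)" and \<mu>: "\<mu> \<in> M" and j: "j < length (b (rem \<mu>))"
      using x by (auto simp: A_def)
    let ?b = "b (rem \<mu>)"
    let ?B = "{y \<in> A. Suc (wt \<mu>) \<le> wt (fst y)}"
    define e where "e = perm_act \<sigma> (?b ! j) - lincomb (\<lambda>i. m (rem \<mu>) i j) ?b"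
    have "e \<in> homog r n (rem \<mu>)" unfolding e_def
      by (intro homog_diff homog_perm_act[OF \<sigma>] homog_sum homog_scale b_homog[OF \<mu>]) (use j in auto)
    moreover have "e \<in> sym_ideal r n" unfolding e_def by (rule m[OF \<mu> j])
    ultimately have "msym r n \<mu> * e \<in> vs.span (F ` ?B)"
      using msym_times_in_span_from[OF \<mu>] unfolding span_from_def by blast
    from span_image_explicit[OF _ this] obtain a where
      a: "\<forall>y. y \<notin> ?B \<longrightarrow> a y = 0" "msym r n \<mu> * e = (\<Sum>y\<in>?B. Const (a y) * F y)"
      using finite_A by (auto simp: Const_def)
    have e': "msym r n \<mu> * e = (\<Sum>y\<in>A. Const (a y) * F y)"
      unfolding a(2)
    proof (rule sum.mono_neutral_left[OF finite_A])
      show "\<forall>y\<in>A - ?B. Const (a y) * F y = 0"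
      proof
        fix y assume "y \<in> A - ?B"
        then have "a y = 0" by (intro a(1)[THEN spec, THEN mp]) blast
        then show "Const (a y) * F y = 0" by simp
      qed
    qed auto
    have "perm_act \<sigma> (F x) = msym r n \<mu> * perm_act \<sigma> (?b ! j)"
      by (simp add: xe F_def perm_act_mult[OF bij] msym_inv[OF \<sigma>])
    also have "\<dots> = (\<Sum>i<length ?b. Const (m (rem \<mu>) i j) * F (\<mu>, i)) + msym r n \<mu> * e"
      by (simp add: e_def F_def right_diff_distrib sum_distrib_left mult.left_commute)
    also have "(\<Sum>i<length ?b. Const (m (rem \<mu>) i j) * F (\<mu>, i)) =
       (\<Sum>y\<in>Pair \<mu> ` {..<length ?b}. Const (m (rem \<mu>) (snd y) j) * F y)"
      by (subst sum.reindex) (auto simp: inj_on_def)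
    also have "\<dots> = (\<Sum>y\<in>A. Const (if fst y = \<mu> then m (rem \<mu>) (snd y) j else 0) * F y)"
      by (rule sum.mono_neutral_cong_left) (use finite_A \<mu> in \<open>auto simp: A_def\<close>)
    finally have eq: "perm_act \<sigma> (F x) = (\<Sum>y\<in>A. Const ((if fst y = \<mu> then m (rem \<mu>) (snd y) j else 0) + a y) * F y)"
      by (simp add: e' Const_add distrib_right sum.distrib)
    show ?thesis unfolding xe fst_conv snd_conv
      by (rule exI[of _ a], rule conjI, rule a(1), rule eq[unfolded xe])
  qed
  then have "\<forall>x\<in>A. \<exists>a. (\<forall>y. y \<notin> {y \<in> A. Suc (wt (fst x)) \<le> wt (fst y)} \<longrightarrow> a y = 0) \<and>
      perm_act \<sigma> (F x) = (\<Sum>y\<in>A. Const ((if fst y = fst x then m (rem (fst x)) (snd y) (snd x) else 0) + a y) * F y)"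
    by blast
  from bchoice[OF this] obtain a where
    a0: "\<And>x y. x \<in> A \<Longrightarrow> y \<notin> {y \<in> A. Suc (wt (fst x)) \<le> wt (fst y)} \<Longrightarrow> a x y = 0"
    and a: "\<And>x. x \<in> A \<Longrightarrow> perm_act \<sigma> (F x) = (\<Sum>y\<in>A. Const ((if fst y = fst x then m (rem (fst x)) (snd y) (snd x) else 0) + a x y) * F y)"
    by blast
  have "(\<Sum>x\<in>A. (if fst x = fst x then m (rem (fst x)) (snd x) (snd x) else 0) + a x x) =
      (\<Sum>w\<in>X. lookup (perm_act \<sigma> (single w 1)) w :: 'k)"
  proof (rule trace_eq_diagonal_sum[where F = F and A = A and X = X and T = "perm_act \<sigma>" and
        M = "\<lambda>y x. (if fst y = fst x then m (rem (fst x)) (snd y) (snd x) else 0) + a x y"])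
    show "finite A" "finite X" by (rule finite_A, rule finite_X)
    show "keys (F i) \<subseteq> X" if "i \<in> A" for i using that by (rule keys_F)
    show "c i = 0" if "(\<Sum>i\<in>A. Const (c i) * F i) = 0" "i \<in> A" for c i using that by (rule independent)
    show "\<exists>c. single w 1 = (\<Sum>i\<in>A. Const (c i) * F i)" if "w \<in> X" for w using that by (rule spans)
    show "perm_act \<sigma> (x + y) = perm_act \<sigma> x + perm_act \<sigma> y" for x y :: "'k dpoly"
      by (rule perm_act_add[OF bij])
    show "perm_act \<sigma> (Const c * x) = Const c * perm_act \<sigma> x" for c and x :: "'k dpoly"
      by (rule perm_act_scale[OF bij])
  qed (rule a)
  moreover have "a x x = 0" if "x \<in> A" for x by (rule a0[OF that]) simp
  ultimately have "(\<Sum>x\<in>A. m (rem (fst x)) (snd x) (snd x)) = (\<Sum>w\<in>X. lookup (perm_act \<sigma> (single w 1)) w)"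
    by simp
  also have "(\<Sum>x\<in>A. m (rem (fst x)) (snd x) (snd x)) = (\<Sum>\<mu>\<in>M. \<Sum>i<length (b (rem \<mu>)). m (rem \<mu>) i i)"
    unfolding A_def by (subst sum.Sigma) (auto simp: finite_M split_def)
  also have "(\<Sum>w\<in>X. lookup (perm_act \<sigma> (single w 1)) w) = (\<Sum>w\<in>X. if relabel \<sigma> w = w then 1 else 0 :: 'k)"
    by (intro sum.cong) (auto simp: perm_act_single[OF bij] lookup_single)
  also have "\<dots> = of_nat (card {w \<in> X. relabel \<sigma> w = w})"
    using finite_X by (simp add: sum.If_cases Int_def)
  finally show ?thesis .
qed

end

text \<open>The recursion for the trace. The summand of the empty type is the trace in multidegree \<open>J\<close> itself,
  and the right hand side does not depend on any choice, so a trace is determined by those in smaller degrees.\<close>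

theorem trace_mod_ideal_sum:
  fixes t :: "(nat \<Rightarrow>\<^sub>0 nat) \<Rightarrow> 'k::field_char_0"
  assumes n: "3 * tdeg J \<le> n" and \<sigma>: "\<sigma> permutes {..<n}"
    and t: "\<And>\<mu>. \<mu> \<in> types r (tdeg J) \<Longrightarrow> J - sum_mset \<mu> + sum_mset \<mu> = J \<Longrightarrow> trace_mod_ideal r n (J - sum_mset \<mu>) \<sigma> (t (J - sum_mset \<mu>))"
  shows "(\<Sum>\<mu> | \<mu> \<in> types r (tdeg J) \<and> J - sum_mset \<mu> + sum_mset \<mu> = J. t (J - sum_mset \<mu>)) =
    of_nat (card {w \<in> words r {..<n}. mdeg w = J \<and> relabel \<sigma> w = w})"
proof -
  define DD where "DD = {D. \<exists>\<mu>\<in>types r (tdeg J). D = J - sum_mset \<mu> \<and> J - sum_mset \<mu> + sum_mset \<mu> = J}"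
  have "\<forall>D\<in>DD. \<exists>bs M. basis_mod_ideal r n D bs
     \<and> (\<forall>j<length bs. perm_act \<sigma> (bs ! j) - lincomb (\<lambda>i. M i j) bs \<in> sym_ideal r n)
     \<and> t D = (\<Sum>i<length bs. M i i)"
    using t unfolding DD_def trace_mod_ideal_def by blast
  from bchoice[OF this] obtain b where "\<forall>D\<in>DD. \<exists>M. basis_mod_ideal r n D (b D)
     \<and> (\<forall>j<length (b D). perm_act \<sigma> (b D ! j) - lincomb (\<lambda>i. M i j) (b D) \<in> sym_ideal r n)
     \<and> t D = (\<Sum>i<length (b D). M i i)"
    by blast
  from bchoice[OF this] obtain m where m: "\<forall>D\<in>DD. basis_mod_ideal r n D (b D)
     \<and> (\<forall>j<length (b D). perm_act \<sigma> (b D ! j) - lincomb (\<lambda>i. m D i j) (b D) \<in> sym_ideal r n)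
     \<and> t D = (\<Sum>i<length (b D). m D i i)"
    by blast
  interpret graded_bases r n J b
    by unfold_locales (use n m in \<open>auto simp: DD_def\<close>)
  have MD: "rem \<mu> \<in> DD" if "\<mu> \<in> M" for \<mu> using that by (auto simp: DD_def M_def)
  have "(\<Sum>\<mu>\<in>M. \<Sum>i<length (b (rem \<mu>)). m (rem \<mu>) i i) = of_nat (card {w \<in> X. relabel \<sigma> w = w})"
  proof (rule trace_identity[where m = m, OF \<sigma>])
    fix \<mu> j assume "\<mu> \<in> M" "j < length (b (rem \<mu>))"
    then show "perm_act \<sigma> (b (rem \<mu>) ! j) - lincomb (\<lambda>i. m (rem \<mu>) i j) (b (rem \<mu>)) \<in> sym_ideal r n"
      using m[THEN bspec, OF MD] by simp
  qed
  moreover have "(\<Sum>\<mu>\<in>M. \<Sum>i<length (b (rem \<mu>)). m (rem \<mu>) i i) = (\<Sum>\<mu>\<in>M. t (rem \<mu>))"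
    by (intro sum.cong refl) (use m MD in auto)
  ultimately show ?thesis by (simp add: M_def X_def conj_assoc)
qed

section \<open>Counting monomials fixed by a permutation\<close>

definition fixed_words :: "nat \<Rightarrow> nat \<Rightarrow> (nat \<Rightarrow> nat) \<Rightarrow> (nat \<Rightarrow>\<^sub>0 nat) \<Rightarrow> word set" where
  "fixed_words r n \<sigma> D = {w \<in> words r {..<n}. mdeg w = D \<and> relabel \<sigma> w = w}"

lemma finite_fixed_words: "finite (fixed_words r n \<sigma> D)"
  by (rule finite_subset[OF _ finite_words[of "{..<n}" r "tdeg D"]]) (auto simp: fixed_words_def simp flip: tdeg_mdeg)

lemma lookup_mdeg: "w \<in> words r {..<n} \<Longrightarrow> lookup (mdeg w) a = (\<Sum>j<n. lookup w (a, j))"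
  by (subst mdeg_superset[of "{..<n}"]) (auto simp: lookup_sum dest: words_cols)

lemma relabel_fixed_iff: "bij \<sigma> \<Longrightarrow> relabel \<sigma> w = w \<longleftrightarrow> (\<forall>j. column w (\<sigma> j) = column w j)"
proof -
  assume b: "bij \<sigma>"
  have "relabel \<sigma> w = w \<longleftrightarrow> (\<forall>j. column (relabel \<sigma> w) (\<sigma> j) = column w (\<sigma> j))"
    by (metis b bij_pointE word_eqI)
  then show ?thesis by (simp add: column_relabel[OF b] bij_is_inj[OF b]) metis
qed

lemma fixed_on_orbit:
  assumes "bij \<sigma>" "relabel \<sigma> w = w" "i \<in> orbit \<sigma> j"
  shows "column w i = column w j"
  using assms(3) by induction (use assms relabel_fixed_iff in auto)

definition block :: "nat \<Rightarrow> nat set \<Rightarrow> nat \<Rightarrow> word" where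
  "block a B k = (\<Sum>i\<in>B. single (a, i) k)"

lemma lookup_block: "finite B \<Longrightarrow> lookup (block a B k) (a', i) = (if a' = a \<and> i \<in> B then k else 0)"
proof -
  assume f: "finite B"
  have "lookup (block a B k) (a', i) = (\<Sum>i'\<in>B. if i' = i then (if a' = a then k else 0) else 0)"
    by (auto simp: block_def lookup_sum lookup_single when_def intro!: sum.cong)
  then show ?thesis using f by simp
qed

lemma mdeg_block:
  assumes "B \<subseteq> {..<n}" "a < r" "block a B k \<in> words r {..<n}"
  shows "mdeg (block a B k) = single a (k * card B)"
proof (rule poly_mapping_eqI)
  fix a'
  have f: "finite B" using assms finite_subset by blast
  have "{j. j < n \<and> j \<in> B} = B" using assms by auto
  then show "lookup (mdeg (block a B k)) a' = lookup (single a (k * card B)) a'"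
    using lookup_mdeg[OF assms(3)] by (simp add: lookup_block[OF f] lookup_single when_def sum.If_cases Int_def lessThan_def)
qed

text \<open>A fixed monomial has constant exponents along the cycle of \<open>j\<close>, so dividing by the \<open>k\<close>-th power of the
  product of the variables \<open>(a, i)\<close> over that cycle is a bijection onto the fixed monomials of the smaller degree.\<close>

lemma card_fixed_words_ge:
  assumes \<sigma>: "\<sigma> permutes {..<n}" and a: "a < r" and j: "j < n" and k: "k \<ge> 1"
  shows "card {w \<in> fixed_words r n \<sigma> D. k \<le> lookup w (a, j)} =
    (if D - single a (k * card (orbit \<sigma> j)) + single a (k * card (orbit \<sigma> j)) = D
     then card (fixed_words r n \<sigma> (D - single a (k * card (orbit \<sigma> j)))) else 0)"
proof -
  let ?B = "orbit \<sigma> j"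
  let ?s = "single a (k * card ?B)"
  let ?b = "block a ?B k"
  have b: "bij \<sigma>" using \<sigma> permutes_bij by blast
  have perm: "permutation \<sigma>" using \<sigma> permutation_permutes by blast
  have sub: "?B \<subseteq> {..<n}" using permutes_orbit_subset[OF \<sigma>] j by auto
  have f: "finite ?B" using sub finite_subset by blast
  have jO: "j \<in> ?B" by (rule permutation_self_in_orbit[OF perm])
  have lb: "lookup ?b (a', i) = (if a' = a \<and> i \<in> ?B then k else 0)" for a' i by (rule lookup_block[OF f])
  have bW: "?b \<in> words r {..<n}"
    using sub a by (auto simp: words_def in_keys_iff lb split: if_splits)
  have db: "mdeg ?b = ?s" by (rule mdeg_block[OF sub a bW])
  have step: "\<sigma> i \<in> ?B \<longleftrightarrow> i \<in> ?B" for i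
    using permutation_orbit_step[OF perm, of i] permutation_self_in_orbit[OF perm]
    by (metis orbit_swap orbit_trans orbit.step)
  have colb: "column ?b (\<sigma> i) = column ?b i" for i
    by (rule poly_mapping_eqI) (simp add: lb step)
  have fixb: "relabel \<sigma> ?b = ?b" using relabel_fixed_iff[OF b] colb by blast
  let ?S = "{v \<in> words r {..<n}. mdeg v + ?s = D \<and> relabel \<sigma> v = v}"
  have "{w \<in> fixed_words r n \<sigma> D. k \<le> lookup w (a, j)} = (\<lambda>v. v + ?b) ` ?S"
  proof (intro equalityI subsetI)
    fix w assume w: "w \<in> {w \<in> fixed_words r n \<sigma> D. k \<le> lookup w (a, j)}"
    have ge: "k \<le> lookup w (a, i)" if "i \<in> ?B" for i
      using w fixed_on_orbit[OF b _ that, of w] by (metis (mono_tags, lifting) fixed_words_def lookup_column mem_Collect_eq)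
    \<comment> \<open>truncated subtraction of the block is exact, as all exponents on the cycle are at least \<open>k\<close>\<close>
    have wv: "w = (w - ?b) + ?b"
      by (rule poly_mapping_eqI) (use ge in \<open>auto simp: lookup_add lookup_minus lb split: if_splits prod.splits\<close>)
    define v where "v = w - ?b"
    have wv: "w = v + ?b" using wv by (simp add: v_def)
    have "v \<in> words r {..<n}" using w wv words_add by (metis (mono_tags, lifting) fixed_words_def mem_Collect_eq)
    moreover have "mdeg v + ?s = D" using w by (simp add: wv db fixed_words_def)
    moreover have "relabel \<sigma> v = v"
      using w by (simp add: wv fixed_words_def relabel_add[OF b] fixb)
    ultimately show "w \<in> (\<lambda>v. v + ?b) ` ?S" using wv by blast
  next
    fix w assume "w \<in> (\<lambda>v. v + ?b) ` ?S"
    then obtain v where v: "v \<in> ?S" "w = v + ?b" by blast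
    have "lookup w (a, j) = lookup v (a, j) + k" by (simp add: v lookup_add lb jO)
    then show "w \<in> {w \<in> fixed_words r n \<sigma> D. k \<le> lookup w (a, j)}"
      using v bW by (simp add: fixed_words_def words_add db relabel_add[OF b] fixb)
  qed
  then have c: "card {w \<in> fixed_words r n \<sigma> D. k \<le> lookup w (a, j)} = card ?S"
    by (simp add: card_image inj_on_def)
  show ?thesis
  proof (cases "D - ?s + ?s = D")
    case True
    then have "mdeg v + ?s = D \<longleftrightarrow> mdeg v = D - ?s" for v by (metis add_diff_cancel_right')
    then have "?S = fixed_words r n \<sigma> (D - ?s)" by (simp add: fixed_words_def)
    then show ?thesis using c True by simp
  next
    case False
    then have "mdeg v + ?s \<noteq> D" for v by (metis add_diff_cancel_right')
    then have S: "?S = {}" by blast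
    show ?thesis using c False by (simp only: S card.empty if_False)
  qed
qed

lemma card_orbit_size:
  assumes \<sigma>: "\<sigma> permutes {..<n}"
  shows "card {j. j < n \<and> card (orbit \<sigma> j) = i} = i * cycle_count n \<sigma> i"
proof -
  let ?C = "{C. \<exists>x<n. C = orbit \<sigma> x \<and> card C = i}"
  have perm: "permutation \<sigma>" using \<sigma> permutation_permutes by blast
  have cyc: "cyclic_on \<sigma> (orbit \<sigma> x)" for x by (rule cyclic_on_orbit'[OF perm])
  have U: "\<Union> ?C = {j. j < n \<and> card (orbit \<sigma> j) = i}"
  proof (intro equalityI subsetI)
    fix j assume "j \<in> \<Union> ?C"
    then obtain x where x: "x < n" "j \<in> orbit \<sigma> x" "card (orbit \<sigma> x) = i" by blast
    then have "orbit \<sigma> j = orbit \<sigma> x" using orbit_cyclic_eq3[OF cyc] by blast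
    moreover have "j < n" using permutes_orbit_subset[OF \<sigma>, of x] x by auto
    ultimately show "j \<in> {j. j < n \<and> card (orbit \<sigma> j) = i}" using x by simp
  next
    fix j assume "j \<in> {j. j < n \<and> card (orbit \<sigma> j) = i}"
    then show "j \<in> \<Union> ?C" using permutation_self_in_orbit[OF perm, of j] by blast
  qed
  have "?C \<subseteq> orbit \<sigma> ` {..<n}" by auto
  then have fin: "finite ?C" by (rule finite_subset) simp
  have "i * card ?C = card (\<Union> ?C)"
  proof (rule card_partition[OF fin])
    show "finite (\<Union> ?C)" unfolding U by simp
    show "c1 \<inter> c2 = {}" if "c1 \<in> ?C" "c2 \<in> ?C" "c1 \<noteq> c2" for c1 c2
    proof (rule ccontr)
      assume "c1 \<inter> c2 \<noteq> {}"
      then obtain y where "y \<in> c1" "y \<in> c2" by blast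
      then have "orbit \<sigma> y = c1" "orbit \<sigma> y = c2" using that orbit_cyclic_eq3[OF cyc] by blast+
      then show False using that by simp
    qed
  qed auto
  then show ?thesis unfolding U cycle_count_def by simp
qed

text \<open>The logarithmic derivative with respect to \<open>q\<^sub>a\<close> of the generating function of the fixed monomials. Both
  sides count triples of a fixed monomial \<open>w\<close>, a column \<open>j\<close> and a number \<open>k\<close> between \<open>1\<close> and the exponent of \<open>w\<close>
  at \<open>(a, j)\<close>; on the right, the columns are sorted by the length \<open>i\<close> of their cycle.\<close>

lemma fixed_words_recursion:
  assumes \<sigma>: "\<sigma> permutes {..<n}" and a: "a < r"
  shows "lookup D a * card (fixed_words r n \<sigma> D) =
    (\<Sum>k=1..lookup D a. \<Sum>i=1..lookup D a. i * cycle_count n \<sigma> i *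
      (if D - single a (k * i) + single a (k * i) = D then card (fixed_words r n \<sigma> (D - single a (k * i))) else 0))"
proof -
  let ?L = "lookup D a"
  let ?g = "\<lambda>k i. if D - single a (k * i) + single a (k * i) = D then card (fixed_words r n \<sigma> (D - single a (k * i))) else 0"
  \<comment> \<open>only cycles of length at most \<open>?L\<close> contribute\<close>
  have g0: "?g k i = 0" if "i > ?L" "k \<ge> 1" for k i
  proof -
    have "k * i > ?L" using that by (metis less_le_trans mult_le_mono1 nat_mult_1)
    have "D - single a (k * i) + single a (k * i) \<noteq> D"
    proof
      assume "D - single a (k * i) + single a (k * i) = D"
      then have "lookup (D - single a (k * i)) a + k * i = ?L" by (metis lookup_add lookup_single_eq)
      then show False using \<open>k * i > ?L\<close> by simp
    qed
    then show ?thesis by simp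
  qed
  have pos: "card (orbit \<sigma> j) \<ge> 1" if "j < n" for j
  proof -
    have "orbit \<sigma> j \<subseteq> {..<n}" using permutes_orbit_subset[OF \<sigma>] that by auto
    then have "finite (orbit \<sigma> j)" by (rule finite_subset) simp
    then show ?thesis using orbit_nonempty[of \<sigma> j] by (simp add: Suc_leI card_gt_0_iff)
  qed
  have wt: "?L = (\<Sum>j<n. \<Sum>k=1..?L. if k \<le> lookup w (a, j) then 1 else 0)" if w: "w \<in> fixed_words r n \<sigma> D" for w
  proof -
    have L: "?L = (\<Sum>j<n. lookup w (a, j))" using w lookup_mdeg[of w r n a] by (simp add: fixed_words_def)
    have "lookup w (a, j) = (\<Sum>k=1..?L. if k \<le> lookup w (a, j) then 1 else 0)" if "j < n" for j
    proof -
      have "lookup w (a, j) \<le> ?L" unfolding L by (rule member_le_sum) (use that in auto)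
      then have "{1..?L} \<inter> {k. k \<le> lookup w (a, j)} = {1..lookup w (a, j)}" by auto
      then show ?thesis by (simp add: sum.If_cases)
    qed
    then show ?thesis by (subst L) simp
  qed
  have "?L * card (fixed_words r n \<sigma> D) = (\<Sum>w\<in>fixed_words r n \<sigma> D. ?L)" by simp
  also have "\<dots> = (\<Sum>w\<in>fixed_words r n \<sigma> D. \<Sum>j<n. \<Sum>k=1..?L. if k \<le> lookup w (a, j) then 1 else 0)"
    by (rule sum.cong[OF refl]) (rule wt)
  also have "\<dots> = (\<Sum>j<n. \<Sum>w\<in>fixed_words r n \<sigma> D. \<Sum>k=1..?L. if k \<le> lookup w (a, j) then 1 else 0)"
    by (rule sum.swap)
  also have "\<dots> = (\<Sum>j<n. \<Sum>k=1..?L. \<Sum>w\<in>fixed_words r n \<sigma> D. if k \<le> lookup w (a, j) then 1 else 0)"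
    by (rule sum.cong[OF refl]) (rule sum.swap)
  also have "\<dots> = (\<Sum>j<n. \<Sum>k=1..?L. card {w \<in> fixed_words r n \<sigma> D. k \<le> lookup w (a, j)})"
    by (rule sum.cong[OF refl], rule sum.cong[OF refl]) (simp add: sum.If_cases finite_fixed_words Int_def)
  also have "\<dots> = (\<Sum>j<n. \<Sum>k=1..?L. ?g k (card (orbit \<sigma> j)))"
    by (rule sum.cong[OF refl], rule sum.cong[OF refl], rule card_fixed_words_ge[OF \<sigma> a]) auto
  also have "\<dots> = (\<Sum>k=1..?L. \<Sum>j<n. ?g k (card (orbit \<sigma> j)))"
    by (rule sum.swap)
  also have "\<dots> = (\<Sum>k=1..?L. \<Sum>i=1..?L. i * cycle_count n \<sigma> i * ?g k i)"
  proof (rule sum.cong[OF refl])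
    fix k assume k: "k \<in> {1..?L}"
    have "(\<Sum>j<n. ?g k (card (orbit \<sigma> j))) = (\<Sum>j | j < n \<and> card (orbit \<sigma> j) \<in> {1..?L}. ?g k (card (orbit \<sigma> j)))"
    proof (rule sum.mono_neutral_right)
      show "\<forall>j\<in>{..<n} - {j. j < n \<and> card (orbit \<sigma> j) \<in> {1..?L}}. ?g k (card (orbit \<sigma> j)) = 0"
      proof
        fix j assume j: "j \<in> {..<n} - {j. j < n \<and> card (orbit \<sigma> j) \<in> {1..?L}}"
        then have "?L < card (orbit \<sigma> j)" using pos[of j] by auto
        then show "?g k (card (orbit \<sigma> j)) = 0" by (rule g0) (use k in simp)
      qed
    qed auto
    also have "\<dots> = (\<Sum>i=1..?L. \<Sum>j | j \<in> {j. j < n \<and> card (orbit \<sigma> j) \<in> {1..?L}} \<and> card (orbit \<sigma> j) = i. ?g k (card (orbit \<sigma> j)))"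
      by (rule sum.group[symmetric]) auto
    also have "\<dots> = (\<Sum>i=1..?L. i * cycle_count n \<sigma> i * ?g k i)"
    proof (rule sum.cong[OF refl])
      fix i assume "i \<in> {1..?L}"
      then have "{j. j \<in> {j. j < n \<and> card (orbit \<sigma> j) \<in> {1..?L}} \<and> card (orbit \<sigma> j) = i} = {j. j < n \<and> card (orbit \<sigma> j) = i}"
        by auto
      then have "(\<Sum>j | j \<in> {j. j < n \<and> card (orbit \<sigma> j) \<in> {1..?L}} \<and> card (orbit \<sigma> j) = i. ?g k (card (orbit \<sigma> j)))
          = (\<Sum>j | j < n \<and> card (orbit \<sigma> j) = i. ?g k i)"
        by (intro sum.cong) auto
      also have "\<dots> = card {j. j < n \<and> card (orbit \<sigma> j) = i} * ?g k i"
        by (simp only: sum_constant of_nat_id)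
      finally show "(\<Sum>j | j \<in> {j. j < n \<and> card (orbit \<sigma> j) \<in> {1..?L}} \<and> card (orbit \<sigma> j) = i. ?g k (card (orbit \<sigma> j)))
          = i * cycle_count n \<sigma> i * ?g k i"
        by (simp only: card_orbit_size[OF \<sigma>])
    qed
    finally show "(\<Sum>j<n. ?g k (card (orbit \<sigma> j))) = (\<Sum>i=1..?L. i * cycle_count n \<sigma> i * ?g k i)" .
  qed
  finally show ?thesis .
qed

section \<open>Character polynomials\<close>

definition mon_eval :: "('v \<Rightarrow> 'b::comm_semiring_1) \<Rightarrow> ('v \<Rightarrow>\<^sub>0 nat) \<Rightarrow> 'b" where
  "mon_eval f m = (\<Prod>v\<in>keys m. f v ^ lookup m v)"

lemma mon_eval_superset: "finite A \<Longrightarrow> keys m \<subseteq> A \<Longrightarrow> mon_eval f m = (\<Prod>v\<in>A. f v ^ lookup m v)"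
  unfolding mon_eval_def by (rule prod.mono_neutral_left) (auto simp: in_keys_iff)

lemma mon_eval_add: "mon_eval f (m + m') = mon_eval f m * mon_eval f m'"
proof -
  let ?A = "keys m \<union> keys m'"
  have "mon_eval f (m + m') = (\<Prod>v\<in>?A. f v ^ lookup (m + m') v)"
    using Poly_Mapping.keys_add[of m m'] by (intro mon_eval_superset) auto
  also have "\<dots> = (\<Prod>v\<in>?A. f v ^ lookup m v) * (\<Prod>v\<in>?A. f v ^ lookup m' v)"
    by (simp add: lookup_add power_add prod.distrib)
  finally show ?thesis by (simp add: mon_eval_superset[of ?A])
qed

lemma mpoly_subst_eq: "mpoly_subst id f P = (\<Sum>m\<in>keys P. lookup P m * mon_eval f m)"
  by (simp add: mpoly_subst_def mon_eval_def)

lemma mpoly_subst_add: "mpoly_subst id f (P + Q) = mpoly_subst id f P + mpoly_subst id f (Q :: ('v, 'b::comm_ring_1) mpoly)"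
  unfolding mpoly_subst_eq by (rule setsum_keys_plus_distrib) (auto simp: distrib_right)

lemma mpoly_subst_0: "mpoly_subst id f (0 :: ('v, 'b::comm_ring_1) mpoly) = 0"
  by (simp add: mpoly_subst_eq)

lemma mpoly_subst_sum: "mpoly_subst id f (sum g A) = (\<Sum>x\<in>A. mpoly_subst id f (g x :: ('v, 'b::comm_ring_1) mpoly))"
  by (induction A rule: infinite_finite_induct)
    (simp_all only: sum.infinite sum.empty sum.insert mpoly_subst_0 mpoly_subst_add not_False_eq_True)

lemma mpoly_subst_single: "mpoly_subst id f (single m c) = (c::'b::comm_ring_1) * mon_eval f m"
  by (cases "c = 0") (auto simp: mpoly_subst_eq)

lemma mpoly_subst_single_mult: "mpoly_subst id f (single m c * P) = c * mon_eval f m * mpoly_subst id f (P :: ('v, 'b::comm_ring_1) mpoly)"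
proof -
  have "single m c * P = (\<Sum>w\<in>keys P. single m c * single w (lookup P w))"
    by (rule mult_expand_right)
  then have "mpoly_subst id f (single m c * P) = (\<Sum>w\<in>keys P. mpoly_subst id f (single m c * single w (lookup P w)))"
    by (simp only: mpoly_subst_sum)
  then show ?thesis
    by (simp add: mult_single mpoly_subst_single mon_eval_add mpoly_subst_eq[of f P] sum_distrib_left ac_simps)
qed

definition wdeg :: "(nat \<Rightarrow>\<^sub>0 nat) \<Rightarrow> nat" where
  "wdeg m = (\<Sum>i\<in>keys m. i * lookup m i)"

lemma wdeg_add: "wdeg (m + m') = wdeg m + wdeg m'"
  unfolding wdeg_def by (rule setsum_keys_plus_distrib) (auto simp: distrib_left)

lemma wdeg_single: "wdeg (single i k) = i * k"
  by (simp add: wdeg_def)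

definition char_poly_on :: "nat \<Rightarrow> nat \<Rightarrow> (nat \<Rightarrow> (nat \<Rightarrow> nat) \<Rightarrow> rat) \<Rightarrow> bool" where
  "char_poly_on N d G \<longleftrightarrow> (\<exists>P. is_char_poly P \<and> char_poly_degree_le P d \<and>
     (\<forall>n\<ge>N. \<forall>\<sigma>. \<sigma> permutes {..<n} \<longrightarrow> char_poly_eval P n \<sigma> = G n \<sigma>))"

lemma char_poly_on_cong:
  assumes "char_poly_on N d G" "\<And>n \<sigma>. n \<ge> N \<Longrightarrow> \<sigma> permutes {..<n} \<Longrightarrow> G n \<sigma> = H n \<sigma>"
  shows "char_poly_on N d H"
  using assms unfolding char_poly_on_def by fastforce

lemma char_poly_on_mono:
  assumes "char_poly_on N d G" "N \<le> N'" "d \<le> d'"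
  shows "char_poly_on N' d' G"
  using assms unfolding char_poly_on_def char_poly_degree_le_def by (meson order_trans)

lemma char_poly_on_add:
  assumes "char_poly_on N d G" "char_poly_on N d H"
  shows "char_poly_on N d (\<lambda>n \<sigma>. G n \<sigma> + H n \<sigma>)"
proof -
  obtain P where P: "is_char_poly P" "char_poly_degree_le P d"
    "\<forall>n\<ge>N. \<forall>\<sigma>. \<sigma> permutes {..<n} \<longrightarrow> char_poly_eval P n \<sigma> = G n \<sigma>"
    using assms(1) by (auto simp: char_poly_on_def)
  obtain Q where Q: "is_char_poly Q" "char_poly_degree_le Q d"
    "\<forall>n\<ge>N. \<forall>\<sigma>. \<sigma> permutes {..<n} \<longrightarrow> char_poly_eval Q n \<sigma> = H n \<sigma>"
    using assms(2) by (auto simp: char_poly_on_def)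
  show ?thesis unfolding char_poly_on_def
    by (rule exI[of _ "P + Q"])
      (use P Q Poly_Mapping.keys_add[of P Q] in \<open>auto simp: is_char_poly_def char_poly_degree_le_def char_poly_eval_def mpoly_subst_add\<close>)
qed

lemma char_poly_on_const: "char_poly_on N d (\<lambda>n \<sigma>. c)"
  unfolding char_poly_on_def
  by (rule exI[of _ "single 0 c"])
    (auto simp: is_char_poly_def char_poly_degree_le_def char_poly_eval_def mpoly_subst_single mon_eval_def)

lemma char_poly_on_sum:
  "(\<And>x. x \<in> A \<Longrightarrow> char_poly_on N d (G x)) \<Longrightarrow> char_poly_on N d (\<lambda>n \<sigma>. \<Sum>x\<in>A. G x n \<sigma>)"
  by (induction A rule: infinite_finite_induct) (auto simp: char_poly_on_const intro: char_poly_on_add)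

lemma char_poly_on_mult_single:
  assumes "char_poly_on N d G" "0 \<notin> keys m"
  shows "char_poly_on N (wdeg m + d) (\<lambda>n \<sigma>. c * mon_eval (\<lambda>i. of_nat (cycle_count n \<sigma> i)) m * G n \<sigma>)"
proof -
  obtain P where P: "is_char_poly P" "char_poly_degree_le P d"
    "\<forall>n\<ge>N. \<forall>\<sigma>. \<sigma> permutes {..<n} \<longrightarrow> char_poly_eval P n \<sigma> = G n \<sigma>"
    using assms(1) by (auto simp: char_poly_on_def)
  have k: "\<exists>w\<in>keys P. x = m + w" if "x \<in> keys (single m c * P)" for x
    using that keys_mult[of "single m c" P] by (auto split: if_splits)
  have "is_char_poly (single m c * P)"
    unfolding is_char_poly_def
  proof
    fix x assume "x \<in> keys (single m c * P)"
    then obtain w where "w \<in> keys P" "x = m + w" using k by blast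
    then show "0 \<notin> keys x" using P(1) assms(2) Poly_Mapping.keys_add[of m w] by (auto simp: is_char_poly_def)
  qed
  moreover have "char_poly_degree_le (single m c * P) (wdeg m + d)"
    unfolding char_poly_degree_le_def wdeg_def[symmetric]
  proof
    fix x assume "x \<in> keys (single m c * P)"
    then obtain w where "w \<in> keys P" "x = m + w" using k by blast
    moreover have "wdeg w \<le> d" if "w \<in> keys P" for w
      using P(2) that by (simp add: char_poly_degree_le_def wdeg_def)
    ultimately show "wdeg x \<le> wdeg m + d" by (simp add: wdeg_add)
  qed
  ultimately show ?thesis using P(3) unfolding char_poly_on_def
    by (intro exI[of _ "single m c * P"]) (simp add: char_poly_eval_def mpoly_subst_single_mult)
qed

lemma char_poly_on_scale: "char_poly_on N d G \<Longrightarrow> char_poly_on N d (\<lambda>n \<sigma>. c * G n \<sigma>)"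
  using char_poly_on_mult_single[of N d G 0 c] by (simp add: wdeg_def mon_eval_def)

lemma char_poly_on_cycle_count:
  assumes "char_poly_on N d G" "i \<ge> 1"
  shows "char_poly_on N (i + d) (\<lambda>n \<sigma>. of_nat (cycle_count n \<sigma> i) * G n \<sigma>)"
proof -
  have "0 \<notin> keys (single i (1::nat))" using assms by auto
  from char_poly_on_mult_single[OF assms(1) this, of 1]
  show ?thesis by (simp add: wdeg_single mon_eval_def)
qed

lemma fixed_words_zero: "\<sigma> permutes {..<n} \<Longrightarrow> fixed_words r n \<sigma> 0 = {0}"
proof -
  assume \<sigma>: "\<sigma> permutes {..<n}"
  have "w = 0" if "mdeg w = 0" for w using that tdeg_mdeg[of w] by simp
  moreover have "relabel \<sigma> 0 = 0" by (rule relabel_fix) (use \<sigma> permutes_bij in auto)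
  ultimately show ?thesis by (auto simp: fixed_words_def)
qed

text \<open>In the recursion the factor \<open>X\<^sub>i\<close> of degree \<open>i\<close> comes with the number of fixed monomials in a degree that
  is smaller by \<open>k * i \<ge> i\<close>, so the bound on the degree is preserved.\<close>

lemma char_poly_on_fixed_words:
  assumes "keys D \<subseteq> {..<r}"
  shows "char_poly_on 0 (tdeg D) (\<lambda>n \<sigma>. of_nat (card (fixed_words r n \<sigma> D)))"
  using assms
proof (induction "tdeg D" arbitrary: D rule: less_induct)
  case less
  show ?case
  proof (cases "D = 0")
    case True
    then show ?thesis
      using char_poly_on_cong[OF char_poly_on_const[of 0 "tdeg D" 1]] by (simp add: fixed_words_zero)
  next
    case False
    then obtain a where a: "a \<in> keys D" by (metis equals0I keys_eq_empty)
    then have ar: "a < r" using less.prems by auto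
    let ?L = "lookup D a"
    have L: "?L > 0" using a by (simp add: in_keys_iff)
    let ?ok = "\<lambda>k i. D - single a (k * i) + single a (k * i) = D"
    let ?G = "\<lambda>k i n \<sigma>. if ?ok k i then (of_nat (card (fixed_words r n \<sigma> (D - single a (k * i)))) :: rat) else 0"
    have G: "char_poly_on 0 (tdeg D) (\<lambda>n \<sigma>. of_nat i * (of_nat (cycle_count n \<sigma> i) * ?G k i n \<sigma>))"
      if ki: "k \<in> {1..?L}" "i \<in> {1..?L}" for k i
    proof (cases "?ok k i")
      case True
      let ?D = "D - single a (k * i)"
      have t: "tdeg D = tdeg ?D + k * i" using True by (metis tdeg_add tdeg_single)
      have "keys ?D \<subseteq> keys D" by (auto simp: in_keys_iff lookup_minus)
      then have "char_poly_on 0 (tdeg ?D) (\<lambda>n \<sigma>. of_nat (card (fixed_words r n \<sigma> ?D)))"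
        using less.hyps[of ?D] less.prems t ki by auto
      then have "char_poly_on 0 (i + tdeg ?D) (\<lambda>n \<sigma>. of_nat (cycle_count n \<sigma> i) * of_nat (card (fixed_words r n \<sigma> ?D)))"
        using ki by (intro char_poly_on_cycle_count) auto
      then have "char_poly_on 0 (tdeg D) (\<lambda>n \<sigma>. of_nat (cycle_count n \<sigma> i) * of_nat (card (fixed_words r n \<sigma> ?D)))"
        by (rule char_poly_on_mono) (use t ki in auto)
      then show ?thesis using True by (simp add: char_poly_on_scale)
    next
      case False
      then show ?thesis using char_poly_on_const[of 0 "tdeg D" 0] by simp
    qed
    have "char_poly_on 0 (tdeg D) (\<lambda>n \<sigma>. inverse (of_nat ?L) *
       (\<Sum>k=1..?L. \<Sum>i=1..?L. of_nat i * (of_nat (cycle_count n \<sigma> i) * ?G k i n \<sigma>)))"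
      by (intro char_poly_on_scale char_poly_on_sum G)
    then show ?thesis
    proof (rule char_poly_on_cong)
      fix n :: nat and \<sigma> assume \<sigma>: "\<sigma> permutes {..<n}"
      have eq: "(of_nat (?L * card (fixed_words r n \<sigma> D)) :: rat) =
         (\<Sum>k=1..?L. \<Sum>i=1..?L. of_nat i * (of_nat (cycle_count n \<sigma> i) * ?G k i n \<sigma>))"
        unfolding fixed_words_recursion[OF \<sigma> ar] by (simp add: if_distrib[of of_nat] mult.assoc cong: if_cong)
      show "inverse (of_nat ?L) *
       (\<Sum>k=1..?L. \<Sum>i=1..?L. of_nat i * (of_nat (cycle_count n \<sigma> i) * ?G k i n \<sigma>)) = of_nat (card (fixed_words r n \<sigma> D))"
        unfolding eq[symmetric] of_nat_mult using L by simp
    qed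
  qed
qed

lemma cycle_count_id: "i \<ge> 1 \<Longrightarrow> cycle_count n id i = (if i = 1 then n else 0)"
proof -
  have o: "orbit id x = {x}" for x :: nat by (simp add: orbit_eq_singleton_iff)
  have "{C. \<exists>x<n. C = orbit id x \<and> card C = 1} = (\<lambda>x. {x}) ` {..<n}" by (auto simp: o)
  moreover have "card ((\<lambda>x. {x}) ` {..<n}) = n" by (simp add: card_image)
  moreover have "{C. \<exists>x<n. C = orbit id x \<and> card C = i} = {}" if "i \<noteq> 1" for i using that by (auto simp: o)
  ultimately show ?thesis by (auto simp: cycle_count_def)
qed

text \<open>The identity has \<open>n\<close> cycles of length \<open>1\<close> and no others, so all monomials that contain some \<open>X\<^sub>i\<close> with
  \<open>i \<noteq> 1\<close> vanish there.\<close>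

lemma char_poly_at_id:
  assumes "is_char_poly P" "char_poly_degree_le P d"
  obtains Q :: "rat poly" where "degree Q \<le> d" "\<And>n. char_poly_eval P n id = poly Q (of_nat n)"
proof -
  define q where "q m = (if keys m \<subseteq> {1} then Polynomial.monom (lookup P m) (lookup m 1) else 0 :: rat poly)" for m
  define Q where "Q = (\<Sum>m\<in>keys P. q m)"
  have "degree (q m) \<le> d" if m: "m \<in> keys P" for m
  proof -
    have "lookup m 1 \<le> (\<Sum>i\<in>keys m. i * lookup m i)"
    proof (cases "1 \<in> keys m")
      case True
      then show ?thesis using member_le_sum[of 1 "keys m" "\<lambda>i. i * lookup m i"] by simp
    qed (simp add: in_keys_iff)
    then have "lookup m 1 \<le> d" using assms(2) m by (force simp: char_poly_degree_le_def)
    then show ?thesis using degree_monom_le[of "lookup P m" "lookup m 1"] by (auto simp: q_def)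
  qed
  then have "degree Q \<le> d" unfolding Q_def by (intro degree_sum_le) auto
  moreover have "char_poly_eval P n id = poly Q (of_nat n)" for n
  proof -
    have "lookup P m * mon_eval (\<lambda>i. of_nat (cycle_count n id i)) m = poly (q m) (of_nat n)" if m: "m \<in> keys P" for m
    proof (cases "keys m \<subseteq> {1}")
      case True
      then have "mon_eval (\<lambda>i. of_nat (cycle_count n id i)) m = (of_nat n ^ lookup m 1 :: rat)"
        by (subst mon_eval_superset[of "{1}"]) (simp_all add: cycle_count_id)
      then show ?thesis using True by (simp add: q_def poly_monom)
    next
      case False
      then obtain i where i: "i \<in> keys m" "i \<noteq> 1" by blast
      have "i \<ge> 1" using i m assms(1) by (metis is_char_poly_def less_one not_le)
      then have "(of_nat (cycle_count n id i) :: rat) ^ lookup m i = 0"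
        using i cycle_count_id[of i n] by (simp add: in_keys_iff)
      then have "mon_eval (\<lambda>i. of_nat (cycle_count n id i) :: rat) m = 0"
        unfolding mon_eval_def using i(1) by (meson finite_keys prod_zero)
      then show ?thesis using False by (simp add: q_def)
    qed
    then show ?thesis by (simp add: char_poly_eval_def mpoly_subst_eq Q_def poly_sum)
  qed
  ultimately show thesis by (rule that)
qed

section \<open>The coinvariant algebra as a quotient ring\<close>

lemma diag_simps [simp]:
  "mult (diag_poly_ring r n) = (*)" "one (diag_poly_ring r n) = 1"
  "zero (diag_poly_ring r n) = 0" "add (diag_poly_ring r n) = (+)"
  by (simp_all add: diag_poly_ring_def)

lemma polys_1: "1 \<in> polys r S"
  using polys_Const[of 1 r S] by simp

lemma cring_diag: "cring (diag_poly_ring r n :: ('k::comm_ring_1) dpoly ring)"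
proof (rule cringI)
  show "abelian_group (diag_poly_ring r n :: 'k dpoly ring)"
  proof (rule abelian_groupI)
    fix x assume "x \<in> carrier (diag_poly_ring r n :: 'k dpoly ring)"
    then show "\<exists>y\<in>carrier (diag_poly_ring r n). y \<oplus>\<^bsub>diag_poly_ring r n\<^esub> x = \<zero>\<^bsub>diag_poly_ring r n\<^esub>"
      by (intro bexI[of _ "- x"]) (simp_all add: carrier_diag polys_uminus)
  qed (simp_all add: carrier_diag polys_add add_ac)
  show "comm_monoid (diag_poly_ring r n :: 'k dpoly ring)"
    by (rule comm_monoidI) (simp_all add: carrier_diag polys_mult polys_1 mult_ac)
qed (simp add: distrib_right)

lemma sym_ideal_is_ideal: "ideal (sym_ideal r n) (diag_poly_ring r n :: ('k::field_char_0) dpoly ring)"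
proof -
  interpret R: cring "diag_poly_ring r n :: 'k dpoly ring" by (rule cring_diag)
  show ?thesis
  proof (rule idealI[OF R.ring_axioms])
    show "subgroup (sym_ideal r n) (add_monoid (diag_poly_ring r n :: 'k dpoly ring))"
    proof (rule R.add.subgroupI)
      show "sym_ideal r n \<subseteq> carrier (diag_poly_ring r n :: 'k dpoly ring)"
        using sym_ideal_polys by (simp add: carrier_diag)
      show "sym_ideal r n \<noteq> ({} :: 'k dpoly set)" using sym_ideal_0 by blast
      fix a assume a: "a \<in> (sym_ideal r n :: 'k dpoly set)"
      then have "a \<in> polys r {..<n}" using sym_ideal_polys by blast
      then have "\<ominus>\<^bsub>diag_poly_ring r n\<^esub> a = - a"
        by (intro R.minus_equality) (simp_all add: carrier_diag polys_uminus)
      moreover have "- a = Const (- 1) * a" by (simp add: Const_uminus)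
      ultimately show "\<ominus>\<^bsub>diag_poly_ring r n\<^esub> a \<in> sym_ideal r n" using sym_ideal_scale[OF a] by metis
    next
      fix a b assume "a \<in> (sym_ideal r n :: 'k dpoly set)" "b \<in> (sym_ideal r n :: 'k dpoly set)"
      then show "a \<oplus>\<^bsub>diag_poly_ring r n\<^esub> b \<in> sym_ideal r n" by (simp add: sym_ideal_add)
    qed
  qed (simp_all add: carrier_diag sym_ideal_mult mult.commute[of _ "_ :: 'k dpoly"])
qed

lemma coinv_ideal_eq: "coinv_ideal r n = (sym_ideal r n :: ('k::field_char_0) dpoly set)"
proof
  interpret R: cring "diag_poly_ring r n :: 'k dpoly ring" by (rule cring_diag)
  let ?S = "{p \<in> carrier (diag_poly_ring r n :: 'k dpoly ring).
          (\<forall>\<sigma>. \<sigma> permutes {..<n} \<longrightarrow> perm_act \<sigma> p = p) \<and> Poly_Mapping.lookup p 0 = 0}"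
  show "coinv_ideal r n \<subseteq> (sym_ideal r n :: 'k dpoly set)"
    unfolding coinv_ideal_def
    by (rule R.genideal_minimal[OF sym_ideal_is_ideal]) (auto simp: carrier_diag intro: invariant_in_sym_ideal)
  interpret I: ideal "coinv_ideal r n" "diag_poly_ring r n :: 'k dpoly ring"
    unfolding coinv_ideal_def by (rule R.genideal_ideal) auto
  have S: "?S \<subseteq> coinv_ideal r n" unfolding coinv_ideal_def by (rule R.genideal_self) auto
  have l: "x * a \<in> coinv_ideal r n" if "a \<in> coinv_ideal r n" "x \<in> polys r {..<n}" for a x :: "'k dpoly"
    using I.I_l_closed[of a x] that by (simp add: carrier_diag)
  show "sym_ideal r n \<subseteq> (coinv_ideal r n :: 'k dpoly set)"
    unfolding sym_ideal_def
  proof (rule vs.span_minimal)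
    show "sym_ideal_gens r n \<subseteq> (coinv_ideal r n :: 'k dpoly set)"
    proof
      fix p :: "'k dpoly" assume "p \<in> sym_ideal_gens r n"
      then obtain \<mu> w where p: "p = msym r n \<mu> * single w 1" "\<mu> \<noteq> {#}" "w \<in> words r {..<n}"
        by (auto simp: sym_ideal_gens_def)
      have "(msym r n \<mu> :: 'k dpoly) \<in> ?S"
        using p(2) by (simp add: carrier_diag msym_polys msym_inv lookup_msym)
      then have "(msym r n \<mu> :: 'k dpoly) \<in> coinv_ideal r n" by (rule subsetD[OF S])
      from l[OF this polys_single[OF p(3)], of 1] show "p \<in> coinv_ideal r n"
        by (simp add: p(1) mult.commute)
    qed
    show "vs.subspace (coinv_ideal r n :: 'k dpoly set)"
    proof (rule vs.subspaceI)
      show "0 \<in> (coinv_ideal r n :: 'k dpoly set)" using I.zero_closed by simp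
      show "x + y \<in> coinv_ideal r n" if "x \<in> coinv_ideal r n" "y \<in> coinv_ideal r n" for x y :: "'k dpoly"
        using I.a_closed[OF that] by simp
      show "single 0 c * x \<in> coinv_ideal r n" if "x \<in> coinv_ideal r n" for c and x :: "'k dpoly"
        using l[OF that polys_Const[of c]] by (simp add: Const_def)
    qed
  qed
qed

lemma lookup_sym_ideal_0: "p \<in> sym_ideal r n \<Longrightarrow> lookup p 0 = 0"
  unfolding sym_ideal_def
proof (induction p rule: vs.span_induct_alt)
  case (step c x y)
  then have "lookup x 0 = 0" by (auto simp: sym_ideal_gens_def lookup_msym_mult_0)
  then show ?case using step(2) by (simp add: lookup_add flip: Const_def)
qed simp

text \<open>The ground field cannot be read off from \<open>r\<close> and \<open>n\<close>; the dummy parameter fixes its type.\<close>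

locale coinv =
  fixes r n :: nat and ty :: "'k::field_char_0 itself"
begin

abbreviation "R \<equiv> diag_poly_ring r n :: 'k dpoly ring"
abbreviation "A \<equiv> coinv_alg r n :: 'k dpoly set ring"
abbreviation "I \<equiv> sym_ideal r n :: 'k dpoly set"
abbreviation "cl \<equiv> coinv_class r n :: 'k dpoly \<Rightarrow> _"
abbreviation "h \<equiv> coinv_const r n :: 'k \<Rightarrow> _"
abbreviation "K \<equiv> range h"
abbreviation "P \<equiv> polys r {..<n} :: 'k dpoly set"

sublocale R: cring R by (rule cring_diag)
sublocale I: ideal I R by (rule sym_ideal_is_ideal)

lemma A_eq: "A = R Quot I" by (simp add: coinv_alg_def coinv_ideal_eq)

lemma cl_eq: "cl p = (\<lambda>x. x + p) ` I"
  by (auto simp: coinv_class_def coinv_ideal_eq a_r_coset_def')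

lemma cl_coset: "cl = (+>\<^bsub>R\<^esub>) I"
  by (rule ext) (simp add: coinv_class_def coinv_ideal_eq)

sublocale A: cring A unfolding A_eq by (rule I.quotient_is_cring[OF cring_diag])

sublocale H: ring_hom_ring R A cl
  unfolding A_eq cl_coset by (rule I.rcos_ring_hom_ring)

lemma I_diff: "x \<in> I \<Longrightarrow> y \<in> I \<Longrightarrow> x - y \<in> I"
  using vs.subspace_diff[OF subspace_sym_ideal] by blast

lemma cl_eq_iff: "cl p = cl q \<longleftrightarrow> p - q \<in> I"
proof
  assume "cl p = cl q"
  moreover have "p \<in> cl p" unfolding cl_eq by (rule image_eqI[of _ _ 0]) auto
  ultimately obtain x where "x \<in> I" "p = x + q" unfolding cl_eq by blast
  then show "p - q \<in> I" by simp
next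
  assume pq: "p - q \<in> I"
  have "cl p \<subseteq> cl q" if "p - q \<in> I" for p q
  proof
    fix y assume "y \<in> cl p"
    then obtain x where x: "x \<in> I" "y = x + p" unfolding cl_eq by blast
    have "y = (x + (p - q)) + q" by (simp add: x)
    moreover have "x + (p - q) \<in> I" using x that by (simp add: sym_ideal_add)
    ultimately show "y \<in> cl q" unfolding cl_eq by blast
  qed
  moreover have "q - p \<in> I" using I_diff[OF sym_ideal_0 pq] by simp
  ultimately show "cl p = cl q" using pq by blast
qed

lemma zero_A: "\<zero>\<^bsub>A\<^esub> = cl 0"
  using H.hom_zero by simp

lemma h_eq: "h c = cl (Const c)" by (simp add: coinv_const_def)

lemma h_inj: "h c = h d \<longleftrightarrow> c = d"
proof
  assume "h c = h d"
  then have "Const c - Const d \<in> I" by (simp add: h_eq cl_eq_iff)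
  then show "c = d" using lookup_sym_ideal_0 by (fastforce simp: lookup_minus Const_def)
qed simp

lemma h_0: "h 0 = \<zero>\<^bsub>A\<^esub>" by (simp add: h_eq zero_A)

lemma K_subfield: "subfield K A"
proof -
  let ?K = "range Const :: 'k dpoly set"
  have uminus: "\<ominus>\<^bsub>R\<^esub> Const c = Const (- c)" for c
    by (rule R.minus_equality) (simp_all add: carrier_diag polys_Const polys_uminus Const_uminus)
  have sub: "subring ?K R"
  proof (rule R.subringI)
    show "?K \<subseteq> carrier R" by (auto simp: carrier_diag polys_Const)
    show "\<one>\<^bsub>R\<^esub> \<in> ?K" using Const_1 by (metis diag_simps(2) rangeI)
  qed (auto simp: uminus simp flip: Const_mult Const_add)
  have "subfield ?K R"
  proof (rule R.subfieldI)
    show "subcring ?K R" by (rule R.subcringI'[OF sub])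
    show "Units (R\<lparr>carrier := ?K\<rparr>) = ?K - {\<zero>\<^bsub>R\<^esub>}"
    proof (intro equalityI subsetI)
      fix x assume "x \<in> Units (R\<lparr>carrier := ?K\<rparr>)"
      then obtain y where "x \<in> ?K" "x * y = 1" by (auto simp: Units_def)
      then show "x \<in> ?K - {\<zero>\<^bsub>R\<^esub>}" by auto
    next
      fix x assume x: "x \<in> ?K - {\<zero>\<^bsub>R\<^esub>}"
      then obtain c where "x = Const c" by auto
      with x have c: "x = Const c" "c \<noteq> 0" by auto
      then have "x * Const (inverse c) = 1" "Const (inverse c) * x = 1"
        by (simp_all flip: Const_mult)
      then show "x \<in> Units (R\<lparr>carrier := ?K\<rparr>)" using c(1) by (auto simp: Units_def)
    qed
  qed
  moreover have "\<one>\<^bsub>A\<^esub> \<noteq> \<zero>\<^bsub>A\<^esub>"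
    using h_inj[of 1 0] H.hom_one by (simp add: h_eq zero_A)
  ultimately have "subfield (cl ` ?K) A" by (rule H.img_is_subfield(2))
  moreover have "cl ` ?K = K" by (auto simp: h_eq)
  ultimately show ?thesis by simp
qed

lemma combine_cl:
  "set us \<subseteq> P \<Longrightarrow> length cs = length us \<Longrightarrow>
    A.combine (map h cs) (map cl us) = cl (lincomb (\<lambda>i. cs ! i) us)"
proof (induction us arbitrary: cs)
  case Nil
  then show ?case by (simp add: zero_A)
next
  case (Cons u us)
  obtain c cs' where cs: "cs = c # cs'" "length cs' = length us" using Cons.prems(2) by (cases cs) auto
  let ?s = "lincomb (\<lambda>i. cs' ! i) us"
  have "us ! i \<in> P" if "i < length us" for i using Cons.prems(1) nth_mem[OF that] by auto
  then have s: "?s \<in> P" by (intro polys_sum polys_scale) auto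
  have u: "u \<in> P" using Cons.prems by simp
  have "A.combine (map h cs) (map cl (u # us)) = cl (Const c) \<otimes>\<^bsub>A\<^esub> cl u \<oplus>\<^bsub>A\<^esub> cl ?s"
    using Cons.IH[OF _ cs(2)] Cons.prems(1) by (simp add: cs) (simp add: h_eq)
  also have "\<dots> = cl (Const c * u + ?s)"
    using H.hom_mult[of "Const c" u] H.hom_add[of "Const c * u" ?s] u s
    by (simp add: carrier_diag polys_Const polys_scale)
  also have "Const c * u + ?s = (\<Sum>i<length (u # us). Const (cs ! i) * (u # us) ! i)"
    by (simp add: cs sum.lessThan_Suc_shift del: sum.lessThan_Suc)
  finally show ?case .
qed

lemma Ks_cases:
  assumes "set Ks \<subseteq> K" obtains cs where "Ks = map h cs"
  using assms by (metis ex_map_conv image_iff subsetD)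

lemma Span_cl:
  assumes "set us \<subseteq> P"
  shows "A.Span K (map cl us) = {cl (lincomb c us) | c. True}"
proof -
  have U: "set (map cl us) \<subseteq> carrier A" using assms H.hom_closed by (auto simp: carrier_diag)
  have "a \<in> A.Span K (map cl us) \<longleftrightarrow> (\<exists>c. a = cl (lincomb c us))" for a
  proof
    assume "a \<in> A.Span K (map cl us)"
    then obtain Ks where Ks: "set Ks \<subseteq> K" "length Ks = length us" "a = A.combine Ks (map cl us)"
      using A.Span_mem_iff_length_version[OF K_subfield U] by auto
    obtain cs where "Ks = map h cs" using Ks_cases[OF Ks(1)] .
    then show "\<exists>c. a = cl (lincomb c us)"
      using combine_cl[OF assms, of cs] Ks by (intro exI[of _ "\<lambda>i. cs ! i"]) simp
  next
    assume "\<exists>c. a = cl (lincomb c us)"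
    then obtain c where c: "a = cl (lincomb c us)" by blast
    have "a = A.combine (map h (map c [0..<length us])) (map cl us)"
      using combine_cl[OF assms, of "map c [0..<length us]"] by (simp add: c)
    then show "a \<in> A.Span K (map cl us)"
      using A.Span_mem_iff_length_version[OF K_subfield U, of a]
      by (auto intro!: exI[of _ "map h (map c [0..<length us])"])
  qed
  then show ?thesis by blast
qed

abbreviation "V D \<equiv> homog r n D :: 'k dpoly set"

lemma V_P: "V D \<subseteq> P" by (auto simp: homog_def)

lemma lift_list:
  assumes "set Us \<subseteq> cl ` V D" obtains us where "Us = map cl us" "set us \<subseteq> V D"
proof -
  define g where "g U = (SOME v. v \<in> V D \<and> cl v = U)" for U
  have g: "g U \<in> V D \<and> cl (g U) = U" if "U \<in> set Us" for U
    unfolding g_def by (rule someI_ex) (use that assms in blast)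
  have "Us = map cl (map g Us)" using g by (simp add: map_idI)
  moreover have "set (map g Us) \<subseteq> V D" using g by auto
  ultimately show thesis by (rule that)
qed

lemma basis_mod_ideal_of_base:
  assumes us: "set us \<subseteq> V D" and ind: "A.independent K (map cl us)" and sp: "A.Span K (map cl us) = cl ` V D"
  shows "basis_mod_ideal r n D us"
  unfolding basis_mod_ideal_def
proof (intro conjI allI impI ballI)
  show "set us \<subseteq> V D" by (rule us)
  have uP: "set us \<subseteq> P" using us V_P by blast
  fix c i assume s: "lincomb c us \<in> I" and i: "i < length us"
  have "A.combine (map h (map c [0..<length us])) (map cl us) = \<zero>\<^bsub>A\<^esub>"
    using combine_cl[OF uP, of "map c [0..<length us]"] s cl_eq_iff[of _ 0] by (simp add: zero_A)
  then have "set (take (length (map cl us)) (map h (map c [0..<length us]))) \<subseteq> {\<zero>\<^bsub>A\<^esub>}"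
    by (intro A.independent_imp_trivial_combine[OF K_subfield ind]) auto
  then have "h (c i) = \<zero>\<^bsub>A\<^esub>" using i by (auto simp: subset_iff)
  then show "c i = 0" using h_inj[of "c i" 0] h_0 by simp
next
  have uP: "set us \<subseteq> P" using us V_P by blast
  fix v assume "v \<in> V D"
  then have "cl v \<in> A.Span K (map cl us)" using sp by blast
  then obtain c where "cl v = cl (lincomb c us)" unfolding Span_cl[OF uP] by blast
  then show "\<exists>c. v - lincomb c us \<in> I" using cl_eq_iff by blast
qed

lemma act_cl: "\<sigma> permutes {..<n} \<Longrightarrow> coinv_act \<sigma> (cl p) = cl (perm_act \<sigma> p)"
proof -
  assume \<sigma>: "\<sigma> permutes {..<n}"
  have b: "bij \<sigma>" using \<sigma> permutes_bij by blast
  have "perm_act \<sigma> ` I = I"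
  proof (intro equalityI subsetI)
    fix x assume "x \<in> perm_act \<sigma> ` I"
    then show "x \<in> I" using sym_ideal_perm_act[OF \<sigma>] by blast
  next
    fix x assume x: "x \<in> I"
    have "x = perm_act \<sigma> (perm_act (pinv \<sigma>) x)"
      using b by (simp add: perm_act_comp bij_imp_bij_inv bij_is_surj surj_iff[THEN iffD1])
        (rule poly_mapping_eqI, simp add: lookup_perm_act relabel_fix)
    then show "x \<in> perm_act \<sigma> ` I" using sym_ideal_perm_act[OF permutes_inv[OF \<sigma>] x] by blast
  qed
  then have "(\<lambda>x. x + perm_act \<sigma> p) ` I = (\<lambda>x. x + perm_act \<sigma> p) ` perm_act \<sigma> ` I" by simp
  also have "\<dots> = perm_act \<sigma> ` (\<lambda>x. x + p) ` I" by (simp add: image_image perm_act_add[OF b])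
  finally show ?thesis by (simp add: coinv_act_def cl_eq)
qed

abbreviation "is_matrix \<sigma> Us M \<equiv>
  \<forall>j<length Us. coinv_act \<sigma> (Us ! j) = A.combine (map (\<lambda>i. h (M i j)) [0..<length Us]) Us"

lemma trace_mod_ideal_of_matrix:
  assumes \<sigma>: "\<sigma> permutes {..<n}"
    and ind: "A.independent K Us" and sp: "A.Span K Us = cl ` V D"
    and M: "is_matrix \<sigma> Us M"
  shows "trace_mod_ideal r n D \<sigma> (\<Sum>i<length Us. M i i)"
proof -
  have "set Us \<subseteq> A.Span K Us" by (rule A.Span_base_incl[OF K_subfield A.independent_in_carrier[OF ind]])
  then obtain us where us: "Us = map cl us" "set us \<subseteq> V D" using lift_list sp by metis
  have uP: "set us \<subseteq> P" using us V_P by blast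
  have "basis_mod_ideal r n D us" by (rule basis_mod_ideal_of_base) (use us ind sp in auto)
  moreover have "perm_act \<sigma> (us ! j) - lincomb (\<lambda>i. M i j) us \<in> I" if j: "j < length us" for j
  proof -
    have "cl (perm_act \<sigma> (us ! j)) = A.combine (map h (map (\<lambda>i. M i j) [0..<length us])) (map cl us)"
      using M j act_cl[OF \<sigma>, of "us ! j"] by (simp add: us o_def)
    also have "\<dots> = cl (lincomb (\<lambda>i. M i j) us)"
      using combine_cl[OF uP, of "map (\<lambda>i. M i j) [0..<length us]"] by simp
    finally show ?thesis by (simp add: cl_eq_iff)
  qed
  ultimately show ?thesis unfolding trace_mod_ideal_def us(1) by auto
qed

lemma V_span: "\<exists>us. set us \<subseteq> V D \<and> A.Span K (map cl us) = cl ` V D"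
proof -
  let ?X = "{w \<in> words r {..<n}. mdeg w = D}"
  have "finite ?X"
    by (rule finite_subset[OF _ finite_words[of "{..<n}" r "tdeg D"]]) (auto simp flip: tdeg_mdeg)
  then obtain ws where ws: "set ws = ?X" "distinct ws" using finite_distinct_list by blast
  define us where "us = map (\<lambda>w. single w (1::'k)) ws"
  have us: "set us \<subseteq> V D" using ws by (auto simp: us_def intro!: homog_single)
  have uP: "set us \<subseteq> P" using us V_P by blast
  have "A.Span K (map cl us) = cl ` V D"
    unfolding Span_cl[OF uP]
  proof (intro equalityI subsetI)
    fix x assume "x \<in> {cl (lincomb c us) |c. True}"
    then obtain c where x: "x = cl (lincomb c us)" by blast
    have "us ! i \<in> V D" if "i < length us" for i using us nth_mem[OF that] by auto
    then have "lincomb c us \<in> V D" by (intro homog_sum homog_scale) auto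
    then show "x \<in> cl ` V D" using x by blast
  next
    fix x assume "x \<in> cl ` V D"
    then obtain v where v: "v \<in> V D" "x = cl v" by blast
    have "keys v \<subseteq> ?X" using v polys_keys by (auto simp: homog_def)
    have "v = (\<Sum>w\<in>keys v. single w (lookup v w))" by (rule poly_expand)
    also have "\<dots> = (\<Sum>w\<in>?X. single w (lookup v w))"
      by (rule sum.mono_neutral_left) (use \<open>keys v \<subseteq> ?X\<close> \<open>finite ?X\<close> in \<open>auto simp: in_keys_iff\<close>)
    also have "\<dots> = (\<Sum>i<length ws. single (ws ! i) (lookup v (ws ! i)))"
      using sum.reindex_bij_betw[OF bij_betw_nth[OF ws(2) refl refl], of "\<lambda>w. single w (lookup v w)"] ws(1) by simp
    also have "\<dots> = lincomb (\<lambda>i. lookup v (ws ! i)) us"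
      by (intro sum.cong) (auto simp: us_def single_eq_Const[of _ "lookup v _"])
    finally have "x = cl (lincomb (\<lambda>i. lookup v (ws ! i)) us)"
      unfolding v(2) by (rule arg_cong)
    then show "x \<in> {cl (lincomb c us) |c. True}"
      by (intro CollectI exI[of _ "\<lambda>i. lookup v (ws ! i)"]) simp
  qed
  then show ?thesis using us by blast
qed

lemma component_finite_dimension: "A.finite_dimension K (cl ` V D)"
proof -
  obtain us where us: "set us \<subseteq> V D" "A.Span K (map cl us) = cl ` V D" using V_span by blast
  have "set (map cl us) \<subseteq> carrier A" using us(1) V_P H.hom_closed by (force simp: carrier_diag)
  from A.Span_finite_dimension[OF K_subfield this] show ?thesis using us(2) by simp
qed

lemma component_base:
  obtains Us where "A.independent K Us" "A.Span K Us = cl ` V D" "length Us = A.dim K (cl ` V D)"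
proof -
  obtain m where m: "A.dimension m K (cl ` V D)"
    using component_finite_dimension by (rule A.finite_dimensionE')
  obtain Us where Us: "A.independent K Us" "length Us = m" "A.Span K Us = cl ` V D"
    using A.exists_base[OF K_subfield m] by blast
  have "A.dim K (cl ` V D) = m" using A.dimI[OF K_subfield m] by (simp add: over_def)
  then show thesis using that[OF Us(1,3)] Us(2) by simp
qed

text \<open>The component is stable under the action, so the images of the basis are combinations of it.\<close>

lemma matrix_exists:
  assumes \<sigma>: "\<sigma> permutes {..<n}" and ind: "A.independent K Us" and sp: "A.Span K Us = cl ` V D"
  shows "\<exists>M. is_matrix \<sigma> Us M"
proof -
  have U: "set Us \<subseteq> carrier A" by (rule A.independent_in_carrier[OF ind])
  have "set Us \<subseteq> A.Span K Us" by (rule A.Span_base_incl[OF K_subfield U])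
  have "\<exists>c. coinv_act \<sigma> (Us ! j) = A.combine (map (\<lambda>i. h (c i)) [0..<length Us]) Us" if j: "j < length Us" for j
  proof -
    have "Us ! j \<in> cl ` V D" using \<open>set Us \<subseteq> A.Span K Us\<close> sp j nth_mem by blast
    then obtain v where v: "v \<in> V D" "Us ! j = cl v" by blast
    have "coinv_act \<sigma> (Us ! j) \<in> A.Span K Us"
      unfolding v(2) act_cl[OF \<sigma>] sp using homog_perm_act[OF \<sigma> v(1)] by blast
    then obtain Ks where Ks: "set Ks \<subseteq> K" "length Ks = length Us" "coinv_act \<sigma> (Us ! j) = A.combine Ks Us"
      using A.Span_mem_iff_length_version[OF K_subfield U] by auto
    obtain cs where cs: "Ks = map h cs" using Ks_cases[OF Ks(1)] .
    then have "Ks = map (\<lambda>i. h (cs ! i)) [0..<length Us]"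
      using Ks(2) by (intro nth_equalityI) auto
    then show ?thesis using Ks(3) by blast
  qed
  then have "\<forall>j\<in>{..<length Us}. \<exists>c. coinv_act \<sigma> (Us ! j) = A.combine (map (\<lambda>i. h (c i)) [0..<length Us]) Us"
    by blast
  from bchoice[OF this] obtain C where
    "\<forall>j\<in>{..<length Us}. coinv_act \<sigma> (Us ! j) = A.combine (map (\<lambda>i. h (C j i)) [0..<length Us]) Us"
    by blast
  then show ?thesis by (intro exI[of _ "\<lambda>i j. C j i"]) simp
qed

lemma trace_mod_ideal_exists: "\<sigma> permutes {..<n} \<Longrightarrow> \<exists>t::'k. trace_mod_ideal r n D \<sigma> t"
proof -
  assume \<sigma>: "\<sigma> permutes {..<n}"
  obtain Us where Us: "A.independent K Us" "A.Span K Us = cl ` V D" by (rule component_base)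
  then show ?thesis using matrix_exists[OF \<sigma> Us] trace_mod_ideal_of_matrix[OF \<sigma> Us] by blast
qed

lemma trace_mod_ideal_lin_trace:
  assumes \<sigma>: "\<sigma> permutes {..<n}" and unique: "\<And>t::'k. trace_mod_ideal r n D \<sigma> t \<Longrightarrow> t = t0"
  shows "lin_trace A h (cl ` V D) (coinv_act \<sigma>) = t0"
proof -
  obtain Us where Us: "A.independent K Us" "A.Span K Us = cl ` V D" by (rule component_base)
  obtain M where M: "is_matrix \<sigma> Us M"
    using matrix_exists[OF \<sigma> Us] by blast
  have t0: "(\<Sum>i<length Us. M i i) = t0" by (rule unique[OF trace_mod_ideal_of_matrix[OF \<sigma> Us M]])
  show ?thesis unfolding lin_trace_def
  proof (rule the_equality)
    show "\<exists>Us M. A.independent K Us \<and> A.Span K Us = cl ` V D \<and>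
        is_matrix \<sigma> Us M \<and>
        t0 = (\<Sum>i<length Us. M i i)"
      by (rule exI[of _ Us], rule exI[of _ M], intro conjI, rule Us(1), rule Us(2), rule M, rule t0[symmetric])
  next
    fix t assume "\<exists>Us M. A.independent K Us \<and> A.Span K Us = cl ` V D \<and>
        is_matrix \<sigma> Us M \<and>
        t = (\<Sum>i<length Us. M i i)"
    then show "t = t0"
      by (elim exE conjE) (hypsubst, rule unique, rule trace_mod_ideal_of_matrix[OF \<sigma>])
  qed
qed

lemma trace_mod_ideal_dim: "trace_mod_ideal r n D id (of_nat (A.dim K (cl ` V D)) :: 'k)"
proof -
  obtain Us where Us: "A.independent K Us" "A.Span K Us = cl ` V D" "length Us = A.dim K (cl ` V D)"
    by (rule component_base)
  have "set Us \<subseteq> cl ` V D"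
    using A.Span_base_incl[OF K_subfield A.independent_in_carrier[OF Us(1)]] Us(2) by simp
  then obtain us where us: "Us = map cl us" "set us \<subseteq> V D" by (rule lift_list)
  have "basis_mod_ideal r n D us" by (rule basis_mod_ideal_of_base) (use us Us in auto)
  moreover have "perm_act id (us ! j) - lincomb (\<lambda>i. if i = j then 1 else 0) us \<in> I"
    if "j < length us" for j
  proof -
    have "perm_act id (us ! j) = us ! j"
      by (rule poly_mapping_eqI) (simp add: lookup_perm_act relabel_fix)
    moreover have "lincomb (\<lambda>i. if i = j then 1 else 0) us = (\<Sum>i<length us. if i = j then us ! i else 0)"
      by (intro sum.cong) auto
    ultimately show ?thesis using that by simp
  qed
  moreover have "of_nat (A.dim K (cl ` V D)) = (\<Sum>i<length us. if i = i then 1 else 0 :: 'k)"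
    using Us(3) us(1) by simp
  ultimately show ?thesis unfolding trace_mod_ideal_def
    by (intro exI[of _ us] exI[of _ "\<lambda>i j. if i = j then 1 else 0"]) blast
qed

end

section \<open>Characters of the multigraded components\<close>

text \<open>Induction on the degree by means of \<open>trace_mod_ideal_sum\<close>. The types other than the empty one
  give traces in smaller degrees, for which the claim is known. In particular the trace is unique.\<close>

lemma trace_mod_ideal_char_poly:
  assumes "keys D \<subseteq> {..<r}"
  shows "\<exists>P. is_char_poly P \<and> char_poly_degree_le P (tdeg D) \<and>
    (\<forall>n\<ge>3 * tdeg D. \<forall>\<sigma>. \<sigma> permutes {..<n} \<longrightarrow> (\<forall>t::'k::field_char_0. trace_mod_ideal r n D \<sigma> t \<longrightarrow> t = of_rat (char_poly_eval P n \<sigma>)))"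
  using assms
proof (induction "tdeg D" arbitrary: D rule: less_induct)
  case less
  let ?good = "\<lambda>D P. is_char_poly P \<and> char_poly_degree_le P (tdeg D) \<and>
    (\<forall>n\<ge>3 * tdeg D. \<forall>\<sigma>. \<sigma> permutes {..<n} \<longrightarrow> (\<forall>t::'k. trace_mod_ideal r n D \<sigma> t \<longrightarrow> t = of_rat (char_poly_eval P n \<sigma>)))"
  have "\<forall>E\<in>{E. tdeg E < tdeg D \<and> keys E \<subseteq> {..<r}}. \<exists>P. ?good E P"
    using less.hyps by blast
  from bchoice[OF this] obtain Q where Q: "\<And>E. tdeg E < tdeg D \<Longrightarrow> keys E \<subseteq> {..<r} \<Longrightarrow> ?good E (Q E)"
    by blast
  define M where "M = {\<mu> \<in> types r (tdeg D). D - sum_mset \<mu> + sum_mset \<mu> = D}"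
  have finM: "finite M" by (simp add: M_def finite_types)
  have M0: "{#} \<in> M" by (simp add: M_def)
  have small: "tdeg (D - sum_mset \<mu>) < tdeg D \<and> keys (D - sum_mset \<mu>) \<subseteq> {..<r}" if \<mu>: "\<mu> \<in> M - {{#}}" for \<mu>
  proof
    have "tdeg (D - sum_mset \<mu>) + wt \<mu> = tdeg D" using \<mu> by (metis (mono_tags, lifting) DiffD1 M_def mem_Collect_eq tdeg_add)
    moreover have "wt \<mu> \<noteq> 0" using is_type_tdeg_0[of r \<mu>] \<mu> by (auto simp: M_def types_iff)
    ultimately show "tdeg (D - sum_mset \<mu>) < tdeg D" by linarith
    have "keys (D - sum_mset \<mu>) \<subseteq> keys D" by (auto simp: in_keys_iff lookup_minus)
    then show "keys (D - sum_mset \<mu>) \<subseteq> {..<r}" using less.prems by blast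
  qed
  define G where "G n \<sigma> = of_nat (card (fixed_words r n \<sigma> D)) + (\<Sum>\<mu>\<in>M - {{#}}. (- 1) * char_poly_eval (Q (D - sum_mset \<mu>)) n \<sigma>)" for n \<sigma>
  have "char_poly_on (3 * tdeg D) (tdeg D) G"
    unfolding G_def
  proof (intro char_poly_on_add char_poly_on_sum char_poly_on_scale)
    show "char_poly_on (3 * tdeg D) (tdeg D) (\<lambda>n \<sigma>. of_nat (card (fixed_words r n \<sigma> D)))"
      by (rule char_poly_on_mono[OF char_poly_on_fixed_words[OF less.prems]]) auto
    fix \<mu> assume \<mu>: "\<mu> \<in> M - {{#}}"
    have "char_poly_on 0 (tdeg (D - sum_mset \<mu>)) (char_poly_eval (Q (D - sum_mset \<mu>)))"
      unfolding char_poly_on_def using Q small[OF \<mu>] by blast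
    then show "char_poly_on (3 * tdeg D) (tdeg D) (char_poly_eval (Q (D - sum_mset \<mu>)))"
      by (rule char_poly_on_mono) (use small[OF \<mu>] in auto)
  qed
  then obtain P where P: "is_char_poly P" "char_poly_degree_le P (tdeg D)"
    "\<And>n \<sigma>. n \<ge> 3 * tdeg D \<Longrightarrow> \<sigma> permutes {..<n} \<Longrightarrow> char_poly_eval P n \<sigma> = G n \<sigma>"
    unfolding char_poly_on_def by blast
  have "t = of_rat (char_poly_eval P n \<sigma>)"
    if n: "n \<ge> 3 * tdeg D" and \<sigma>: "\<sigma> permutes {..<n}" and t: "trace_mod_ideal r n D \<sigma> t" for n \<sigma> and t :: 'k
  proof -
    interpret coinv r n "TYPE('k)" .
    define s where "s E = (if E = D then t else of_rat (char_poly_eval (Q E) n \<sigma>))" for E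
    have s: "trace_mod_ideal r n (D - sum_mset \<mu>) \<sigma> (s (D - sum_mset \<mu>))" if \<mu>: "\<mu> \<in> M" for \<mu>
    proof (cases "\<mu> = {#}")
      case True
      then show ?thesis using t by (simp add: s_def)
    next
      case False
      then have sm: "tdeg (D - sum_mset \<mu>) < tdeg D" "keys (D - sum_mset \<mu>) \<subseteq> {..<r}" using small \<mu> by auto
      obtain t' :: 'k where t': "trace_mod_ideal r n (D - sum_mset \<mu>) \<sigma> t'" using trace_mod_ideal_exists[OF \<sigma>] by blast
      have "3 * tdeg (D - sum_mset \<mu>) \<le> n" using n sm by simp
      then have "t' = of_rat (char_poly_eval (Q (D - sum_mset \<mu>)) n \<sigma>)"
        using Q[OF sm] \<sigma> t' by blast
      moreover have "D - sum_mset \<mu> \<noteq> D" using sm(1) by auto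
      ultimately show ?thesis using t' by (simp add: s_def)
    qed
    have "(\<Sum>\<mu>\<in>M. s (D - sum_mset \<mu>)) = of_nat (card (fixed_words r n \<sigma> D))"
      unfolding M_def fixed_words_def
      by (rule trace_mod_ideal_sum[OF n \<sigma>]) (use s in \<open>auto simp: M_def\<close>)
    also have "(\<Sum>\<mu>\<in>M. s (D - sum_mset \<mu>)) = t + (\<Sum>\<mu>\<in>M - {{#}}. s (D - sum_mset \<mu>))"
      using finM M0 by (simp add: sum.remove s_def)
    also have "(\<Sum>\<mu>\<in>M - {{#}}. s (D - sum_mset \<mu>)) = (\<Sum>\<mu>\<in>M - {{#}}. of_rat (char_poly_eval (Q (D - sum_mset \<mu>)) n \<sigma>))"
    proof (rule sum.cong[OF refl])
      fix \<mu> assume "\<mu> \<in> M - {{#}}"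
      from small[OF this] have "D - sum_mset \<mu> \<noteq> D" by auto
      then show "s (D - sum_mset \<mu>) = of_rat (char_poly_eval (Q (D - sum_mset \<mu>)) n \<sigma>)" by (simp add: s_def)
    qed
    finally have "t = of_nat (card (fixed_words r n \<sigma> D)) - (\<Sum>\<mu>\<in>M - {{#}}. of_rat (char_poly_eval (Q (D - sum_mset \<mu>)) n \<sigma>))"
      by (simp add: algebra_simps)
    then show ?thesis using P(3)[OF n \<sigma>] by (simp add: G_def of_rat_add of_rat_diff of_rat_sum of_rat_minus sum_negf)
  qed
  then show ?case using P(1,2) by blast
qed

definition degree_vector :: "nat list \<Rightarrow> nat \<Rightarrow>\<^sub>0 nat" where
  "degree_vector J = (\<Sum>a<length J. single a (J ! a))"

lemma lookup_degree_vector: "lookup (degree_vector J) a = (if a < length J then J ! a else 0)"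
proof -
  have "lookup (degree_vector J) a = (\<Sum>b<length J. if b = a then J ! b else 0)"
    by (simp add: degree_vector_def lookup_sum lookup_single when_def)
  then show ?thesis by simp
qed

lemma keys_degree_vector: "keys (degree_vector J) \<subseteq> {..<length J}"
  by (auto simp: in_keys_iff lookup_degree_vector split: if_splits)

lemma tdeg_degree_vector: "tdeg (degree_vector J) = sum_list J"
  by (simp add: degree_vector_def tdeg_sum sum_list_sum_nth lessThan_atLeast0)

lemma coinv_component_eq:
  assumes "length J = r"
  shows "coinv_component r J n = coinv_class r n ` (homog r n (degree_vector J) :: ('k::field_char_0) dpoly set)"
proof -
  have "(\<forall>a<r. (\<Sum>j<n. lookup m (a, j)) = J ! a) \<longleftrightarrow> mdeg m = degree_vector J" if m: "m \<in> words r {..<n}" for m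
  proof -
    have out: "lookup (mdeg m) a = 0" if "\<not> a < r" for a
      unfolding lookup_mdeg[OF m] using m that by (intro sum.neutral) (auto simp: words_def in_keys_iff subset_iff)
    have "mdeg m = degree_vector J \<longleftrightarrow> (\<forall>a. lookup (mdeg m) a = lookup (degree_vector J) a)"
      by (auto intro: poly_mapping_eqI)
    also have "\<dots> \<longleftrightarrow> (\<forall>a<r. lookup (mdeg m) a = J ! a)"
      using out by (auto simp: lookup_degree_vector assms)
    finally show ?thesis by (simp add: lookup_mdeg[OF m])
  qed
  then have "{p \<in> carrier (diag_poly_ring r n). has_multidegree r J n p} = (homog r n (degree_vector J) :: 'k dpoly set)"
    using polys_keys by (fastforce simp: carrier_diag has_multidegree_def homog_def)
  then show ?thesis by (simp add: coinv_component_def)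
qed

theorem theorem1p11:
  fixes r :: nat and J :: "nat list"
  assumes "r \<ge> 1" and "length J = r"
  shows
    "(\<exists>N P. is_char_poly P \<and> char_poly_degree_le P (sum_list J) \<and>
        (\<forall>n\<ge>N. \<forall>\<sigma>. \<sigma> permutes {..<n} \<longrightarrow>
           (coinv_character r J n \<sigma> :: 'k::field_char_0) = of_rat (char_poly_eval P n \<sigma>))) \<and>
     (\<exists>Q :: rat poly. degree Q \<le> sum_list J \<and>
        (\<exists>N. \<forall>n\<ge>N.
           ring.finite_dimension (coinv_alg r n) (range (coinv_const r n :: 'k \<Rightarrow> _))
             (coinv_component r J n) \<and>
           of_nat (ring.dim (coinv_alg r n) (range (coinv_const r n :: 'k \<Rightarrow> _))
             (coinv_component r J n)) = poly Q (of_nat n)))"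
proof -
  let ?D = "degree_vector J"
  have "keys ?D \<subseteq> {..<r}" using keys_degree_vector[of J] assms by simp
  from trace_mod_ideal_char_poly[OF this, where 'k = 'k] obtain P where
    P: "is_char_poly P" "char_poly_degree_le P (sum_list J)"
    and eval: "\<And>n \<sigma> t. n \<ge> 3 * sum_list J \<Longrightarrow> \<sigma> permutes {..<n} \<Longrightarrow> trace_mod_ideal r n ?D \<sigma> (t::'k) \<Longrightarrow>
      t = of_rat (char_poly_eval P n \<sigma>)"
    unfolding tdeg_degree_vector by blast
  have char: "(coinv_character r J n \<sigma> :: 'k) = of_rat (char_poly_eval P n \<sigma>)"
    if n: "n \<ge> 3 * sum_list J" and \<sigma>: "\<sigma> permutes {..<n}" for n \<sigma>
  proof -
    interpret coinv r n "TYPE('k)" .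
    show ?thesis unfolding coinv_character_def coinv_component_eq[OF assms(2)]
      by (rule trace_mod_ideal_lin_trace[OF \<sigma> eval[OF n \<sigma>]])
  qed
  obtain Q :: "rat poly" where Q: "degree Q \<le> sum_list J" "\<And>n. char_poly_eval P n id = poly Q (of_nat n)"
    by (rule char_poly_at_id[OF P]) blast
  have dim: "ring.finite_dimension (coinv_alg r n) (range (coinv_const r n :: 'k \<Rightarrow> _)) (coinv_component r J n) \<and>
      of_nat (ring.dim (coinv_alg r n) (range (coinv_const r n :: 'k \<Rightarrow> _)) (coinv_component r J n)) = poly Q (of_nat n)"
    if n: "n \<ge> 3 * sum_list J" for n
  proof -
    interpret coinv r n "TYPE('k)" .
    have "of_nat (A.dim K (cl ` V ?D)) = (of_rat (char_poly_eval P n id) :: 'k)"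
      by (rule eval[OF n permutes_id trace_mod_ideal_dim])
    then have "of_rat (of_nat (A.dim K (cl ` V ?D))) = (of_rat (poly Q (of_nat n)) :: 'k)"
      by (simp add: Q(2))
    then have "of_nat (A.dim K (cl ` V ?D)) = poly Q (of_nat n)" by (simp only: of_rat_eq_iff)
    then show ?thesis using component_finite_dimension by (simp add: coinv_component_eq[OF assms(2)])
  qed
  show ?thesis using P char Q(1) dim by blast
qed

end
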